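(* Let $\mathcal K$ be a simplicial complex on $[m]$. The bicomplexes $\bigl(\bigoplus_{I\subset[m]}C^*(\mathcal K_I),d,d'\bigr)$ and $\bigl(R^*(\mathcal K),d,d'\bigr)$ are isomorphic. Therefore, $\mathit{HH}^*(\mathcal Z_{\mathcal K})$ is isomorphic to the first double cohomology of the bicomplex $\bigl(\Lambda[u_1,\dots,u_m]\otimes\mathbb Z[\mathcal K],d,d'\bigr)$: $$\mathit{HH}^*(\mathcal Z_{\mathcal K})\cong H\bigl(H\bigl(\Lambda[u_1,\dots,u_m]\otimes\mathbb Z[\mathcal K],d\bigr),d'\bigr).$$
   Context: $\mathcal K$ is a simplicial complex on the vertex set $[m]=\{1,\dots,m\}$ (containing $\varnothing$ and all singletons); $\mathcal K_I=\{J\in\mathcal K:J\subset I\}$ is the full subcomplex on $I\subset[m]$. For a finite set $I$ of integers and an integer $j$, $\varepsilon(j,I)=(-1)^{\#\{r\in I: r<j\}}$. (1) $C^*(\mathcal K_I)$ is the augmented simplicial cochain complex over $\mathbb Z$: $C^{q-1}(\mathcal K_I)$ is free on $\alpha_{L,I}$, $L\in\mathcal K_I$, $|L|=q\ge0$, placed in bidegree $(q-|I|,2|I|)$, with $d\alpha_{L,I}=\sum_{j\in I\setminus L,\,L\cup\{j\}\in\mathcal K}\varepsilon(j,L)\alpha_{L\cup\{j\},I}$. The second differential is $d'\alpha_{L,I}=(-1)^{|L|}\sum_{i\in I\setminus L}\varepsilon(i,I)\alpha_{L,I\setminus\{i\}}$ (i.e. $(-1)^{p+1}\sum_{i\in I}\varepsilon(i,I)$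 times the restriction $C^p(\mathcal K_I)\to C^p(\mathcal K_{I\setminus\{i\}})$). (2) $\mathbb Z[\mathcal K]=\mathbb Z[v_1,\dots,v_m]/(\prod_{i\in I}v_i: I\subset[m],I\notin\mathcal K)$ is the face ring. The Koszul algebra $\Lambda[u_1,\dots,u_m]\otimes\mathbb Z[\mathcal K]$ has $\mathrm{bideg}\,u_i=(-1,2)$, $\mathrm{bideg}\,v_i=(0,2)$, and two differentials that are derivations (graded Leibniz rule): $du_i=v_i$, $dv_i=0$ (bidegree $(1,0)$) and $d'u_i=1$, $d'v_i=0$ (bidegree $(1,-2)$). (3) $R^*(\mathcal K)\subset\Lambda[u_1,\dots,u_m]\otimes\mathbb Z[\mathcal K]$ is the subgroup with basis the monomials $u_Jv_I$ ($J\subset[m]$, $I\in\mathcal K$, $J\cap I=\varnothing$), with differentials $d,d'$ given by restriction: $d(u_Jv_I)=\sum_{k\in J}\varepsilon(k,J)u_{J\setminus\{k\}}v_{I\cup\{k\}}$ (with $v_{I\cup\{k\}}=0$ if $I\cup\{k\}\notin\mathcal K$), $d'(u_Jv_I)=\sum_{j\in J}\varepsilon(j,J)u_{J\setminus\{j\}}v_I$. It is known that the cohomology of $(R^*(\mathcal K),d)$ agrees with that of the Koszul algebra with respect to $d$ (both are $H^*(\mathcal Z_{\mathcal K})$, the cohomology of the moment-angle complex $\mathcal Z_{\mathcal K}=\bigcup_{I\in\mathcal K}\{z\in(D^2)^m:|z_j|=1\text{ if }j\notin I\}$). In each case $d$ and $d'$ anticommute. The double cohomology is $\mathit{HH}^*(\mathcal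 Z_{\mathcal K})=H\bigl(H\bigl(\bigoplus_{I\subset[m]}C^*(\mathcal K_I),d\bigr),d'\bigr)=H\bigl(\bigoplus_{I\subset[m]}\widetilde H^*(\mathcal K_I),d'\bigr)$, where $\widetilde H^p(\mathcal K_I)$ is in bidegree $(p+1-|I|,2|I|)$. The first double cohomology of a bicomplex $(A,d,d')$ is $H(H(A,d),d')$. *)

theory Defs
  imports "HOL-Algebra.QuotRing" "HOL-Algebra.Elementary_Groups" "HOL-Algebra.Free_Abelian_Groups"
begin

definition simplicial_complex_on :: "nat \<Rightarrow> nat set set \<Rightarrow> bool" where
  "simplicial_complex_on m K \<longleftrightarrow>
     K \<subseteq> Pow {1..m} \<and> {} \<in> K \<and> (\<forall>i\<in>{1..m}. {i} \<in> K) \<and> (\<forall>J\<in>K. \<forall>L. L \<subseteq> J \<longrightarrow> L \<in> K)"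

definition full_subcomplex :: "nat set set \<Rightarrow> nat set \<Rightarrow> nat set set" where
  "full_subcomplex K I = {J \<in> K. J \<subseteq> I}"

definition eps :: "nat \<Rightarrow> nat set \<Rightarrow> int" where
  "eps j I = (-1) ^ card {r \<in> I. r < j}"

section \<open>Bigraded groups and bicomplexes\<close>

text \<open>A bigraded group is represented by its total group together with the components
  of each bidegree, and a bicomplex by its total group together with two endomorphisms.\<close>

record 'a bigraded =
  total :: "'a monoid"
  piece :: "int \<Rightarrow> int \<Rightarrow> 'a set"

record 'a bicomplex = "'a bigraded" +
  diff :: "'a \<Rightarrow> 'a"
  diff' :: "'a \<Rightarrow> 'a"

definition bigraded_iso :: "('a, 'c) bigraded_scheme \<Rightarrow> ('b, 'd) bigraded_scheme \<Rightarrow> ('a \<Rightarrow> 'b) \<Rightarrow> bool" where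
  "bigraded_iso A B \<phi> \<longleftrightarrow>
     \<phi> \<in> iso (total A) (total B) \<and> (\<forall>p q. \<phi> ` piece A p q = piece B p q)"

definition bigraded_isomorphic :: "('a, 'c) bigraded_scheme \<Rightarrow> ('b, 'd) bigraded_scheme \<Rightarrow> bool" where
  "bigraded_isomorphic A B \<longleftrightarrow> (\<exists>\<phi>. bigraded_iso A B \<phi>)"

definition bicomplex_isomorphic :: "'a bicomplex \<Rightarrow> 'b bicomplex \<Rightarrow> bool" where
  "bicomplex_isomorphic A B \<longleftrightarrow>
     (\<exists>\<phi>. bigraded_iso A B \<phi> \<and>
        (\<forall>x\<in>carrier (total A). \<phi> (diff A x) = diff B (\<phi> x) \<and> \<phi> (diff' A x) = diff' B (\<phi> x)))"

text \<open>Cohomology of a bigraded group with respect to a differential: cocycles modulo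
  coboundaries. Its component of bidegree \<open>(p,q)\<close> consists of the classes of
  cocycles of bidegree \<open>(p,q)\<close>.\<close>

definition cohomology :: "('a, 'c) bigraded_scheme \<Rightarrow> ('a \<Rightarrow> 'a) \<Rightarrow> 'a set bigraded" where
  "cohomology A \<delta> =
     \<lparr>total = (total A)\<lparr>carrier := kernel (total A) (total A) \<delta>\<rparr> Mod (\<delta> ` carrier (total A)),
      piece = (\<lambda>p q. (\<lambda>x. (\<delta> ` carrier (total A)) #>\<^bsub>total A\<^esub> x) `
                        (piece A p q \<inter> kernel (total A) (total A) \<delta>))\<rparr>"

text \<open>The map induced on cohomology with respect to \<open>\<delta>\<close> by an endomorphism \<open>\<delta>'\<close> that
  commutes or anticommutes with \<open>\<delta>\<close>: the class of \<open>x\<close> is sent to the class of \<open>\<delta>' x\<close>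
  (the union is over all representatives, which have the same image).\<close>

definition induced_map :: "('a, 'c) bigraded_scheme \<Rightarrow> ('a \<Rightarrow> 'a) \<Rightarrow> ('a \<Rightarrow> 'a) \<Rightarrow> 'a set \<Rightarrow> 'a set" where
  "induced_map A \<delta> \<delta>' X = (\<Union>x\<in>X. (\<delta> ` carrier (total A)) #>\<^bsub>total A\<^esub> \<delta>' x)"

definition first_double_cohomology :: "'a bicomplex \<Rightarrow> 'a set set bigraded" where
  "first_double_cohomology A = cohomology (cohomology A (diff A)) (induced_map A (diff A) (diff' A))"


section \<open>The cochain bicomplex\<close>

text \<open>The pair \<open>(L, I)\<close> stands for the basis element \<open>\<alpha>\<^bsub>L,I\<^esub>\<close> of
  \<open>C\<^sup>*(K\<^sub>I)\<close>; the direct sum over \<open>I\<close> is the free abelian group on all pairs.\<close>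

definition cochain_basis :: "nat \<Rightarrow> nat set set \<Rightarrow> (nat set \<times> nat set) set" where
  "cochain_basis m K = {(L, I). I \<subseteq> {1..m} \<and> L \<in> full_subcomplex K I}"

definition cochain_d :: "nat set set \<Rightarrow> ((nat set \<times> nat set) \<Rightarrow>\<^sub>0 int) \<Rightarrow> ((nat set \<times> nat set) \<Rightarrow>\<^sub>0 int)" where
  "cochain_d K = frag_extend (\<lambda>(L, I).
     \<Sum>j \<in> {j \<in> I - L. insert j L \<in> K}. frag_cmul (eps j L) (frag_of (insert j L, I)))"

definition cochain_d' :: "((nat set \<times> nat set) \<Rightarrow>\<^sub>0 int) \<Rightarrow> ((nat set \<times> nat set) \<Rightarrow>\<^sub>0 int)" where
  "cochain_d' = frag_extend (\<lambda>(L, I).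
     frag_cmul ((-1) ^ card L) (\<Sum>i \<in> I - L. frag_cmul (eps i I) (frag_of (L, I - {i}))))"

definition cochain_bicomplex :: "nat \<Rightarrow> nat set set \<Rightarrow> ((nat set \<times> nat set) \<Rightarrow>\<^sub>0 int) bicomplex" where
  "cochain_bicomplex m K =
     \<lparr>total = free_Abelian_group (cochain_basis m K),
      piece = (\<lambda>p q. carrier (free_Abelian_group
        {(L, I) \<in> cochain_basis m K. p = int (card L) - int (card I) \<and> q = 2 * int (card I)})),
      diff = cochain_d K,
      diff' = cochain_d'\<rparr>"

text \<open>\<open>HH\<^sup>*(Z\<^sub>K)\<close>.\<close>

definition HH :: "nat \<Rightarrow> nat set set \<Rightarrow> ((nat set \<times> nat set) \<Rightarrow>\<^sub>0 int) set set bigraded" where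
  "HH m K = first_double_cohomology (cochain_bicomplex m K)"


section \<open>The face ring\<close>

type_synonym ipoly = "(nat \<Rightarrow>\<^sub>0 nat) \<Rightarrow>\<^sub>0 int"

text \<open>\<^typ>\<open>ipoly\<close> with the multiplication of \<^theory>\<open>HOL-Library.Poly_Mapping\<close> is the polynomial
  ring over \<open>\<int>\<close> in variables indexed by \<^typ>\<open>nat\<close>, of which only \<open>1..m\<close> are used.\<close>

definition poly_ring :: "nat \<Rightarrow> ipoly ring" where
  "poly_ring m =
     \<lparr>carrier = {p. \<forall>a \<in> Poly_Mapping.keys p. Poly_Mapping.keys a \<subseteq> {1..m}},
      monoid.mult = (*), one = 1, ring.zero = 0, add = (+)\<rparr>"

definition var :: "nat \<Rightarrow> ipoly" where
  "var i = Poly_Mapping.single (Poly_Mapping.single i 1) 1"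

definition stanley_reisner_ideal :: "nat \<Rightarrow> nat set set \<Rightarrow> ipoly set" where
  "stanley_reisner_ideal m K = genideal (poly_ring m) {\<Prod>i\<in>I. var i | I. I \<subseteq> {1..m} \<and> I \<notin> K}"

definition face_ring :: "nat \<Rightarrow> nat set set \<Rightarrow> ipoly set ring" where
  "face_ring m K = poly_ring m Quot stanley_reisner_ideal m K"

definition face_class :: "nat \<Rightarrow> nat set set \<Rightarrow> ipoly \<Rightarrow> ipoly set" where
  "face_class m K p = stanley_reisner_ideal m K +>\<^bsub>poly_ring m\<^esub> p"


section \<open>The Koszul algebra\<close>

text \<open>The exterior algebra on \<open>u\<^sub>1, \<dots>, u\<^sub>m\<close> is free on the increasing products
  \<open>u\<^sub>J\<close>, so an element \<open>\<Sum>\<^sub>J u\<^sub>J \<otimes> f\<^sub>J\<close> of its tensor product with the face ring is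
  the family of its coefficients \<open>f\<^sub>J\<close>. The product is determined by
  \<open>u\<^sub>A u\<^sub>B = \<plusminus> u\<^bsub>A \<union> B\<^esub>\<close> for disjoint \<open>A\<close>, \<open>B\<close>, with the sign of the permutation
  sorting \<open>A\<close> followed by \<open>B\<close>, and \<open>u\<^sub>A u\<^sub>B = 0\<close> otherwise.\<close>

definition shuffle_sign :: "nat set \<Rightarrow> nat set \<Rightarrow> int" where
  "shuffle_sign A B = (-1) ^ card {(a, b). a \<in> A \<and> b \<in> B \<and> b < a}"

definition koszul_algebra :: "nat \<Rightarrow> nat set set \<Rightarrow> (nat set \<Rightarrow> ipoly set) ring" where
  "koszul_algebra m K =
     \<lparr>carrier = Pow {1..m} \<rightarrow>\<^sub>E carrier (face_ring m K),
      monoid.mult = (\<lambda>f g. \<lambda>J\<in>Pow {1..m}. \<Oplus>\<^bsub>face_ring m K\<^esub>A\<in>Pow J.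
        [shuffle_sign A (J - A)] \<cdot>\<^bsub>face_ring m K\<^esub> (f A \<otimes>\<^bsub>face_ring m K\<^esub> g (J - A))),
      one = (\<lambda>J\<in>Pow {1..m}. if J = {} then \<one>\<^bsub>face_ring m K\<^esub> else \<zero>\<^bsub>face_ring m K\<^esub>),
      ring.zero = (\<lambda>J\<in>Pow {1..m}. \<zero>\<^bsub>face_ring m K\<^esub>),
      add = (\<lambda>f g. \<lambda>J\<in>Pow {1..m}. f J \<oplus>\<^bsub>face_ring m K\<^esub> g J)\<rparr>"

text \<open>\<open>u\<^sub>J \<otimes> p\<close>\<close>

definition koszul_elem :: "nat \<Rightarrow> nat set set \<Rightarrow> nat set \<Rightarrow> ipoly \<Rightarrow> nat set \<Rightarrow> ipoly set" where
  "koszul_elem m K J p =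
     (\<lambda>J'\<in>Pow {1..m}. if J' = J then face_class m K p else \<zero>\<^bsub>face_ring m K\<^esub>)"

abbreviation koszul_u :: "nat \<Rightarrow> nat set set \<Rightarrow> nat \<Rightarrow> nat set \<Rightarrow> ipoly set" where
  "koszul_u m K i \<equiv> koszul_elem m K {i} 1"

abbreviation koszul_v :: "nat \<Rightarrow> nat set set \<Rightarrow> nat \<Rightarrow> nat set \<Rightarrow> ipoly set" where
  "koszul_v m K i \<equiv> koszul_elem m K {} (var i)"

text \<open>The component of bidegree \<open>(p,q)\<close> is spanned by the monomials
  \<open>u\<^sub>J v\<^sub>1\<^bsup>a 1\<^esup> \<cdots> v\<^sub>m\<^bsup>a m\<^esup>\<close> of that bidegree, where \<open>u\<^sub>i\<close> has
  bidegree \<open>(-1,2)\<close> and \<open>v\<^sub>i\<close> has bidegree \<open>(0,2)\<close>.\<close>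

definition koszul_piece :: "nat \<Rightarrow> nat set set \<Rightarrow> int \<Rightarrow> int \<Rightarrow> (nat set \<Rightarrow> ipoly set) set" where
  "koszul_piece m K p q = generate (add_monoid (koszul_algebra m K))
     {koszul_elem m K J (\<Prod>i=1..m. var i ^ a i) | J a.
        J \<subseteq> {1..m} \<and> p = - int (card J) \<and> q = 2 * int (card J) + 2 * int (\<Sum>i=1..m. a i)}"

text \<open>The additive maps \<open>\<theta>\<close> satisfying the graded Leibniz rule (with respect to the total
  degree) with \<open>\<theta> u\<^sub>i = w i\<close> and \<open>\<theta> v\<^sub>i = 0\<close>. Extensionality only fixes the irrelevant
  values outside the carrier; it makes \<open>\<theta>\<close> unique, see
  \<open>koszul_derivation_ex1\<close> below.\<close>

definition is_koszul_derivation :: "nat \<Rightarrow> nat set set \<Rightarrow> (nat \<Rightarrow> nat set \<Rightarrow> ipoly set) \<Rightarrow>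
    ((nat set \<Rightarrow> ipoly set) \<Rightarrow> (nat set \<Rightarrow> ipoly set)) \<Rightarrow> bool" where
  "is_koszul_derivation m K w \<theta> \<longleftrightarrow>
     (let E = koszul_algebra m K in
       \<theta> \<in> extensional (carrier E) \<and>
       \<theta> \<in> hom (add_monoid E) (add_monoid E) \<and>
       (\<forall>p q. \<forall>x\<in>koszul_piece m K p q. \<forall>y\<in>carrier E.
          \<theta> (x \<otimes>\<^bsub>E\<^esub> y) = \<theta> x \<otimes>\<^bsub>E\<^esub> y \<oplus>\<^bsub>E\<^esub> (if even (p + q) then x else \<ominus>\<^bsub>E\<^esub> x) \<otimes>\<^bsub>E\<^esub> \<theta> y) \<and>
       (\<forall>i\<in>{1..m}. \<theta> (koszul_u m K i) = w i \<and> \<theta> (koszul_v m K i) = \<zero>\<^bsub>E\<^esub>))"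

definition koszul_d :: "nat \<Rightarrow> nat set set \<Rightarrow> (nat set \<Rightarrow> ipoly set) \<Rightarrow> (nat set \<Rightarrow> ipoly set)" where
  "koszul_d m K = (THE \<theta>. is_koszul_derivation m K (koszul_v m K) \<theta>)"

definition koszul_d' :: "nat \<Rightarrow> nat set set \<Rightarrow> (nat set \<Rightarrow> ipoly set) \<Rightarrow> (nat set \<Rightarrow> ipoly set)" where
  "koszul_d' m K = (THE \<theta>. is_koszul_derivation m K (\<lambda>_. \<one>\<^bsub>koszul_algebra m K\<^esub>) \<theta>)"

definition koszul_bicomplex :: "nat \<Rightarrow> nat set set \<Rightarrow> (nat set \<Rightarrow> ipoly set) bicomplex" where
  "koszul_bicomplex m K =
     \<lparr>total = add_monoid (koszul_algebra m K),
      piece = koszul_piece m K,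
      diff = koszul_d m K,
      diff' = koszul_d' m K\<rparr>"


section \<open>The subcomplex \<open>R\<^sup>*(K)\<close>\<close>

text \<open>The subgroup spanned by the monomials \<open>u\<^sub>J v\<^sub>I\<close>, with bigrading and differentials
  restricted from the Koszul algebra.\<close>

definition R_group :: "nat \<Rightarrow> nat set set \<Rightarrow> (nat set \<Rightarrow> ipoly set) monoid" where
  "R_group m K = subgroup_generated (add_monoid (koszul_algebra m K))
     {koszul_elem m K J (\<Prod>i\<in>I. var i) | J I. J \<subseteq> {1..m} \<and> I \<in> K \<and> J \<inter> I = {}}"

definition R_bicomplex :: "nat \<Rightarrow> nat set set \<Rightarrow> (nat set \<Rightarrow> ipoly set) bicomplex" where
  "R_bicomplex m K =
     \<lparr>total = R_group m K,
      piece = (\<lambda>p q. koszul_piece m K p q \<inter> carrier (R_group m K)),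
      diff = koszul_d m K,
      diff' = koszul_d' m K\<rparr>"


section \<open>The Koszul differentials are well defined\<close>

text \<open>A derivation with prescribed values on the generators exists and is unique, so the
  definite descriptions in \<^const>\<open>koszul_d\<close> and \<^const>\<open>koszul_d'\<close> denote.\<close>

subsection \<open>The Leibniz rule on coefficients\<close>

lemma shuffle_sign_insert_left:
  assumes "finite A" "finite B" "k \<notin> A"
  shows "shuffle_sign (insert k A) B = eps k B * shuffle_sign A B"
proof -
  let ?S = "{(a, b). a \<in> A \<and> b \<in> B \<and> b < a}"
  have 1: "{(a, b). a \<in> insert k A \<and> b \<in> B \<and> b < a} = Pair k ` {b \<in> B. b < k} \<union> ?S"
    by auto
  have fin: "finite ?S"
    by (rule finite_subset[of _ "A \<times> B"]) (use assms in auto)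
  have "card (Pair k ` {b \<in> B. b < k} \<union> ?S) = card (Pair k ` {b \<in> B. b < k}) + card ?S"
    by (rule card_Un_disjoint) (use assms fin in auto)
  moreover have "card (Pair k ` {b \<in> B. b < k}) = card {b \<in> B. b < k}"
    by (simp add: card_image inj_on_def)
  ultimately show ?thesis
    unfolding shuffle_sign_def 1 eps_def by (simp add: power_add)
qed

lemma shuffle_sign_insert_right:
  assumes "finite A" "finite B" "k \<notin> A" "k \<notin> B"
  shows "shuffle_sign A (insert k B) = (-1) ^ card A * eps k A * shuffle_sign A B"
proof -
  let ?S = "{(a, b). a \<in> A \<and> b \<in> B \<and> b < a}"
  have 1: "{(a, b). a \<in> A \<and> b \<in> insert k B \<and> b < a} = (\<lambda>a. (a, k)) ` {a \<in> A. k < a} \<union> ?S"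
    by auto
  have fin: "finite ?S"
    by (rule finite_subset[of _ "A \<times> B"]) (use assms in auto)
  have 2: "card ((\<lambda>a. (a, k)) ` {a \<in> A. k < a} \<union> ?S)
      = card ((\<lambda>a. (a, k)) ` {a \<in> A. k < a}) + card ?S"
    by (rule card_Un_disjoint) (use assms fin in auto)
  have 3: "card ((\<lambda>a. (a, k)) ` {a \<in> A. k < a}) = card {a \<in> A. k < a}"
    by (simp add: card_image inj_on_def)
  have "card ({a \<in> A. k < a} \<union> {a \<in> A. a < k}) = card {a \<in> A. k < a} + card {a \<in> A. a < k}"
  proof (rule card_Un_disjoint)
    show "finite {a \<in> A. k < a}" "finite {a \<in> A. a < k}"
      using assms(1) by simp_all
    show "{a \<in> A. k < a} \<inter> {a \<in> A. a < k} = {}"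
      by (rule equals0I) (metis (no_types, lifting) IntE mem_Collect_eq less_asym)
  qed
  moreover have "{a \<in> A. k < a} \<union> {a \<in> A. a < k} = A"
  proof (rule Set.set_eqI)
    fix x
    have "x \<in> A \<Longrightarrow> x < k \<or> k < x" using assms(3) by (metis linorder_neqE_nat)
    then show "x \<in> {a \<in> A. k < a} \<union> {a \<in> A. a < k} \<longleftrightarrow> x \<in> A" by blast
  qed
  ultimately have 4: "card A = card {a \<in> A. k < a} + card {a \<in> A. a < k}" by simp
  have "(-1) ^ card A * eps k A = (-1::int) ^ card {a \<in> A. k < a}"
    unfolding eps_def 4 by (simp add: power_add mult.assoc)
  then show ?thesis
    unfolding shuffle_sign_def 1 2 3 by (simp add: power_add)
qed

lemma eps_insert [simp]: "eps k (insert k A) = eps k A"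
  unfolding eps_def by (rule arg_cong[where f = "\<lambda>S. (-1) ^ card S"]) auto

lemma eps_Un:
  assumes "finite A" "finite B" "A \<inter> B = {}"
  shows "eps k (A \<union> B) = eps k A * eps k B"
proof -
  have "{r \<in> A \<union> B. r < k} = {r \<in> A. r < k} \<union> {r \<in> B. r < k}" by auto
  moreover have "card ({r \<in> A. r < k} \<union> {r \<in> B. r < k}) = card {r \<in> A. r < k} + card {r \<in> B. r < k}"
    by (rule card_Un_disjoint) (use assms in auto)
  ultimately show ?thesis by (simp add: eps_def power_add)
qed

text \<open>The product and the derivation \<open>u\<^sub>k \<mapsto> W k\<close> on families of coefficients in an arbitrary
  commutative ring.\<close>

definition emul :: "(nat set \<Rightarrow> 'r::comm_ring_1) \<Rightarrow> (nat set \<Rightarrow> 'r) \<Rightarrow> nat set \<Rightarrow> 'r" where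
  "emul F G J = (\<Sum>A\<in>Pow J. of_int (shuffle_sign A (J - A)) * (F A * G (J - A)))"

definition eder :: "nat set \<Rightarrow> (nat \<Rightarrow> 'r::comm_ring_1) \<Rightarrow> (nat set \<Rightarrow> 'r) \<Rightarrow> nat set \<Rightarrow> 'r" where
  "eder V W F J = (\<Sum>k\<in>V - J. of_int (eps k J) * (W k * F (insert k J)))"

lemma sum_Pow_insert:
  fixes f :: "'a set \<Rightarrow> 'b::comm_monoid_add"
  assumes "finite J" "k \<notin> J"
  shows "(\<Sum>B\<in>Pow (insert k J). f B) = (\<Sum>A\<in>Pow J. f (insert k A)) + (\<Sum>A\<in>Pow J. f A)"
proof -
  have "Pow (insert k J) = Pow J \<union> insert k ` Pow J" by (rule Pow_insert)
  moreover have "Pow J \<inter> insert k ` Pow J = {}" using assms by auto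
  moreover have "inj_on (insert k) (Pow J)"
    using assms by (auto simp: inj_on_def)
  ultimately show ?thesis
    using assms by (simp add: sum.union_disjoint sum.reindex add.commute)
qed

lemma eder_emul:
  fixes F G :: "nat set \<Rightarrow> 'r::comm_ring_1"
  assumes V: "finite V" "J \<subseteq> V" and F: "\<And>A. A \<subseteq> V \<Longrightarrow> card A \<noteq> n \<Longrightarrow> F A = 0"
  shows "eder V W (emul F G) J = emul (eder V W F) G J + (-1) ^ n * emul F (eder V W G) J"
proof -
  have fin: "finite J" and finA: "A \<subseteq> V \<Longrightarrow> finite A" for A
    using V finite_subset by auto
  define T1 T2 where "T1 A k = of_int (shuffle_sign A (J - A)) * of_int (eps k A) * W k * F (insert k A) * G (J - A)"
    and "T2 A k = of_int (shuffle_sign A (J - A)) * (-1) ^ n * of_int (eps k (J - A)) * W k * F A * G (insert k (J - A))"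
  for A k
  have L: "eder V W (emul F G) J = (\<Sum>k\<in>V - J. \<Sum>A\<in>Pow J. T1 A k + T2 A k)"
    unfolding eder_def
  proof (rule sum.cong[OF refl])
    fix k assume k: "k \<in> V - J"
    have "of_int (eps k J) * (W k * emul F G (insert k J)) =
      (\<Sum>A\<in>Pow J. of_int (eps k J) * (W k * (of_int (shuffle_sign (insert k A) (insert k J - insert k A)) *
           (F (insert k A) * G (insert k J - insert k A))))) +
      (\<Sum>A\<in>Pow J. of_int (eps k J) * (W k * (of_int (shuffle_sign A (insert k J - A)) *
           (F A * G (insert k J - A)))))"
      unfolding emul_def using k fin by (subst sum_Pow_insert) (auto simp: sum_distrib_left distrib_left)
    also have "(\<Sum>A\<in>Pow J. of_int (eps k J) * (W k * (of_int (shuffle_sign (insert k A) (insert k J - insert k A)) *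
           (F (insert k A) * G (insert k J - insert k A))))) = (\<Sum>A\<in>Pow J. T1 A k)"
    proof (rule sum.cong[OF refl])
      fix A assume "A \<in> Pow J"
      then have A: "A \<subseteq> J" "finite A" "k \<notin> A" using fin k by (auto intro: finite_subset)
      have e: "insert k J - insert k A = J - A" using k A by auto
      have "eps k J = eps k A * eps k (J - A)"
        using eps_Un[of A "J - A" k] A fin by (simp add: Un_absorb1)
      moreover have "eps k (J - A) * eps k (J - A) = 1" by (simp add: eps_def)
      ultimately have "eps k J * shuffle_sign (insert k A) (J - A) = shuffle_sign A (J - A) * eps k A"
        using shuffle_sign_insert_left[of A "J - A" k] A fin by (simp add: algebra_simps)
      from arg_cong[OF this, of "of_int :: int \<Rightarrow> 'r"]
      have *: "of_int (eps k J) * of_int (shuffle_sign (insert k A) (J - A)) = (of_int (shuffle_sign A (J - A)) * of_int (eps k A) :: 'r)"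
        by (simp only: of_int_mult)
      have "of_int (eps k J) * (W k * (of_int (shuffle_sign (insert k A) (J - A)) * (F (insert k A) * G (J - A))))
          = (of_int (eps k J) * of_int (shuffle_sign (insert k A) (J - A))) * (W k * (F (insert k A) * G (J - A)))"
        by (simp only: mult_ac)
      then show "of_int (eps k J) * (W k * (of_int (shuffle_sign (insert k A) (insert k J - insert k A)) *
           (F (insert k A) * G (insert k J - insert k A)))) = T1 A k"
        unfolding e T1_def * by (simp only: mult_ac)
    qed
    also have "(\<Sum>A\<in>Pow J. of_int (eps k J) * (W k * (of_int (shuffle_sign A (insert k J - A)) *
           (F A * G (insert k J - A))))) = (\<Sum>A\<in>Pow J. T2 A k)"
    proof (rule sum.cong[OF refl])
      fix A assume "A \<in> Pow J"
      then have A: "A \<subseteq> J" "finite A" "k \<notin> A" using fin k by (auto intro: finite_subset)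
      have e: "insert k J - A = insert k (J - A)" using k A by auto
      have e1: "eps k J = eps k A * eps k (J - A)"
        using eps_Un[of A "J - A" k] A fin by (simp add: Un_absorb1)
      have e2: "eps k A * eps k A = 1" by (simp add: eps_def)
      have e3: "shuffle_sign A (insert k (J - A)) = (-1) ^ card A * eps k A * shuffle_sign A (J - A)"
        by (rule shuffle_sign_insert_right) (use A k fin in auto)
      have "eps k J * shuffle_sign A (insert k (J - A)) = eps k A * eps k A * ((-1) ^ card A * eps k (J - A) * shuffle_sign A (J - A))"
        unfolding e1 e3 by (simp add: mult_ac)
      then have "eps k J * shuffle_sign A (insert k (J - A)) = shuffle_sign A (J - A) * (-1) ^ card A * eps k (J - A)"
        unfolding e2 by (simp add: mult_ac)
      from arg_cong[OF this, of "of_int :: int \<Rightarrow> 'r"]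
      have *: "of_int (eps k J) * of_int (shuffle_sign A (insert k (J - A))) = (of_int (shuffle_sign A (J - A)) * (-1) ^ card A * of_int (eps k (J - A)) :: 'r)"
        by (simp only: of_int_mult of_int_power of_int_minus of_int_1)
      show "of_int (eps k J) * (W k * (of_int (shuffle_sign A (insert k J - A)) *
           (F A * G (insert k J - A)))) = T2 A k"
      proof (cases "card A = n")
        case True
        have "of_int (eps k J) * (W k * (of_int (shuffle_sign A (insert k (J - A))) * (F A * G (insert k (J - A)))))
          = (of_int (eps k J) * of_int (shuffle_sign A (insert k (J - A)))) * (W k * (F A * G (insert k (J - A))))"
          by (simp only: mult_ac)
        then show ?thesis unfolding e T2_def * True by (simp only: mult_ac)
      next
        case False
        then have "F A = 0" using F A V by auto
        then show ?thesis by (simp add: T2_def)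
      qed
    qed
    finally show "of_int (eps k J) * (W k * emul F G (insert k J)) = (\<Sum>A\<in>Pow J. T1 A k + T2 A k)"
      by (simp add: sum.distrib)
  qed
  have R1: "emul (eder V W F) G J = (\<Sum>A\<in>Pow J. \<Sum>k\<in>V - A. T1 A k)"
    unfolding emul_def eder_def T1_def
    by (simp add: sum_distrib_left sum_distrib_right mult_ac)
  have R2: "(-1) ^ n * emul F (eder V W G) J = (\<Sum>A\<in>Pow J. \<Sum>k\<in>V - (J - A). T2 A k)"
    unfolding emul_def eder_def T2_def
    by (simp add: sum_distrib_left sum_distrib_right mult_ac)
  have S1: "(\<Sum>k\<in>V - A. T1 A k) = (\<Sum>k\<in>V - J. T1 A k) + (\<Sum>k\<in>J - A. T1 A k)"
    and S2: "(\<Sum>k\<in>V - (J - A). T2 A k) = (\<Sum>k\<in>V - J. T2 A k) + (\<Sum>k\<in>A. T2 A k)" if "A \<in> Pow J" for A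
  proof -
    have 1: "V - A = (V - J) \<union> (J - A)" and 2: "V - (J - A) = (V - J) \<union> A" using that V by auto
    have "finite A" using that fin finite_subset by auto
    then show "(\<Sum>k\<in>V - A. T1 A k) = (\<Sum>k\<in>V - J. T1 A k) + (\<Sum>k\<in>J - A. T1 A k)"
      "(\<Sum>k\<in>V - (J - A). T2 A k) = (\<Sum>k\<in>V - J. T2 A k) + (\<Sum>k\<in>A. T2 A k)"
      unfolding 1 2 using that V fin by (auto intro!: sum.union_disjoint)
  qed
  have C: "(\<Sum>A\<in>Pow J. \<Sum>k\<in>J - A. T1 A k) + (\<Sum>A\<in>Pow J. \<Sum>k\<in>A. T2 A k) = 0"
  proof -
    have "(\<Sum>A\<in>Pow J. \<Sum>k\<in>J - A. T1 A k) = (\<Sum>(A, k)\<in>Sigma (Pow J) (\<lambda>A. J - A). T1 A k)"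
      using fin by (intro sum.Sigma) auto
    also have "\<dots> = (\<Sum>(A, k)\<in>Sigma (Pow J) (\<lambda>A. A). T1 (A - {k}) k)"
      by (rule sum.reindex_bij_witness[of _ "\<lambda>(A, k). (A - {k}, k)" "\<lambda>(A, k). (insert k A, k)"]) auto
    also have "\<dots> = (\<Sum>(A, k)\<in>Sigma (Pow J) (\<lambda>A. A). - T2 A k)"
    proof (rule sum.cong[OF refl], clarify)
      fix A k assume A: "A \<subseteq> J" and k: "k \<in> A"
      define A' where "A' = A - {k}"
      have A': "A = insert k A'" "k \<notin> A'" "finite A'" using A k fin by (auto simp: A'_def dest: finite_subset)
      have e: "J - A' = insert k (J - A)" using A k by (auto simp: A'_def)
      have s1: "shuffle_sign A' (insert k (J - A)) = (-1) ^ card A' * eps k A' * shuffle_sign A' (J - A)"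
        by (rule shuffle_sign_insert_right) (use A' k fin in auto)
      have s2: "shuffle_sign A (J - A) = eps k (J - A) * shuffle_sign A' (J - A)"
        using shuffle_sign_insert_left[of A' "J - A" k] A' fin by simp
      have e2: "eps k A' * eps k A' = 1" "eps k (J - A) * eps k (J - A) = 1"
        by (simp_all add: eps_def)
      have "shuffle_sign A' (J - A') * eps k A' = (-1) ^ card A' * shuffle_sign A' (J - A) * (eps k A' * eps k A')"
        unfolding e s1 by (simp add: mult_ac)
      also have "\<dots> = - ((-1) ^ card A * shuffle_sign A' (J - A) * (eps k (J - A) * eps k (J - A)))"
        unfolding e2 using A' by simp
      also have "\<dots> = - (shuffle_sign A (J - A) * (-1) ^ card A * eps k (J - A))"
        unfolding s2 by (simp add: mult_ac)
      finally have "shuffle_sign A' (J - A') * eps k A' = - (shuffle_sign A (J - A) * (-1) ^ card A * eps k (J - A))" .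
      from arg_cong[OF this, of "of_int :: int \<Rightarrow> 'r"]
      have *: "of_int (shuffle_sign A' (J - A')) * of_int (eps k A') = (- (of_int (shuffle_sign A (J - A)) * (-1) ^ card A * of_int (eps k (J - A))) :: 'r)"
        by (simp only: of_int_mult of_int_power of_int_minus of_int_1)
      show "T1 (A - {k}) k = - T2 A k"
      proof (cases "card A = n")
        case True
        have "T1 A' k = of_int (shuffle_sign A' (J - A')) * of_int (eps k A') * W k * F A * G (insert k (J - A))"
          by (simp only: T1_def e A'(1)[symmetric])
        also have "\<dots> = - T2 A k" unfolding * T2_def True by simp
        finally show ?thesis by (simp add: A'_def)
      next
        case False
        then have "F A = 0" using F A V by auto
        then show ?thesis using A' by (simp add: T1_def T2_def flip: A'_def)
      qed
    qed
    also have "\<dots> = - (\<Sum>A\<in>Pow J. \<Sum>k\<in>A. T2 A k)"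
    proof -
      have "\<forall>A\<in>Pow J. finite A" using fin by (auto intro: finite_subset)
      then show ?thesis using fin by (subst sum.Sigma) (auto simp: case_prod_unfold sum_negf)
    qed
    finally show ?thesis by simp
  qed
  have "eder V W (emul F G) J = (\<Sum>A\<in>Pow J. \<Sum>k\<in>V - J. T1 A k + T2 A k)"
    unfolding L by (rule sum.swap)
  also have "\<dots> = (\<Sum>A\<in>Pow J. \<Sum>k\<in>V - J. T1 A k) + (\<Sum>A\<in>Pow J. \<Sum>k\<in>V - J. T2 A k)"
    by (simp only: sum.distrib)
  also have "\<dots> = ((\<Sum>A\<in>Pow J. \<Sum>k\<in>V - J. T1 A k) + (\<Sum>A\<in>Pow J. \<Sum>k\<in>J - A. T1 A k))
      + ((\<Sum>A\<in>Pow J. \<Sum>k\<in>V - J. T2 A k) + (\<Sum>A\<in>Pow J. \<Sum>k\<in>A. T2 A k))"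
    (is "?x + ?y = (?x + ?u) + (?y + ?w)")
  proof -
    have "(x + u) + (y + w) = x + y" if "u + w = 0" for x y u w :: 'r
      using that by (metis add.assoc add.commute add_0_right)
    from this[OF C] show ?thesis by (rule sym)
  qed
  also have "\<dots> = (\<Sum>A\<in>Pow J. \<Sum>k\<in>V - A. T1 A k) + (\<Sum>A\<in>Pow J. \<Sum>k\<in>V - (J - A). T2 A k)"
    unfolding sum.distrib[symmetric]
    by (intro arg_cong2[where f = "(+)"] sum.cong refl) (simp_all only: S1 S2)
  also have "\<dots> = emul (eder V W F) G J + (-1) ^ n * emul F (eder V W G) J"
    unfolding R1 R2 ..
  finally show ?thesis .
qed


subsection \<open>Passage to the face ring\<close>

declare One_nat_def [simp del]

lemma poly_ring_simps:
  "x \<in> carrier (poly_ring m) \<longleftrightarrow> (\<forall>a \<in> Poly_Mapping.keys x. Poly_Mapping.keys a \<subseteq> {1..m})"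
  "x \<otimes>\<^bsub>poly_ring m\<^esub> y = x * y" "\<one>\<^bsub>poly_ring m\<^esub> = 1"
  "\<zero>\<^bsub>poly_ring m\<^esub> = 0" "x \<oplus>\<^bsub>poly_ring m\<^esub> y = x + y"
  by (simp_all add: poly_ring_def)

lemma poly_ring_closed:
  shows "0 \<in> carrier (poly_ring m)" "1 \<in> carrier (poly_ring m)"
    and "x \<in> carrier (poly_ring m) \<Longrightarrow> - x \<in> carrier (poly_ring m)"
    and "x \<in> carrier (poly_ring m) \<Longrightarrow> y \<in> carrier (poly_ring m) \<Longrightarrow> x + y \<in> carrier (poly_ring m)"
    and "x \<in> carrier (poly_ring m) \<Longrightarrow> y \<in> carrier (poly_ring m) \<Longrightarrow> x * y \<in> carrier (poly_ring m)"
proof -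
  show "0 \<in> carrier (poly_ring m)" "1 \<in> carrier (poly_ring m)"
    by (simp_all add: poly_ring_simps)
  show "x \<in> carrier (poly_ring m) \<Longrightarrow> - x \<in> carrier (poly_ring m)"
    by (simp add: poly_ring_simps)
  show "x \<in> carrier (poly_ring m) \<Longrightarrow> y \<in> carrier (poly_ring m) \<Longrightarrow> x + y \<in> carrier (poly_ring m)"
    unfolding poly_ring_simps using Poly_Mapping.keys_add[of x y] by blast
  show "x \<in> carrier (poly_ring m) \<Longrightarrow> y \<in> carrier (poly_ring m) \<Longrightarrow> x * y \<in> carrier (poly_ring m)"
    unfolding poly_ring_simps
  proof
    fix c assume x: "\<forall>a\<in>Poly_Mapping.keys x. Poly_Mapping.keys a \<subseteq> {1..m}"
      and y: "\<forall>a\<in>Poly_Mapping.keys y. Poly_Mapping.keys a \<subseteq> {1..m}"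
      and "c \<in> Poly_Mapping.keys (x * y)"
    then obtain a b where "c = a + b" "a \<in> Poly_Mapping.keys x" "b \<in> Poly_Mapping.keys y"
      using keys_mult[of x y] by blast
    then show "Poly_Mapping.keys c \<subseteq> {1..m}"
      using x y Poly_Mapping.keys_add[of a b] by blast
  qed
qed

lemma poly_ring_sum_closed:
  "(\<And>i. i \<in> S \<Longrightarrow> f i \<in> carrier (poly_ring m)) \<Longrightarrow> sum f S \<in> carrier (poly_ring m)"
  by (induction S rule: infinite_finite_induct) (simp_all add: poly_ring_closed)

lemma poly_ring_prod_closed:
  "(\<And>i. i \<in> S \<Longrightarrow> f i \<in> carrier (poly_ring m)) \<Longrightarrow> prod f S \<in> carrier (poly_ring m)"
  by (induction S rule: infinite_finite_induct) (simp_all add: poly_ring_closed)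

lemma poly_ring_power_closed:
  "f \<in> carrier (poly_ring m) \<Longrightarrow> f ^ (n::nat) \<in> carrier (poly_ring m)"
  by (induction n) (simp_all add: poly_ring_closed)

lemma poly_ring_of_int_closed: "of_int c \<in> carrier (poly_ring m)"
proof -
  have n: "of_nat k \<in> carrier (poly_ring m)" for k
    by (induction k) (simp_all add: poly_ring_closed)
  show ?thesis
    by (cases c) (use n poly_ring_closed in \<open>simp_all del: of_nat_Suc\<close>)
qed

lemma var_closed: "i \<in> {1..m} \<Longrightarrow> var i \<in> carrier (poly_ring m)"
  by (simp add: poly_ring_simps var_def)

lemma poly_ring_cring: "cring (poly_ring m)"
proof (rule cringI)
  show "abelian_group (poly_ring m)"
  proof (rule abelian_groupI)
    fix x assume "x \<in> carrier (poly_ring m)"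
    then show "\<exists>y\<in>carrier (poly_ring m). y \<oplus>\<^bsub>poly_ring m\<^esub> x = \<zero>\<^bsub>poly_ring m\<^esub>"
      by (intro bexI[of _ "- x"]) (simp_all add: poly_ring_simps(2-) poly_ring_closed)
  qed (simp_all add: poly_ring_simps(2-) poly_ring_closed add_ac)
  show "comm_monoid (poly_ring m)"
    by (rule comm_monoidI) (simp_all add: poly_ring_simps(2-) poly_ring_closed mult_ac)
qed (simp_all add: poly_ring_simps(2-) distrib_right)

lemma poly_ring_a_inv:
  assumes "x \<in> carrier (poly_ring m)"
  shows "\<ominus>\<^bsub>poly_ring m\<^esub> x = - x"
proof -
  interpret cring "poly_ring m" by (rule poly_ring_cring)
  show ?thesis
    by (rule minus_equality) (use assms poly_ring_closed in \<open>simp_all add: poly_ring_simps(2-)\<close>)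
qed

lemma poly_ring_finsum:
  assumes "finite S" "\<And>i. i \<in> S \<Longrightarrow> f i \<in> carrier (poly_ring m)"
  shows "finsum (poly_ring m) f S = sum f S"
proof -
  interpret cring "poly_ring m" by (rule poly_ring_cring)
  show ?thesis using assms
  proof (induction S rule: finite_induct)
    case empty
    then show ?case by (simp add: poly_ring_simps)
  next
    case (insert i S)
    then have "finsum (poly_ring m) f (insert i S) = f i \<oplus>\<^bsub>poly_ring m\<^esub> finsum (poly_ring m) f S"
      by (intro finsum_insert) (auto simp: Pi_def)
    then show ?case using insert by (simp add: poly_ring_simps(2-))
  qed
qed

lemma sr_ideal: "ideal (stanley_reisner_ideal m K) (poly_ring m)"
proof -
  interpret cring "poly_ring m" by (rule poly_ring_cring)
  show ?thesis unfolding stanley_reisner_ideal_def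
    by (rule genideal_ideal) (auto intro!: poly_ring_prod_closed var_closed)
qed

lemma face_class_hom: "ring_hom_cring (poly_ring m) (face_ring m K) (face_class m K)"
proof -
  have "face_class m K = (+>\<^bsub>poly_ring m\<^esub>) (stanley_reisner_ideal m K)"
    by (simp add: fun_eq_iff face_class_def)
  then show ?thesis
    unfolding face_ring_def using ideal.rcos_ring_hom_cring[OF sr_ideal poly_ring_cring] by simp
qed

lemma face_ring_carrier: "carrier (face_ring m K) = face_class m K ` carrier (poly_ring m)"
  by (auto simp: face_ring_def FactRing_def A_RCOSETS_def' face_class_def)

lemma face_class_simps:
  shows "x \<in> carrier (poly_ring m) \<Longrightarrow> face_class m K x \<in> carrier (face_ring m K)"
    and "\<zero>\<^bsub>face_ring m K\<^esub> = face_class m K 0"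
    and "\<one>\<^bsub>face_ring m K\<^esub> = face_class m K 1"
    and "x \<in> carrier (poly_ring m) \<Longrightarrow> y \<in> carrier (poly_ring m) \<Longrightarrow>
      face_class m K x \<oplus>\<^bsub>face_ring m K\<^esub> face_class m K y = face_class m K (x + y)"
    and "x \<in> carrier (poly_ring m) \<Longrightarrow> y \<in> carrier (poly_ring m) \<Longrightarrow>
      face_class m K x \<otimes>\<^bsub>face_ring m K\<^esub> face_class m K y = face_class m K (x * y)"
    and "x \<in> carrier (poly_ring m) \<Longrightarrow> \<ominus>\<^bsub>face_ring m K\<^esub> face_class m K x = face_class m K (- x)"
    and "finite S \<Longrightarrow> (\<And>i. i \<in> S \<Longrightarrow> f i \<in> carrier (poly_ring m)) \<Longrightarrow>
      (\<Oplus>\<^bsub>face_ring m K\<^esub>i\<in>S. face_class m K (f i)) = face_class m K (\<Sum>i\<in>S. f i)"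
    and "x \<in> carrier (poly_ring m) \<Longrightarrow> [c] \<cdot>\<^bsub>face_ring m K\<^esub> face_class m K x = face_class m K (of_int c * x)"
proof -
  interpret ring_hom_cring "poly_ring m" "face_ring m K" "face_class m K" by (rule face_class_hom)
  show "x \<in> carrier (poly_ring m) \<Longrightarrow> face_class m K x \<in> carrier (face_ring m K)" by simp
  show "\<zero>\<^bsub>face_ring m K\<^esub> = face_class m K 0" using hom_zero by (simp add: poly_ring_simps)
  show "\<one>\<^bsub>face_ring m K\<^esub> = face_class m K 1" using hom_one by (simp add: poly_ring_simps)
  show "x \<in> carrier (poly_ring m) \<Longrightarrow> y \<in> carrier (poly_ring m) \<Longrightarrow>
      face_class m K x \<oplus>\<^bsub>face_ring m K\<^esub> face_class m K y = face_class m K (x + y)"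
    using hom_add[of x y] by (simp add: poly_ring_simps(2-))
  show "x \<in> carrier (poly_ring m) \<Longrightarrow> y \<in> carrier (poly_ring m) \<Longrightarrow>
      face_class m K x \<otimes>\<^bsub>face_ring m K\<^esub> face_class m K y = face_class m K (x * y)"
    using hom_mult[of x y] by (simp add: poly_ring_simps(2-))
  show neg: "\<ominus>\<^bsub>face_ring m K\<^esub> face_class m K x = face_class m K (- x)" if "x \<in> carrier (poly_ring m)" for x
    using hom_a_inv[of x] that by (simp add: poly_ring_a_inv)
  show "(\<Oplus>\<^bsub>face_ring m K\<^esub>i\<in>S. face_class m K (f i)) = face_class m K (\<Sum>i\<in>S. f i)"
    if "finite S" "\<And>i. i \<in> S \<Longrightarrow> f i \<in> carrier (poly_ring m)" for S :: "'b set" and f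
  proof -
    have "face_class m K (finsum (poly_ring m) f S) = finsum (face_ring m K) (face_class m K \<circ> f) S"
      by (rule hom_finsum) (use that in auto)
    then show ?thesis using poly_ring_finsum[OF that] by (simp add: comp_def)
  qed
  show "[c] \<cdot>\<^bsub>face_ring m K\<^esub> face_class m K x = face_class m K (of_int c * x)"
    if x: "x \<in> carrier (poly_ring m)" for x
  proof -
    have nat: "[n] \<cdot>\<^bsub>face_ring m K\<^esub> face_class m K x = face_class m K (of_nat n * x)" for n :: nat
    proof (induction n)
      case 0
      then show ?case using hom_zero by (simp add: poly_ring_simps(2-))
    next
      case (Suc n)
      have "of_nat n * x \<in> carrier (poly_ring m)"
        using poly_ring_closed(5)[OF poly_ring_of_int_closed[of "int n"] x] by simp
      then have "face_class m K (of_nat n * x) \<oplus>\<^bsub>face_ring m K\<^esub> face_class m K x = face_class m K (of_nat n * x + x)"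
        using hom_add[of "of_nat n * x" x] x by (simp add: poly_ring_simps(2-))
      then show ?case using Suc by (simp add: S.add.nat_pow_Suc algebra_simps)
    qed
    show ?thesis
    proof (cases "c \<ge> 0")
      case True
      then show ?thesis using nat[of "nat c"] by (simp add: add_pow_int_ge)
    next
      case False
      have "of_nat (nat (- c)) * x \<in> carrier (poly_ring m)"
        using poly_ring_closed(5)[OF poly_ring_of_int_closed[of "int (nat (-c))"] x] by (simp only: of_int_of_nat_eq)
      from neg[OF this] have "\<ominus>\<^bsub>face_ring m K\<^esub> ([nat (- c)] \<cdot>\<^bsub>face_ring m K\<^esub> face_class m K x) =
          face_class m K (- (of_nat (nat (- c)) * x))"
        unfolding nat .
      moreover have "- (of_nat (nat (- c)) * x) = of_int c * x" using False by simp
      ultimately show ?thesis using False by (simp add: add_pow_int_lt)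
    qed
  qed
qed

text \<open>\<open>kclass m K F\<close> is the element of the Koszul algebra whose coefficients are the classes
  of the polynomials \<open>F J\<close>.\<close>

definition kclass :: "nat \<Rightarrow> nat set set \<Rightarrow> (nat set \<Rightarrow> ipoly) \<Rightarrow> nat set \<Rightarrow> ipoly set" where
  "kclass m K F = (\<lambda>J\<in>Pow {1..m}. face_class m K (F J))"

definition kfam :: "nat \<Rightarrow> (nat set \<Rightarrow> ipoly) set" where
  "kfam m = {F. \<forall>J\<in>Pow {1..m}. F J \<in> carrier (poly_ring m)}"

lemma koszul_carrier: "carrier (koszul_algebra m K) = kclass m K ` kfam m"
proof (intro equalityI subsetI)
  fix f assume f: "f \<in> carrier (koszul_algebra m K)"
  then have f: "f \<in> Pow {1..m} \<rightarrow>\<^sub>E carrier (face_ring m K)" by (simp add: koszul_algebra_def)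
  have "\<exists>F. \<forall>J\<in>Pow {1..m}. F J \<in> carrier (poly_ring m) \<and> f J = face_class m K (F J)"
  proof (rule bchoice, rule ballI)
    fix J assume "J \<in> Pow {1..m}"
    then have "f J \<in> carrier (face_ring m K)" using f by (rule PiE_mem[rotated])
    then show "\<exists>y. y \<in> carrier (poly_ring m) \<and> f J = face_class m K y"
      unfolding face_ring_carrier by blast
  qed
  then obtain F where F: "\<forall>J\<in>Pow {1..m}. F J \<in> carrier (poly_ring m) \<and> f J = face_class m K (F J)" ..
  have "f = kclass m K F"
  proof (rule PiE_ext[OF f])
    show "kclass m K F \<in> Pow {1..m} \<rightarrow>\<^sub>E carrier (face_ring m K)"
      unfolding kclass_def using F by (intro restrict_PiE_iff[THEN iffD2]) (auto simp: face_class_simps)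
  qed (use F in \<open>simp add: kclass_def\<close>)
  then show "f \<in> kclass m K ` kfam m" using F by (auto simp: kfam_def)
next
  fix f assume "f \<in> kclass m K ` kfam m"
  then obtain F where F: "f = kclass m K F" "F \<in> kfam m" by blast
  have "kclass m K F \<in> Pow {1..m} \<rightarrow>\<^sub>E carrier (face_ring m K)"
    unfolding kclass_def using F by (intro restrict_PiE_iff[THEN iffD2]) (auto simp: kfam_def face_class_simps)
  then show "f \<in> carrier (koszul_algebra m K)" using F by (simp add: koszul_algebra_def)
qed

lemma kclass_cong: "(\<And>J. J \<subseteq> {1..m} \<Longrightarrow> F J = G J) \<Longrightarrow> kclass m K F = kclass m K G"
  unfolding kclass_def by (rule restrict_ext) auto

lemma koszul_elem_kclass: "koszul_elem m K J p = kclass m K (\<lambda>J'. if J' = J then p else 0)"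
  unfolding koszul_elem_def kclass_def by (rule restrict_ext) (simp add: face_class_simps)

lemma koszul_zero: "\<zero>\<^bsub>koszul_algebra m K\<^esub> = kclass m K (\<lambda>_. 0)"
  by (simp add: koszul_algebra_def kclass_def face_class_simps)

lemma koszul_one: "\<one>\<^bsub>koszul_algebra m K\<^esub> = koszul_elem m K {} 1"
  unfolding koszul_elem_def face_class_simps(3)[symmetric] by (simp add: koszul_algebra_def)

lemma koszul_add:
  assumes "F \<in> kfam m" "G \<in> kfam m"
  shows "kclass m K F \<oplus>\<^bsub>koszul_algebra m K\<^esub> kclass m K G = kclass m K (\<lambda>J. F J + G J)"
  using assms unfolding koszul_algebra_def kclass_def kfam_def
  by (simp, intro restrict_ext) (simp add: face_class_simps)

lemma kfam_emul: "F \<in> kfam m \<Longrightarrow> G \<in> kfam m \<Longrightarrow> emul F G \<in> kfam m"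
  unfolding kfam_def emul_def
  by (auto intro!: poly_ring_sum_closed poly_ring_closed(5) poly_ring_of_int_closed dest: subset_trans)

lemma koszul_mult:
  assumes "F \<in> kfam m" "G \<in> kfam m"
  shows "kclass m K F \<otimes>\<^bsub>koszul_algebra m K\<^esub> kclass m K G = kclass m K (emul F G)"
proof -
  interpret h: ring_hom_cring "poly_ring m" "face_ring m K" "face_class m K" by (rule face_class_hom)
  have "(\<Oplus>\<^bsub>face_ring m K\<^esub>A\<in>Pow J. [shuffle_sign A (J - A)] \<cdot>\<^bsub>face_ring m K\<^esub>
          (kclass m K F A \<otimes>\<^bsub>face_ring m K\<^esub> kclass m K G (J - A))) = face_class m K (emul F G J)"
    if J: "J \<in> Pow {1..m}" for J
  proof -
    have c: "F A \<in> carrier (poly_ring m)" "G (J - A) \<in> carrier (poly_ring m)" if "A \<in> Pow J" for A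
      using assms that J by (auto simp: kfam_def)
    have "(\<Oplus>\<^bsub>face_ring m K\<^esub>A\<in>Pow J. [shuffle_sign A (J - A)] \<cdot>\<^bsub>face_ring m K\<^esub>
          (kclass m K F A \<otimes>\<^bsub>face_ring m K\<^esub> kclass m K G (J - A)))
      = (\<Oplus>\<^bsub>face_ring m K\<^esub>A\<in>Pow J. face_class m K (of_int (shuffle_sign A (J - A)) * (F A * G (J - A))))"
    proof (rule h.S.finsum_cong')
      fix A assume A: "A \<in> Pow J"
      then have "A \<in> Pow {1..m}" "J - A \<in> Pow {1..m}" using J by auto
      then show "[shuffle_sign A (J - A)] \<cdot>\<^bsub>face_ring m K\<^esub> (kclass m K F A \<otimes>\<^bsub>face_ring m K\<^esub> kclass m K G (J - A))
        = face_class m K (of_int (shuffle_sign A (J - A)) * (F A * G (J - A)))"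
        using c[OF A] by (simp add: kclass_def face_class_simps(5,8) poly_ring_closed)
    qed (use c in \<open>auto intro!: face_class_simps(1) poly_ring_closed(5) poly_ring_of_int_closed\<close>)
    also have "\<dots> = face_class m K (emul F G J)"
      unfolding emul_def
    proof (rule face_class_simps(7))
      show "finite (Pow J)" using J finite_subset by auto
    qed (use c in \<open>auto intro!: poly_ring_closed(5) poly_ring_of_int_closed\<close>)
    finally show ?thesis .
  qed
  then show ?thesis unfolding koszul_algebra_def
    by (simp add: kclass_def[of m K "emul F G"] cong: restrict_cong)
qed

lemma kfam_intros:
  "(\<lambda>_. 0) \<in> kfam m"
  "p \<in> carrier (poly_ring m) \<Longrightarrow> (\<lambda>J'. if J' = J then p else 0) \<in> kfam m"
  "F \<in> kfam m \<Longrightarrow> G \<in> kfam m \<Longrightarrow> (\<lambda>J. F J + G J) \<in> kfam m"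
  "F \<in> kfam m \<Longrightarrow> (\<lambda>J. - F J) \<in> kfam m"
  by (auto simp: kfam_def poly_ring_closed)

lemma koszul_abelian_group: "abelian_group (koszul_algebra m K)"
proof (rule abelian_groupI)
  fix x assume "x \<in> carrier (koszul_algebra m K)"
  then obtain F where F: "F \<in> kfam m" "x = kclass m K F" unfolding koszul_carrier by blast
  have "kclass m K (\<lambda>J. - F J) \<oplus>\<^bsub>koszul_algebra m K\<^esub> x = \<zero>\<^bsub>koszul_algebra m K\<^esub>"
    using F by (simp add: koszul_add kfam_intros koszul_zero)
  then show "\<exists>y\<in>carrier (koszul_algebra m K). y \<oplus>\<^bsub>koszul_algebra m K\<^esub> x = \<zero>\<^bsub>koszul_algebra m K\<^esub>"
    using F by (metis koszul_carrier kfam_intros(4) imageI)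
qed (auto simp: koszul_carrier koszul_add koszul_zero kfam_intros add_ac)

lemma koszul_a_inv:
  assumes "F \<in> kfam m"
  shows "\<ominus>\<^bsub>koszul_algebra m K\<^esub> kclass m K F = kclass m K (\<lambda>J. - F J)"
proof -
  interpret abelian_group "koszul_algebra m K" by (rule koszul_abelian_group)
  show ?thesis
    by (rule minus_equality)
      (use assms in \<open>auto simp: koszul_carrier koszul_add koszul_zero kfam_intros\<close>)
qed

subsection \<open>Existence of derivations\<close>

definition kder :: "nat \<Rightarrow> nat set set \<Rightarrow> (nat \<Rightarrow> ipoly) \<Rightarrow> (nat set \<Rightarrow> ipoly set) \<Rightarrow> nat set \<Rightarrow> ipoly set" where
  "kder m K W = (\<lambda>f\<in>carrier (koszul_algebra m K). \<lambda>J\<in>Pow {1..m}. \<Oplus>\<^bsub>face_ring m K\<^esub>k\<in>{1..m} - J.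
     [eps k J] \<cdot>\<^bsub>face_ring m K\<^esub> (face_class m K (W k) \<otimes>\<^bsub>face_ring m K\<^esub> f (insert k J)))"

lemma kfam_eder:
  assumes "F \<in> kfam m" "\<And>k. k \<in> {1..m} \<Longrightarrow> W k \<in> carrier (poly_ring m)"
  shows "eder {1..m} W F \<in> kfam m"
  using assms unfolding kfam_def eder_def
  by (auto intro!: poly_ring_sum_closed poly_ring_closed(5) poly_ring_of_int_closed)

lemma kder_kclass:
  assumes "F \<in> kfam m" "\<And>k. k \<in> {1..m} \<Longrightarrow> W k \<in> carrier (poly_ring m)"
  shows "kder m K W (kclass m K F) = kclass m K (eder {1..m} W F)"
proof -
  interpret h: ring_hom_cring "poly_ring m" "face_ring m K" "face_class m K" by (rule face_class_hom)
  have "(\<Oplus>\<^bsub>face_ring m K\<^esub>k\<in>{1..m} - J. [eps k J] \<cdot>\<^bsub>face_ring m K\<^esub>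
          (face_class m K (W k) \<otimes>\<^bsub>face_ring m K\<^esub> kclass m K F (insert k J))) = face_class m K (eder {1..m} W F J)"
    if J: "J \<in> Pow {1..m}" for J
  proof -
    have c: "W k \<in> carrier (poly_ring m)" "F (insert k J) \<in> carrier (poly_ring m)" if "k \<in> {1..m} - J" for k
      using assms that J by (auto simp: kfam_def)
    have "(\<Oplus>\<^bsub>face_ring m K\<^esub>k\<in>{1..m} - J. [eps k J] \<cdot>\<^bsub>face_ring m K\<^esub>
          (face_class m K (W k) \<otimes>\<^bsub>face_ring m K\<^esub> kclass m K F (insert k J)))
      = (\<Oplus>\<^bsub>face_ring m K\<^esub>k\<in>{1..m} - J. face_class m K (of_int (eps k J) * (W k * F (insert k J))))"
    proof (rule h.S.finsum_cong')
      fix k assume k: "k \<in> {1..m} - J"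
      then have "insert k J \<in> Pow {1..m}" using J by auto
      then show "[eps k J] \<cdot>\<^bsub>face_ring m K\<^esub> (face_class m K (W k) \<otimes>\<^bsub>face_ring m K\<^esub> kclass m K F (insert k J))
        = face_class m K (of_int (eps k J) * (W k * F (insert k J)))"
        using c[OF k] by (simp add: kclass_def face_class_simps(5,8) poly_ring_closed)
    qed (use c in \<open>auto intro!: face_class_simps(1) poly_ring_closed(5) poly_ring_of_int_closed\<close>)
    also have "\<dots> = face_class m K (eder {1..m} W F J)"
      unfolding eder_def
      by (rule face_class_simps(7)) (use c in \<open>auto intro!: poly_ring_closed(5) poly_ring_of_int_closed\<close>)
    finally show ?thesis .
  qed
  moreover have "kclass m K F \<in> carrier (koszul_algebra m K)" using assms by (simp add: koszul_carrier)
  ultimately show ?thesis unfolding kder_def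
    by (simp add: kclass_def[of m K "eder {1..m} W F"] cong: restrict_cong)
qed

lemma koszul_piece_rep:
  assumes "x \<in> koszul_piece m K p q"
  shows "\<exists>F\<in>kfam m. x = kclass m K F \<and> (\<forall>J\<subseteq>{1..m}. F J \<noteq> 0 \<longrightarrow> p = - int (card J) \<and> even q)"
  using assms unfolding koszul_piece_def
proof (induction rule: generate.induct)
  case one
  show ?case by (rule bexI[of _ "\<lambda>_. 0"]) (simp_all add: kfam_intros koszul_zero)
next
  case (incl h)
  then obtain J a where h: "h = koszul_elem m K J (\<Prod>i = 1..m. var i ^ a i)" "J \<subseteq> {1..m}" "p = - int (card J)"
    "q = 2 * int (card J) + 2 * int (\<Sum>i=1..m. a i)" by blast
  have "(\<Prod>i = 1..m. var i ^ a i) \<in> carrier (poly_ring m)"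
    by (intro poly_ring_prod_closed poly_ring_power_closed var_closed)
  then show ?case unfolding h(1) koszul_elem_kclass using h(3,4)
    by (intro bexI[OF _ kfam_intros(2)]) auto
next
  case (inv h)
  then obtain J a where h: "h = koszul_elem m K J (\<Prod>i = 1..m. var i ^ a i)" "J \<subseteq> {1..m}" "p = - int (card J)"
    "q = 2 * int (card J) + 2 * int (\<Sum>i=1..m. a i)" by blast
  have c: "(\<Prod>i = 1..m. var i ^ a i) \<in> carrier (poly_ring m)"
    by (intro poly_ring_prod_closed poly_ring_power_closed var_closed)
  have "inv\<^bsub>add_monoid (koszul_algebra m K)\<^esub> h = \<ominus>\<^bsub>koszul_algebra m K\<^esub> h"
    by (simp add: a_inv_def)
  also have "\<dots> = kclass m K (\<lambda>J'. - (if J' = J then \<Prod>i = 1..m. var i ^ a i else 0))"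
    unfolding h(1) koszul_elem_kclass by (rule koszul_a_inv[OF kfam_intros(2)[OF c]])
  finally show ?case using h(3,4)
    by (intro bexI[OF _ kfam_intros(4)[OF kfam_intros(2)[OF c]]]) auto
next
  case (eng h1 h2)
  then obtain F G where "F \<in> kfam m" "h1 = kclass m K F" "\<forall>J\<subseteq>{1..m}. F J \<noteq> 0 \<longrightarrow> p = - int (card J) \<and> even q"
    "G \<in> kfam m" "h2 = kclass m K G" "\<forall>J\<subseteq>{1..m}. G J \<noteq> 0 \<longrightarrow> p = - int (card J) \<and> even q"
    by blast
  note FG = this
  have "h1 \<otimes>\<^bsub>add_monoid (koszul_algebra m K)\<^esub> h2 = kclass m K (\<lambda>J. F J + G J)"
    using FG by (simp add: koszul_add)
  moreover have "p = - int (card J) \<and> even q" if "J \<subseteq> {1..m}" "F J + G J \<noteq> 0" for J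
    using FG(3,6) that by (cases "F J = 0") auto
  ultimately show ?case
    using kfam_intros(3)[OF FG(1,4)] by blast
qed

lemma eps_empty [simp]: "eps k {} = 1"
  by (simp add: eps_def)

lemma kder_derivation:
  assumes W: "\<And>k. k \<in> {1..m} \<Longrightarrow> W k \<in> carrier (poly_ring m)"
  shows "is_koszul_derivation m K (\<lambda>i. koszul_elem m K {} (W i)) (kder m K W)"
  unfolding is_koszul_derivation_def Let_def
proof (intro conjI ballI allI)
  show "kder m K W \<in> extensional (carrier (koszul_algebra m K))"
    by (simp add: kder_def)
  show "kder m K W \<in> hom (add_monoid (koszul_algebra m K)) (add_monoid (koszul_algebra m K))"
  proof (rule homI)
    fix x assume "x \<in> carrier (add_monoid (koszul_algebra m K))"
    then obtain F where F: "F \<in> kfam m" "x = kclass m K F" by (auto simp: koszul_carrier)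
    have "kder m K W x = kclass m K (eder {1..m} W F)" "eder {1..m} W F \<in> kfam m"
      unfolding F by (rule kder_kclass[OF F(1) W], assumption) (rule kfam_eder[OF F(1) W])
    then show "kder m K W x \<in> carrier (add_monoid (koszul_algebra m K))"
      by (simp add: koszul_carrier)
  next
    fix x y assume "x \<in> carrier (add_monoid (koszul_algebra m K))" "y \<in> carrier (add_monoid (koszul_algebra m K))"
    then obtain F G where FG: "F \<in> kfam m" "G \<in> kfam m" "x = kclass m K F" "y = kclass m K G"
      by (auto simp: koszul_carrier)
    have "eder {1..m} W (\<lambda>J. F J + G J) = (\<lambda>J. eder {1..m} W F J + eder {1..m} W G J)"
      by (simp add: eder_def fun_eq_iff distrib_left sum.distrib)
    then show "kder m K W (x \<otimes>\<^bsub>add_monoid (koszul_algebra m K)\<^esub> y) =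
        kder m K W x \<otimes>\<^bsub>add_monoid (koszul_algebra m K)\<^esub> kder m K W y"
      using kder_kclass[OF FG(1), where K = K and W = W] kder_kclass[OF FG(2), where K = K and W = W]
        kder_kclass[OF kfam_intros(3)[OF FG(1,2)], where K = K and W = W]
        koszul_add[OF FG(1,2), of K] koszul_add[OF kfam_eder kfam_eder, OF FG(1) _ FG(2), of W W K] W
      unfolding FG by simp
  qed
next
  fix p q x y
  assume x: "x \<in> koszul_piece m K p q" and y: "y \<in> carrier (koszul_algebra m K)"
  obtain F where F: "F \<in> kfam m" "x = kclass m K F"
    "\<And>J. J \<subseteq> {1..m} \<Longrightarrow> F J \<noteq> 0 \<Longrightarrow> p = - int (card J) \<and> even q"
    using koszul_piece_rep[OF x] by blast
  obtain G where G: "G \<in> kfam m" "y = kclass m K G" using y unfolding koszul_carrier by blast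
  define n where "n = (if even q then nat \<bar>p\<bar> else Suc (nat \<bar>p\<bar>))"
  have n: "even n \<longleftrightarrow> even (p + q)" by (auto simp: n_def even_nat_iff)
  have Fn: "F A = 0" if "A \<subseteq> {1..m}" "card A \<noteq> n" for A
    using F(3)[OF that(1)] that(2) by (cases "F A = 0") (auto simp: n_def)
  have E: "eder {1..m} W (emul F G) J = emul (eder {1..m} W F) G J + (-1) ^ n * emul F (eder {1..m} W G) J"
    if "J \<subseteq> {1..m}" for J
    by (rule eder_emul) (use that Fn in auto)
  have neg: "emul (\<lambda>J. - F J) (eder {1..m} W G) = (\<lambda>J. - emul F (eder {1..m} W G) J)"
    by (simp add: emul_def fun_eq_iff sum_negf)
  have d: "kder m K W x = kclass m K (eder {1..m} W F)" "kder m K W y = kclass m K (eder {1..m} W G)"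
    unfolding F(2) G(2) by (rule kder_kclass[OF F(1) W], assumption) (rule kder_kclass[OF G(1) W])
  have e: "eder {1..m} W F \<in> kfam m" "eder {1..m} W G \<in> kfam m"
    by (rule kfam_eder[OF F(1) W], assumption) (rule kfam_eder[OF G(1) W])
  have s: "(if even (p + q) then x else \<ominus>\<^bsub>koszul_algebra m K\<^esub> x) \<otimes>\<^bsub>koszul_algebra m K\<^esub> kder m K W y
      = kclass m K (\<lambda>J. (-1) ^ n * emul F (eder {1..m} W G) J)"
  proof (cases "even n")
    case True
    then have "even (p + q)" using n by blast
    then show ?thesis using True F(1) e by (simp add: d F(2) koszul_mult del: even_add)
  next
    case False
    then have "\<not> even (p + q)" using n by blast
    then show ?thesis using False F(1) e
      by (simp only: if_False) (simp add: d F(2) koszul_a_inv koszul_mult kfam_intros neg)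
  qed
  have fam: "emul (eder {1..m} W F) G \<in> kfam m" "(\<lambda>J. (-1) ^ n * emul F (eder {1..m} W G) J) \<in> kfam m"
  proof -
    show "emul (eder {1..m} W F) G \<in> kfam m" using G e by (simp add: kfam_emul)
    have "emul F (eder {1..m} W G) \<in> kfam m" using F e by (simp add: kfam_emul)
    then show "(\<lambda>J. (-1) ^ n * emul F (eder {1..m} W G) J) \<in> kfam m"
      using kfam_intros(4) by (cases "even n") auto
  qed
  have "kder m K W (x \<otimes>\<^bsub>koszul_algebra m K\<^esub> y) = kclass m K (eder {1..m} W (emul F G))"
    unfolding F(2) G(2) koszul_mult[OF F(1) G(1)]
    by (rule kder_kclass[OF kfam_emul[OF F(1) G(1)] W])
  also have "\<dots> = kclass m K (\<lambda>J. emul (eder {1..m} W F) G J + (-1) ^ n * emul F (eder {1..m} W G) J)"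
    by (rule kclass_cong) (rule E)
  also have "\<dots> = kclass m K (emul (eder {1..m} W F) G) \<oplus>\<^bsub>koszul_algebra m K\<^esub>
      kclass m K (\<lambda>J. (-1) ^ n * emul F (eder {1..m} W G) J)"
    by (rule koszul_add[OF fam, symmetric])
  also have "kclass m K (emul (eder {1..m} W F) G) = kder m K W x \<otimes>\<^bsub>koszul_algebra m K\<^esub> y"
    unfolding d G(2) by (rule koszul_mult[OF e(1) G(1), symmetric])
  finally show "kder m K W (x \<otimes>\<^bsub>koszul_algebra m K\<^esub> y) = kder m K W x \<otimes>\<^bsub>koszul_algebra m K\<^esub> y
      \<oplus>\<^bsub>koszul_algebra m K\<^esub> (if even (p + q) then x else \<ominus>\<^bsub>koszul_algebra m K\<^esub> x) \<otimes>\<^bsub>koszul_algebra m K\<^esub> kder m K W y"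
    unfolding s .
next
  fix i assume i: "i \<in> {1..m}"
  have "eder {1..m} W (\<lambda>J'. if J' = {i} then 1 else 0) J = (if J = {} then W i else 0)" if "J \<subseteq> {1..m}" for J
  proof (cases "J = {}")
    case True
    have "eder {1..m} W (\<lambda>J'. if J' = {i} then 1 else 0) {} = (\<Sum>k\<in>{1..m}. if i = k then W k else 0)"
      unfolding eder_def by (intro sum.cong) auto
    then show ?thesis using i True by simp
  next
    case False
    then have "insert k J \<noteq> {i}" if "k \<in> {1..m} - J" for k using that by blast
    then show ?thesis using False unfolding eder_def by (intro trans[OF sum.neutral]) auto
  qed
  then show "kder m K W (koszul_u m K i) = koszul_elem m K {} (W i)"
    unfolding koszul_elem_kclass using W
    by (subst kder_kclass) (auto intro!: kclass_cong kfam_intros poly_ring_closed)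
  have "eder {1..m} W (\<lambda>J'. if J' = {} then var i else 0) = (\<lambda>_. 0)"
    by (simp add: eder_def fun_eq_iff)
  then show "kder m K W (koszul_v m K i) = \<zero>\<^bsub>koszul_algebra m K\<^esub>"
    unfolding koszul_elem_kclass koszul_zero using W i
    by (subst kder_kclass) (auto intro!: kfam_intros var_closed)
qed


subsection \<open>Uniqueness of derivations\<close>

lemma koszul_elem_carrier:
  "p \<in> carrier (poly_ring m) \<Longrightarrow> koszul_elem m K J p \<in> carrier (koszul_algebra m K)"
  unfolding koszul_elem_kclass koszul_carrier by (intro imageI kfam_intros)

lemma koszul_elem_mult:
  assumes p: "p \<in> carrier (poly_ring m)" and G: "G \<in> kfam m"
  shows "koszul_elem m K B p \<otimes>\<^bsub>koszul_algebra m K\<^esub> kclass m K G =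
    kclass m K (\<lambda>J. if B \<subseteq> J then of_int (shuffle_sign B (J - B)) * (p * G (J - B)) else 0)"
  unfolding koszul_elem_kclass koszul_mult[OF kfam_intros(2)[OF p] G]
proof (rule kclass_cong)
  fix J assume J: "J \<subseteq> {1..m}"
  then have "finite (Pow J)" using finite_subset by auto
  moreover have "emul (\<lambda>J'. if J' = B then p else 0) G J =
      (\<Sum>A\<in>Pow J. if A = B then of_int (shuffle_sign B (J - B)) * (p * G (J - B)) else 0)"
    unfolding emul_def by (intro sum.cong) auto
  ultimately show "emul (\<lambda>J'. if J' = B then p else 0) G J =
      (if B \<subseteq> J then of_int (shuffle_sign B (J - B)) * (p * G (J - B)) else 0)"
    by simp
qed

lemma shuffle_sign_empty [simp]: "shuffle_sign {} B = 1" "shuffle_sign A {} = 1"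
  by (simp_all add: shuffle_sign_def)

lemma koszul_elem_empty_mult:
  assumes "p \<in> carrier (poly_ring m)" "r \<in> carrier (poly_ring m)"
  shows "koszul_elem m K {} p \<otimes>\<^bsub>koszul_algebra m K\<^esub> koszul_elem m K B r = koszul_elem m K B (p * r)"
proof -
  have "koszul_elem m K {} p \<otimes>\<^bsub>koszul_algebra m K\<^esub> koszul_elem m K B r =
      kclass m K (\<lambda>J. if {} \<subseteq> J then of_int (shuffle_sign {} (J - {})) * (p * (if J - {} = B then r else 0)) else 0)"
    unfolding koszul_elem_kclass[of m K B r]
    by (rule koszul_elem_mult[OF assms(1) kfam_intros(2)[OF assms(2)]])
  also have "\<dots> = koszul_elem m K B (p * r)"
    unfolding koszul_elem_kclass by (rule kclass_cong) auto
  finally show ?thesis .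
qed

lemma koszul_u_mult_elem:
  assumes "p \<in> carrier (poly_ring m)" "\<forall>a\<in>B. i < a"
  shows "koszul_u m K i \<otimes>\<^bsub>koszul_algebra m K\<^esub> koszul_elem m K B p = koszul_elem m K (insert i B) p"
proof -
  have "koszul_u m K i \<otimes>\<^bsub>koszul_algebra m K\<^esub> koszul_elem m K B p =
      kclass m K (\<lambda>J. if {i} \<subseteq> J then of_int (shuffle_sign {i} (J - {i})) * (1 * (if J - {i} = B then p else 0)) else 0)"
    unfolding koszul_elem_kclass[of m K B p]
    by (rule koszul_elem_mult[OF poly_ring_closed(2) kfam_intros(2)[OF assms(1)]])
  also have "\<dots> = koszul_elem m K (insert i B) p"
    unfolding koszul_elem_kclass
  proof (rule kclass_cong)
    fix J
    have "{(a, b). a \<in> {i} \<and> b \<in> B \<and> b < a} = {}" using assms(2) by fastforce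
    then have "shuffle_sign {i} B = 1" by (simp only: shuffle_sign_def card.empty power_0)
    moreover have "i \<notin> B" using assms(2) by blast
    then have "{i} \<subseteq> J \<and> J - {i} = B \<longleftrightarrow> J = insert i B" by blast
    ultimately show "(if {i} \<subseteq> J then of_int (shuffle_sign {i} (J - {i})) * (1 * (if J - {i} = B then p else 0)) else 0) =
      (if J = insert i B then p else 0)"
      by (cases "J = insert i B") auto
  qed
  finally show ?thesis .
qed

lemma poly_ring_induct:
  assumes p: "p \<in> carrier (poly_ring m)"
    and one: "P 1"
    and add: "\<And>x y. x \<in> carrier (poly_ring m) \<Longrightarrow> y \<in> carrier (poly_ring m) \<Longrightarrow> P x \<Longrightarrow> P y \<Longrightarrow> P (x + y)"
    and neg: "\<And>x. x \<in> carrier (poly_ring m) \<Longrightarrow> P x \<Longrightarrow> P (- x)"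
    and var: "\<And>i x. i \<in> {1..m} \<Longrightarrow> x \<in> carrier (poly_ring m) \<Longrightarrow> P x \<Longrightarrow> P (var i * x)"
  shows "P p"
proof -
  have zero: "P 0" using add[of 1 "- 1"] one neg[of 1] poly_ring_closed by simp
  have mono: "P (Poly_Mapping.single a 1)" if "Poly_Mapping.keys a \<subseteq> {1..m}" for a
    using that
  proof (induction "\<Sum>i\<in>{1..m}. Poly_Mapping.lookup a i" arbitrary: a)
    case 0
    have "Poly_Mapping.lookup a i = 0" for i
      using 0 by (cases "i \<in> {1..m}") (auto simp: in_keys_iff)
    then have "a = 0" by (simp add: poly_mapping_eqI)
    then show ?case using one by simp
  next
    case (Suc n)
    have "\<exists>i\<in>{1..m}. Poly_Mapping.lookup a i \<noteq> 0"
    proof (rule ccontr)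
      assume "\<not> ?thesis"
      then have "(\<Sum>i\<in>{1..m}. Poly_Mapping.lookup a i) = 0" by (intro sum.neutral) blast
      then show False using Suc.hyps(2) by simp
    qed
    then obtain i where i: "i \<in> {1..m}" "Poly_Mapping.lookup a i \<noteq> 0" by blast
    define b where "b = a - Poly_Mapping.single i 1"
    have a: "a = Poly_Mapping.single i 1 + b"
      by (rule poly_mapping_eqI) (use i in \<open>auto simp: b_def lookup_add lookup_minus lookup_single when_def\<close>)
    have b: "Poly_Mapping.keys b \<subseteq> {1..m}"
      using Suc.prems by (auto simp: b_def in_keys_iff lookup_minus)
    have "(\<Sum>j\<in>{1..m}. Poly_Mapping.lookup a j) = (\<Sum>j\<in>{1..m}. if i = j then 1 else 0) + (\<Sum>j\<in>{1..m}. Poly_Mapping.lookup b j)"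
      unfolding a by (simp add: lookup_add lookup_single when_def sum.distrib)
    then have "(\<Sum>j\<in>{1..m}. Poly_Mapping.lookup b j) = n" using Suc.hyps(2) i(1) by simp
    then have "P (Poly_Mapping.single b 1)" using Suc.hyps(1)[of b] b by simp
    then have "P (var i * Poly_Mapping.single b 1)"
      using i(1) b by (intro var) (simp_all add: poly_ring_simps(1))
    then show ?case unfolding a by (simp add: var_def mult_single)
  qed
  have single: "P (Poly_Mapping.single a c)" if a: "Poly_Mapping.keys a \<subseteq> {1..m}" for a c
  proof -
    have cl: "Poly_Mapping.single a c \<in> carrier (poly_ring m)" for c
      using a by (simp add: poly_ring_simps(1))
    have nat: "P (Poly_Mapping.single a (int n))" for n
    proof (induction n)
      case (Suc n)
      have "Poly_Mapping.single a (int (Suc n)) = Poly_Mapping.single a 1 + Poly_Mapping.single a (int n)"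
        by (simp flip: single_add)
      then show ?case using add[OF cl cl mono[OF a] Suc] by simp
    qed (simp add: zero)
    show ?thesis
    proof (cases "c \<ge> 0")
      case True
      then show ?thesis using nat[of "nat c"] by simp
    next
      case False
      then show ?thesis using neg[OF cl nat[of "nat (- c)"]] by (simp flip: single_uminus)
    qed
  qed
  have "(\<Sum>a\<in>Poly_Mapping.keys p. Poly_Mapping.single a (Poly_Mapping.lookup p a)) = p"
    by (rule poly_mapping_eqI)
      (simp add: lookup_sum lookup_single when_def in_keys_iff sum.delta')
  moreover have "P (\<Sum>a\<in>S. Poly_Mapping.single a (Poly_Mapping.lookup p a)) \<and>
      (\<Sum>a\<in>S. Poly_Mapping.single a (Poly_Mapping.lookup p a)) \<in> carrier (poly_ring m)"
    if "finite S" "S \<subseteq> Poly_Mapping.keys p" for S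
    using that
  proof (induction S rule: finite_induct)
    case empty
    then show ?case by (simp add: zero poly_ring_closed)
  next
    case (insert a S)
    have a: "Poly_Mapping.keys a \<subseteq> {1..m}" using insert.prems p by (auto simp: poly_ring_simps(1))
    then have "Poly_Mapping.single a (Poly_Mapping.lookup p a) \<in> carrier (poly_ring m)"
      by (simp add: poly_ring_simps(1))
    then show ?case using insert single[OF a] add poly_ring_closed(4) by simp
  qed
  from this[of "Poly_Mapping.keys p"]
  have "P (\<Sum>a\<in>Poly_Mapping.keys p. Poly_Mapping.single a (Poly_Mapping.lookup p a))" by simp
  ultimately show ?thesis by simp
qed

lemma koszul_piece_gens:
  shows "\<one>\<^bsub>koszul_algebra m K\<^esub> \<in> koszul_piece m K 0 0"
    and "i \<in> {1..m} \<Longrightarrow> koszul_u m K i \<in> koszul_piece m K (-1) 2"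
    and "i \<in> {1..m} \<Longrightarrow> koszul_v m K i \<in> koszul_piece m K 0 2"
proof -
  have 0: "(\<Prod>j=1..m. var j ^ 0) = 1" by simp
  show "\<one>\<^bsub>koszul_algebra m K\<^esub> \<in> koszul_piece m K 0 0"
    unfolding koszul_piece_def koszul_one
    by (rule generate.incl, intro CollectI exI[of _ "{}"] exI[of _ "\<lambda>_. 0"]) simp
  show "i \<in> {1..m} \<Longrightarrow> koszul_u m K i \<in> koszul_piece m K (-1) 2"
    unfolding koszul_piece_def
    by (rule generate.incl, intro CollectI exI[of _ "{i}"] exI[of _ "\<lambda>_. 0"]) simp
  assume i: "i \<in> {1..m}"
  have "(\<Prod>j=1..m. var j ^ (if j = i then 1 else 0)) = (\<Prod>j=1..m. if j = i then var j else 1)"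
    by (intro prod.cong) auto
  then have "(\<Prod>j=1..m. var j ^ (if j = i then 1 else 0)) = var i" using i by simp
  then show "koszul_v m K i \<in> koszul_piece m K 0 2"
    unfolding koszul_piece_def using i
    by (intro generate.incl CollectI exI[of _ "{}"] exI[of _ "\<lambda>j. if j = i then 1 else 0"]) simp
qed

lemma koszul_derivation_unique:
  assumes 1: "is_koszul_derivation m K w \<theta>1" and 2: "is_koszul_derivation m K w \<theta>2"
  shows "\<theta>1 = \<theta>2"
proof -
  let ?E = "koszul_algebra m K"
  interpret abelian_group ?E by (rule koszul_abelian_group)
  have hom: "abelian_group_hom ?E ?E \<theta>" if "is_koszul_derivation m K w \<theta>" for \<theta>
    by (rule abelian_group_homI[OF koszul_abelian_group koszul_abelian_group])
      (intro group_hom.intro group_hom_axioms.intro a_group,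
        use that in \<open>simp only: is_koszul_derivation_def Let_def\<close>)
  interpret h1: abelian_group_hom ?E ?E \<theta>1 by (rule hom[OF 1])
  interpret h2: abelian_group_hom ?E ?E \<theta>2 by (rule hom[OF 2])
  define D where "D = {x \<in> carrier ?E. \<theta>1 x = \<theta>2 x}"
  have D_zero: "\<zero>\<^bsub>?E\<^esub> \<in> D" by (simp add: D_def)
  have D_add: "x \<oplus>\<^bsub>?E\<^esub> y \<in> D" if "x \<in> D" "y \<in> D" for x y using that by (simp add: D_def)
  have D_neg: "\<ominus>\<^bsub>?E\<^esub> x \<in> D" if "x \<in> D" for x using that by (simp add: D_def)
  have mult_closed: "x \<otimes>\<^bsub>?E\<^esub> y \<in> carrier ?E" if "x \<in> carrier ?E" "y \<in> carrier ?E" for x y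
    using that unfolding koszul_carrier by (auto simp: koszul_mult kfam_emul)
  have leib: "\<theta> (x \<otimes>\<^bsub>?E\<^esub> y) = \<theta> x \<otimes>\<^bsub>?E\<^esub> y \<oplus>\<^bsub>?E\<^esub> (if even (p + q) then x else \<ominus>\<^bsub>?E\<^esub> x) \<otimes>\<^bsub>?E\<^esub> \<theta> y"
    if "is_koszul_derivation m K w \<theta>" "x \<in> koszul_piece m K p q" "y \<in> carrier ?E" for \<theta> x y p q
    using that by (simp add: is_koszul_derivation_def Let_def)
  have D_mult: "x \<otimes>\<^bsub>?E\<^esub> y \<in> D" if "x \<in> D" "x \<in> koszul_piece m K p q" "y \<in> D" for x y p q
    using that leib[OF 1 that(2), of y] leib[OF 2 that(2), of y] by (simp add: D_def mult_closed)
  have one_closed: "\<one>\<^bsub>?E\<^esub> \<in> carrier ?E"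
    unfolding koszul_one by (rule koszul_elem_carrier) (rule poly_ring_closed)
  have one_l: "\<one>\<^bsub>?E\<^esub> \<otimes>\<^bsub>?E\<^esub> x = x" if x: "x \<in> carrier ?E" for x
  proof -
    obtain F where F: "F \<in> kfam m" "x = kclass m K F" using x unfolding koszul_carrier by blast
    show ?thesis unfolding koszul_one F(2) koszul_elem_mult[OF poly_ring_closed(2) F(1)]
      by (rule kclass_cong) simp
  qed
  have one_r: "x \<otimes>\<^bsub>?E\<^esub> \<one>\<^bsub>?E\<^esub> = x" if x: "x \<in> carrier ?E" for x
  proof -
    obtain F where F: "F \<in> kfam m" "x = kclass m K F" using x unfolding koszul_carrier by blast
    show ?thesis unfolding koszul_one koszul_elem_kclass F(2) koszul_mult[OF F(1) kfam_intros(2)[OF poly_ring_closed(2)]]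
    proof (rule kclass_cong)
      fix J assume "J \<subseteq> {1..m}"
      then have "finite (Pow J)" using finite_subset by auto
      moreover have "emul F (\<lambda>J'. if J' = {} then 1 else 0) J = (\<Sum>A\<in>Pow J. if A = J then F J else 0)"
        unfolding emul_def by (intro sum.cong refl) auto
      ultimately show "emul F (\<lambda>J'. if J' = {} then 1 else 0) J = F J" by simp
    qed
  qed
  have "\<theta> \<one>\<^bsub>?E\<^esub> = \<zero>\<^bsub>?E\<^esub>" if \<theta>: "is_koszul_derivation m K w \<theta>" for \<theta>
  proof -
    interpret h: abelian_group_hom ?E ?E \<theta> by (rule hom[OF \<theta>])
    have c: "\<theta> \<one>\<^bsub>?E\<^esub> \<in> carrier ?E" using one_closed by simp
    then have "\<theta> \<one>\<^bsub>?E\<^esub> = \<theta> \<one>\<^bsub>?E\<^esub> \<oplus>\<^bsub>?E\<^esub> \<theta> \<one>\<^bsub>?E\<^esub>"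
      using leib[OF \<theta> koszul_piece_gens(1) one_closed] one_closed by (simp add: one_l one_r)
    then show ?thesis using c by (metis add.r_cancel_one')
  qed
  then have D_one: "\<one>\<^bsub>?E\<^esub> \<in> D" using 1 2 one_closed by (simp add: D_def)
  have D_u: "koszul_u m K i \<in> D" and D_v: "koszul_v m K i \<in> D" if "i \<in> {1..m}" for i
    using that 1 2 koszul_elem_carrier[OF poly_ring_closed(2)] koszul_elem_carrier[OF var_closed[OF that]]
    by (simp_all add: D_def is_koszul_derivation_def Let_def)
  have poly: "koszul_elem m K {} p \<in> D" if "p \<in> carrier (poly_ring m)" for p
  proof (rule poly_ring_induct[OF that])
    show "koszul_elem m K {} 1 \<in> D" using D_one by (simp add: koszul_one)
  next
    fix x y assume xy: "x \<in> carrier (poly_ring m)" "y \<in> carrier (poly_ring m)"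
      "koszul_elem m K {} x \<in> D" "koszul_elem m K {} y \<in> D"
    have "koszul_elem m K {} (x + y) = koszul_elem m K {} x \<oplus>\<^bsub>?E\<^esub> koszul_elem m K {} y"
      unfolding koszul_elem_kclass koszul_add[OF kfam_intros(2)[OF xy(1)] kfam_intros(2)[OF xy(2)]]
      by (rule kclass_cong) simp
    then show "koszul_elem m K {} (x + y) \<in> D" using D_add xy by simp
  next
    fix x assume x: "x \<in> carrier (poly_ring m)" "koszul_elem m K {} x \<in> D"
    have "koszul_elem m K {} (- x) = \<ominus>\<^bsub>?E\<^esub> koszul_elem m K {} x"
      unfolding koszul_elem_kclass koszul_a_inv[OF kfam_intros(2)[OF x(1)]]
      by (rule kclass_cong) simp
    then show "koszul_elem m K {} (- x) \<in> D" using D_neg x by simp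
  next
    fix i x assume i: "i \<in> {1..m}" and x: "x \<in> carrier (poly_ring m)" "koszul_elem m K {} x \<in> D"
    show "koszul_elem m K {} (var i * x) \<in> D"
      using D_mult[OF D_v[OF i] koszul_piece_gens(3)[OF i] x(2)]
      unfolding koszul_elem_empty_mult[OF var_closed[OF i] x(1)] .
  qed
  have elem: "koszul_elem m K J p \<in> D" if J: "J \<subseteq> {1..m}" and p: "p \<in> carrier (poly_ring m)" for J p
  proof -
    have "finite J" using J finite_subset by auto
    then show ?thesis using J
    proof (induction J rule: finite_linorder_min_induct)
      case empty
      then show ?case using poly[OF p] by simp
    next
      case (insert i B)
      then have i: "i \<in> {1..m}" by blast
      show ?case
        using D_mult[OF D_u[OF i] koszul_piece_gens(2)[OF i], of "koszul_elem m K B p"] insert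
        unfolding koszul_u_mult_elem[OF p insert.hyps(2)] by simp
    qed
  qed
  have "x \<in> D" if x: "x \<in> carrier ?E" for x
  proof -
    obtain F where F: "F \<in> kfam m" "x = kclass m K F" using x unfolding koszul_carrier by blast
    have "kclass m K (\<lambda>J. if J \<in> S then F J else 0) \<in> D" if "finite S" "S \<subseteq> Pow {1..m}" for S
      using that
    proof (induction S rule: finite_induct)
      case empty
      then show ?case using D_zero by (simp add: koszul_zero)
    next
      case (insert J S)
      then have J: "J \<subseteq> {1..m}" "F J \<in> carrier (poly_ring m)" using F by (auto simp: kfam_def)
      have "(\<lambda>J. if J \<in> S then F J else 0) \<in> kfam m" using F by (auto simp: kfam_def poly_ring_closed)
      from koszul_add[OF kfam_intros(2)[OF J(2)] this, of K J]
      have "koszul_elem m K J (F J) \<oplus>\<^bsub>?E\<^esub> kclass m K (\<lambda>J. if J \<in> S then F J else 0) =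
          kclass m K (\<lambda>J'. (if J' = J then F J else 0) + (if J' \<in> S then F J' else 0))"
        unfolding koszul_elem_kclass .
      also have "\<dots> = kclass m K (\<lambda>J'. if J' \<in> insert J S then F J' else 0)"
        by (rule kclass_cong) (use insert.hyps in auto)
      finally show ?case using D_add[OF elem[OF J]] insert by (metis (no_types, lifting) insert_subset)
    qed
    from this[of "Pow {1..m}"] have "kclass m K (\<lambda>J. if J \<in> Pow {1..m} then F J else 0) \<in> D" by simp
    moreover have "kclass m K (\<lambda>J. if J \<in> Pow {1..m} then F J else 0) = x"
      unfolding F(2) by (rule kclass_cong) simp
    ultimately show ?thesis by simp
  qed
  then have "\<theta>1 x = \<theta>2 x" if "x \<in> carrier ?E" for x using that by (simp add: D_def)
  moreover have "\<theta>1 \<in> extensional (carrier ?E)" "\<theta>2 \<in> extensional (carrier ?E)"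
    using 1 2 by (simp_all add: is_koszul_derivation_def Let_def)
  ultimately show ?thesis by (intro extensionalityI[where A = "carrier ?E"])
qed

lemma koszul_derivation_ex1:
  assumes "\<And>i. i \<in> {1..m} \<Longrightarrow> W i \<in> carrier (poly_ring m)"
  shows "\<exists>!\<theta>. is_koszul_derivation m K (\<lambda>i. koszul_elem m K {} (W i)) \<theta>"
proof (rule ex1I)
  show "is_koszul_derivation m K (\<lambda>i. koszul_elem m K {} (W i)) (kder m K W)"
    by (rule kder_derivation) (rule assms)
qed (rule koszul_derivation_unique, assumption, rule kder_derivation, rule assms)

lemma koszul_d_derivation: "is_koszul_derivation m K (koszul_v m K) (koszul_d m K)"
  unfolding koszul_d_def by (rule theI'[OF koszul_derivation_ex1]) (rule var_closed)

lemma koszul_d'_derivation: "is_koszul_derivation m K (\<lambda>_. \<one>\<^bsub>koszul_algebra m K\<^esub>) (koszul_d' m K)"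
  unfolding koszul_d'_def koszul_one by (rule theI'[OF koszul_derivation_ex1]) (rule poly_ring_closed)

declare One_nat_def [simp]


end

theory Submission
  imports Defs
begin

text \<open>
  Everything reduces to one comparison map, from cochains to the Koszul algebra,
  \<open>\<alpha>\<^bsub>L,I\<^esub> \<mapsto> \<plusminus> u\<^bsub>I - L\<^esub> v\<^bsub>L\<^esub>\<close>. With the sign
  \<open>\<Prod>\<^sub>l\<^sub>\<in>\<^sub>L \<epsilon>(l, I)\<close> it commutes with both differentials (\<open>cochain_sign_insert\<close> and
  \<open>cochain_sign_remove\<close> are the two identities needed), and it carries the basis
  \<open>(L, I)\<close>, \<open>L \<subseteq> I\<close>, onto the monomials \<open>u\<^sub>J v\<^sub>L\<close> with \<open>J \<inter> L = {}\<close>, \<open>L \<in> K\<close>. It is therefore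
  an isomorphism onto \<open>R\<^sup>*(K)\<close>.

  For the second claim, this map is a quasi-isomorphism for \<open>d\<close>. The Stanley-Reisner ideal
  is spanned by the monomials whose support is not a face (\<open>stanley_reisner_ideal_eq\<close>), so the
  Koszul algebra is free abelian on the monomials \<open>u\<^sub>J v\<^sup>a\<close> with \<open>supp a \<in> K\<close>. The differential
  \<open>d\<close> replaces a factor \<open>u\<^sub>k\<close> by \<open>v\<^sub>k\<close>, and so preserves the multidegree \<open>\<chi>\<^sub>J + a\<close>; the squarefree
  multidegrees make up \<open>R\<^sup>*(K)\<close>, which is thus a direct summand of the complex. In a multidegree
  with some entry \<open>\<ge> 2\<close>, fix the least such index \<open>i\<close>. There \<open>v\<^sub>i\<close> divides every monomial, and
  exchanging one factor \<open>v\<^sub>i\<close> for \<open>u\<^sub>i\<close> does not change the support (if \<open>u\<^sub>i\<close> is absent, then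
  \<open>v\<^sub>i\<close> occurs at least twice). This exchange is a contracting homotopy (\<open>mon_homotopy_identity\<close>),
  so the complementary summand is acyclic.

  A quasi-isomorphism for \<open>d\<close> that respects bidegrees and commutes with \<open>d'\<close> induces an
  isomorphism on \<open>H(-, d)\<close> commuting with the maps induced by \<open>d'\<close>. Such an isomorphism
  is again a quasi-isomorphism, now for these induced maps, and taking cohomology once more gives
  \<open>quasi_isomorphism_double_cohomology\<close>.
\<close>

declare One_nat_def [simp del]

section \<open>Cohomology of differential groups\<close>

definition cohomology_class :: "('a, 'c) bigraded_scheme \<Rightarrow> ('a \<Rightarrow> 'a) \<Rightarrow> 'a \<Rightarrow> 'a set" where
  "cohomology_class A \<delta> x = (\<delta> ` carrier (total A)) #>\<^bsub>total A\<^esub> x"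

text \<open>Stated for a bigraded group with an endomorphism, so that it covers both a
  bicomplex with its first differential and the cohomology of a bicomplex with the map induced by
  the second one.\<close>

locale differential_group =
  fixes A :: "('a, 'c) bigraded_scheme" and \<delta> :: "'a \<Rightarrow> 'a"
  assumes comm_group: "comm_group (total A)"
    and hom: "\<delta> \<in> hom (total A) (total A)"
    and square: "x \<in> carrier (total A) \<Longrightarrow> \<delta> (\<delta> x) = \<one>\<^bsub>total A\<^esub>"
begin

abbreviation cocycles :: "'a set" where "cocycles \<equiv> kernel (total A) (total A) \<delta>"

abbreviation coboundaries :: "'a set" where "coboundaries \<equiv> \<delta> ` carrier (total A)"

abbreviation cls :: "'a \<Rightarrow> 'a set" where "cls \<equiv> cohomology_class A \<delta>"

sublocale comm_group "total A" by (rule comm_group)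

sublocale group_hom "total A" "total A" \<delta>
  by unfold_locales (rule hom)

lemma subgroup_cocycles: "subgroup cocycles (total A)"
  by (rule subgroup_kernel)

lemma subgroup_coboundaries: "subgroup coboundaries (total A)"
  by (rule img_is_subgroup)

lemma coboundaries_subset_cocycles: "coboundaries \<subseteq> cocycles"
  by (auto simp: kernel_def square)

lemma cocycles_closed: "x \<in> cocycles \<Longrightarrow> x \<in> carrier (total A)"
  by (simp add: kernel_def)

lemma carrier_cohomology: "carrier (total (cohomology A \<delta>)) = cls ` cocycles"
  by (auto simp: cohomology_def carrier_FactGroup r_coset_def cohomology_class_def)

lemma one_cohomology: "\<one>\<^bsub>total (cohomology A \<delta>)\<^esub> = coboundaries"
  by (simp add: cohomology_def)

lemma piece_cohomology: "piece (cohomology A \<delta>) p q = cls ` (piece A p q \<inter> cocycles)"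
  by (simp add: cohomology_def cohomology_class_def[abs_def])

lemma normal_coboundaries: "coboundaries \<lhd> total A"
  by (rule subgroup_imp_normal[OF subgroup_coboundaries])

lemma mult_cohomology:
  assumes "x \<in> carrier (total A)" "y \<in> carrier (total A)"
  shows "cls x \<otimes>\<^bsub>total (cohomology A \<delta>)\<^esub> cls y = cls (x \<otimes>\<^bsub>total A\<^esub> y)"
  using normal.rcos_sum[OF normal_coboundaries assms] by (simp add: cohomology_def set_mult_def cohomology_class_def)

lemma comm_group_cohomology: "comm_group (total (cohomology A \<delta>))"
proof -
  interpret Z: comm_group "(total A)\<lparr>carrier := cocycles\<rparr>"
    by (rule group.group_comm_groupI[OF subgroup.subgroup_is_group[OF subgroup_cocycles is_group]])
      (simp add: m_comm cocycles_closed)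
  show ?thesis
    unfolding cohomology_def
    using Z.abelian_FactGroup[OF subgroup_incl[OF subgroup_coboundaries subgroup_cocycles
          coboundaries_subset_cocycles]] by simp
qed

lemma cls_eq_coboundaries_iff:
  assumes "x \<in> carrier (total A)"
  shows "cls x = coboundaries \<longleftrightarrow> x \<in> coboundaries"
  using coset_join1[OF _ assms subgroup_coboundaries] coset_join2[OF assms subgroup_coboundaries] assms
    subgroup.subset[OF subgroup_coboundaries] rcos_self[OF assms subgroup_coboundaries]
  unfolding cohomology_class_def by blast

lemma cls_one: "cls \<one>\<^bsub>total A\<^esub> = coboundaries"
  by (simp add: cls_eq_coboundaries_iff subgroup.one_closed[OF subgroup_coboundaries])

lemma cls_coboundary_mult:
  assumes "z \<in> carrier (total A)" "x \<in> carrier (total A)"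
  shows "cls (\<delta> z \<otimes>\<^bsub>total A\<^esub> x) = cls x"
proof -
  have "\<delta> z \<otimes>\<^bsub>total A\<^esub> x \<in> cls x" using assms by (auto simp: cohomology_class_def r_coset_def)
  from repr_independence[OF this[unfolded cohomology_class_def] assms(2) subgroup_coboundaries]
  show ?thesis by (simp add: cohomology_class_def)
qed

end

text \<open>The class of \<open>x\<close> goes to the class of \<open>\<psi> x\<close>. Taking the union over all representatives
  avoids a choice and makes \<^const>\<open>induced_map\<close> the case where source and target coincide.\<close>

definition cohomology_map ::
    "('b, 'd) bigraded_scheme \<Rightarrow> ('b \<Rightarrow> 'b) \<Rightarrow> ('a \<Rightarrow> 'b) \<Rightarrow> 'a set \<Rightarrow> 'b set" where
  "cohomology_map B \<epsilon> \<psi> X = (\<Union>x\<in>X. cohomology_class B \<epsilon> (\<psi> x))"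

lemma induced_map_eq_cohomology_map: "induced_map A \<delta> \<delta>' = cohomology_map A \<delta> \<delta>'"
  by (simp add: fun_eq_iff induced_map_def cohomology_map_def cohomology_class_def)

text \<open>A map on cohomology exists as soon as cocycles go to cocycles and coboundaries to
  coboundaries. Asking for this instead of \<open>\<psi> \<circ> \<delta> = \<epsilon> \<circ> \<psi>\<close> puts chain maps and
  anticommuting differentials, viewed as maps from a complex to itself, under one heading.\<close>

locale cocycle_map =
  A: differential_group A \<delta> + B: differential_group B \<epsilon>
  for A :: "('a, 'c) bigraded_scheme" and \<delta> and B :: "('b, 'd) bigraded_scheme" and \<epsilon> +
  fixes \<psi> :: "'a \<Rightarrow> 'b"
  assumes map_hom: "\<psi> \<in> hom (total A) (total B)"
    and map_cocycles: "x \<in> A.cocycles \<Longrightarrow> \<psi> x \<in> B.cocycles"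
    and map_coboundaries: "x \<in> carrier (total A) \<Longrightarrow> \<psi> (\<delta> x) \<in> B.coboundaries"
begin

lemma cohomology_map_cls:
  assumes x: "x \<in> carrier (total A)"
  shows "cohomology_map B \<epsilon> \<psi> (A.cls x) = B.cls (\<psi> x)"
proof -
  interpret \<psi>: group_hom "total A" "total B" \<psi> by unfold_locales (rule map_hom)
  have "B.cls (\<psi> y) = B.cls (\<psi> x)" if y: "y \<in> A.cls x" for y
  proof -
    obtain z where z: "z \<in> carrier (total A)" "y = \<delta> z \<otimes>\<^bsub>total A\<^esub> x"
      using y by (auto simp: cohomology_class_def r_coset_def)
    obtain w where w: "w \<in> carrier (total B)" "\<psi> (\<delta> z) = \<epsilon> w"
      using map_coboundaries[OF z(1)] by blast
    have "\<psi> y = \<epsilon> w \<otimes>\<^bsub>total B\<^esub> \<psi> x" using z x w by (metis \<psi>.hom_mult A.hom_closed)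
    then show ?thesis using B.cls_coboundary_mult[OF w(1)] x by simp
  qed
  moreover have "x \<in> A.cls x"
    unfolding cohomology_class_def by (rule A.rcos_self[OF x A.subgroup_coboundaries])
  ultimately show ?thesis unfolding cohomology_map_def by blast
qed

lemma cohomology_map_hom:
  "cohomology_map B \<epsilon> \<psi> \<in> hom (total (cohomology A \<delta>)) (total (cohomology B \<epsilon>))"
proof -
  interpret \<psi>: group_hom "total A" "total B" \<psi> by unfold_locales (rule map_hom)
  show ?thesis
  proof (rule homI)
    fix X assume "X \<in> carrier (total (cohomology A \<delta>))"
    then obtain x where "x \<in> A.cocycles" "X = A.cls x" by (auto simp: A.carrier_cohomology)
    then show "cohomology_map B \<epsilon> \<psi> X \<in> carrier (total (cohomology B \<epsilon>))"
      using map_cocycles by (simp add: A.cocycles_closed cohomology_map_cls B.carrier_cohomology)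
  next
    fix X Y assume "X \<in> carrier (total (cohomology A \<delta>))" "Y \<in> carrier (total (cohomology A \<delta>))"
    then obtain x y where xy: "x \<in> carrier (total A)" "X = A.cls x" "y \<in> carrier (total A)" "Y = A.cls y"
      unfolding A.carrier_cohomology using A.cocycles_closed by blast
    then show "cohomology_map B \<epsilon> \<psi> (X \<otimes>\<^bsub>total (cohomology A \<delta>)\<^esub> Y) =
        cohomology_map B \<epsilon> \<psi> X \<otimes>\<^bsub>total (cohomology B \<epsilon>)\<^esub> cohomology_map B \<epsilon> \<psi> Y"
      by (simp add: A.mult_cohomology cohomology_map_cls B.mult_cohomology)
  qed
qed

end

text \<open>Injectivity and surjectivity on cohomology, in terms of representatives. The two
  surjectivity conditions are separate because \<^const>\<open>bigraded_iso\<close> speaks about the total groups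
  and about the components: a cocycle in one bidegree must come from a cocycle in that same
  bidegree.\<close>

locale quasi_isomorphism = cocycle_map +
  assumes map_piece: "\<psi> ` piece A p q \<subseteq> piece B p q"
    and reflects_coboundaries: "x \<in> A.cocycles \<Longrightarrow> \<psi> x \<in> B.coboundaries \<Longrightarrow> x \<in> A.coboundaries"
    and surj: "y \<in> B.cocycles \<Longrightarrow> \<exists>x\<in>A.cocycles. \<exists>w\<in>carrier (total B). y = \<epsilon> w \<otimes>\<^bsub>total B\<^esub> \<psi> x"
    and surj_piece: "y \<in> piece B p q \<inter> B.cocycles \<Longrightarrow>
      \<exists>x\<in>piece A p q \<inter> A.cocycles. \<exists>w\<in>carrier (total B). y = \<epsilon> w \<otimes>\<^bsub>total B\<^esub> \<psi> x"
begin

lemma bigraded_iso_cohomology: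
  "bigraded_iso (cohomology A \<delta>) (cohomology B \<epsilon>) (cohomology_map B \<epsilon> \<psi>)"
proof -
  let ?\<phi> = "cohomology_map B \<epsilon> \<psi>"
  interpret \<psi>: group_hom "total A" "total B" \<psi> by unfold_locales (rule map_hom)
  interpret HA: comm_group "total (cohomology A \<delta>)" by (rule A.comm_group_cohomology)
  interpret HB: comm_group "total (cohomology B \<epsilon>)" by (rule B.comm_group_cohomology)
  interpret \<phi>: group_hom "total (cohomology A \<delta>)" "total (cohomology B \<epsilon>)" ?\<phi>
    by unfold_locales (rule cohomology_map_hom)
  have lift: "\<exists>x\<in>S. ?\<phi> (A.cls x) = B.cls y"
    if y: "\<exists>x\<in>S. \<exists>w\<in>carrier (total B). y = \<epsilon> w \<otimes>\<^bsub>total B\<^esub> \<psi> x" and S: "S \<subseteq> A.cocycles" for y S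
  proof -
    obtain x w where "x \<in> S" "x \<in> carrier (total A)" "w \<in> carrier (total B)" "y = \<epsilon> w \<otimes>\<^bsub>total B\<^esub> \<psi> x"
      using y S A.cocycles_closed by blast
    then show ?thesis
      by (intro bexI[of _ x]) (simp_all add: cohomology_map_cls B.cls_coboundary_mult)
  qed
  have "inj_on ?\<phi> (carrier (total (cohomology A \<delta>)))"
  proof (rule \<phi>.inj_on_one_iff[THEN iffD2], intro allI impI)
    fix X assume X: "X \<in> carrier (total (cohomology A \<delta>))" "?\<phi> X = \<one>\<^bsub>total (cohomology B \<epsilon>)\<^esub>"
    then obtain x where x: "x \<in> A.cocycles" "X = A.cls x" by (auto simp: A.carrier_cohomology)
    have "\<psi> x \<in> B.coboundaries"
      using X(2) x A.cocycles_closed[OF x(1)]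
      by (simp add: cohomology_map_cls B.one_cohomology B.cls_eq_coboundaries_iff)
    then show "X = \<one>\<^bsub>total (cohomology A \<delta>)\<^esub>"
      using reflects_coboundaries[OF x(1)] A.cocycles_closed[OF x(1)] x(2)
      by (simp add: A.one_cohomology A.cls_eq_coboundaries_iff)
  qed
  moreover have "?\<phi> ` carrier (total (cohomology A \<delta>)) = carrier (total (cohomology B \<epsilon>))"
  proof
    show "?\<phi> ` carrier (total (cohomology A \<delta>)) \<subseteq> carrier (total (cohomology B \<epsilon>))" by auto
    show "carrier (total (cohomology B \<epsilon>)) \<subseteq> ?\<phi> ` carrier (total (cohomology A \<delta>))"
    proof
      fix Y assume "Y \<in> carrier (total (cohomology B \<epsilon>))"
      then obtain y where "y \<in> B.cocycles" "Y = B.cls y" by (auto simp: B.carrier_cohomology)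
      then show "Y \<in> ?\<phi> ` carrier (total (cohomology A \<delta>))"
        using lift[OF surj] unfolding A.carrier_cohomology image_image by blast
    qed
  qed
  moreover have "?\<phi> ` piece (cohomology A \<delta>) p q = piece (cohomology B \<epsilon>) p q" for p q
  proof
    show "?\<phi> ` piece (cohomology A \<delta>) p q \<subseteq> piece (cohomology B \<epsilon>) p q"
    proof
      fix Y assume "Y \<in> ?\<phi> ` piece (cohomology A \<delta>) p q"
      then obtain x where x: "x \<in> piece A p q" "x \<in> A.cocycles" "Y = ?\<phi> (A.cls x)"
        by (auto simp: A.piece_cohomology)
      then have "Y = B.cls (\<psi> x)" by (simp add: cohomology_map_cls A.cocycles_closed)
      then show "Y \<in> piece (cohomology B \<epsilon>) p q"
        using map_piece map_cocycles x unfolding B.piece_cohomology by blast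
    qed
    show "piece (cohomology B \<epsilon>) p q \<subseteq> ?\<phi> ` piece (cohomology A \<delta>) p q"
    proof
      fix Y assume "Y \<in> piece (cohomology B \<epsilon>) p q"
      then obtain y where "y \<in> piece B p q \<inter> B.cocycles" "Y = B.cls y" by (auto simp: B.piece_cohomology)
      then show "Y \<in> ?\<phi> ` piece (cohomology A \<delta>) p q"
        using lift[OF surj_piece] unfolding A.piece_cohomology image_image by blast
    qed
  qed
  ultimately show ?thesis
    using cohomology_map_hom by (simp add: bigraded_iso_def iso_def bij_betw_def)
qed

end

locale anticommuting_differentials = differential_group A \<delta>
  for A :: "('a, 'c) bigraded_scheme" and \<delta> +
  fixes \<delta>' :: "'a \<Rightarrow> 'a"
  assumes hom': "\<delta>' \<in> hom (total A) (total A)"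
    and square': "x \<in> carrier (total A) \<Longrightarrow> \<delta>' (\<delta>' x) = \<one>\<^bsub>total A\<^esub>"
    and anticommute: "x \<in> carrier (total A) \<Longrightarrow> \<delta> (\<delta>' x) \<otimes>\<^bsub>total A\<^esub> \<delta>' (\<delta> x) = \<one>\<^bsub>total A\<^esub>"
begin

text \<open>By \<open>\<delta>' \<circ> \<delta> = - \<delta> \<circ> \<delta>'\<close>, the map \<open>\<delta>'\<close> sends the coboundary \<open>\<delta> x\<close> to the
  coboundary \<open>\<delta> (- \<delta>' x)\<close> and cocycles to cocycles.\<close>

sublocale second: cocycle_map A \<delta> A \<delta> \<delta>'
proof unfold_locales
  interpret d': group_hom "total A" "total A" \<delta>' by unfold_locales (rule hom')
  have swap: "\<delta>' (\<delta> x) = \<delta> (inv\<^bsub>total A\<^esub> (\<delta>' x))" if "x \<in> carrier (total A)" for x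
    using inv_equality[of "\<delta>' (\<delta> x)" "\<delta> (\<delta>' x)"] anticommute[OF that] that
    by (simp add: hom_inv m_comm)
  show "\<delta>' \<in> hom (total A) (total A)" by (rule hom')
  show "\<delta>' (\<delta> x) \<in> coboundaries" if "x \<in> carrier (total A)" for x
    unfolding swap[OF that] using that by (intro imageI) simp
  show "\<delta>' x \<in> cocycles" if "x \<in> cocycles" for x
    using that anticommute[of x] by (simp add: kernel_def)
qed

lemma differential_group_cohomology:
  "differential_group (cohomology A \<delta>) (induced_map A \<delta> \<delta>')"
  unfolding induced_map_eq_cohomology_map
proof (rule differential_group.intro)
  show "comm_group (total (cohomology A \<delta>))" by (rule comm_group_cohomology)
  show "cohomology_map A \<delta> \<delta>' \<in> hom (total (cohomology A \<delta>)) (total (cohomology A \<delta>))"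
    by (rule second.cohomology_map_hom)
  fix X assume "X \<in> carrier (total (cohomology A \<delta>))"
  then obtain x where "x \<in> cocycles" "X = cls x" by (auto simp: carrier_cohomology)
  moreover have "\<delta>' y \<in> carrier (total A)" if "y \<in> carrier (total A)" for y
    using hom' that by (auto simp: hom_def)
  ultimately show "cohomology_map A \<delta> \<delta>' (cohomology_map A \<delta> \<delta>' X) = \<one>\<^bsub>total (cohomology A \<delta>)\<^esub>"
    by (simp add: second.cohomology_map_cls cocycles_closed square' one_cohomology cls_one)
qed

end

text \<open>The isomorphism that \<open>\<psi>\<close> induces on the first cohomology commutes with the maps
  induced by the second differentials, since \<open>\<psi>\<close> does so on representatives. A bijection with this
  property matches cocycles with cocycles and coboundaries with coboundaries, so it is itself a
  quasi-isomorphism, and the passage to cohomology can be repeated.\<close>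

theorem quasi_isomorphism_double_cohomology:
  fixes A :: "'a bicomplex" and B :: "'b bicomplex"
  assumes A: "anticommuting_differentials A (diff A) (diff' A)"
    and B: "anticommuting_differentials B (diff B) (diff' B)"
    and \<psi>: "quasi_isomorphism A (diff A) B (diff B) \<psi>"
    and commute': "\<And>x. x \<in> carrier (total A) \<Longrightarrow> \<psi> (diff' A x) = diff' B (\<psi> x)"
  shows "bigraded_isomorphic (first_double_cohomology A) (first_double_cohomology B)"
proof -
  interpret A: anticommuting_differentials A "diff A" "diff' A" by (rule A)
  interpret B: anticommuting_differentials B "diff B" "diff' B" by (rule B)
  interpret \<psi>: quasi_isomorphism A "diff A" B "diff B" \<psi> by (rule \<psi>)
  interpret HA: differential_group "cohomology A (diff A)" "induced_map A (diff A) (diff' A)"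
    by (rule A.differential_group_cohomology)
  interpret HB: differential_group "cohomology B (diff B)" "induced_map B (diff B) (diff' B)"
    by (rule B.differential_group_cohomology)
  let ?\<phi> = "cohomology_map B (diff B) \<psi>"
  have iso: "bigraded_iso (cohomology A (diff A)) (cohomology B (diff B)) ?\<phi>"
    by (rule \<psi>.bigraded_iso_cohomology)
  then have bij: "inj_on ?\<phi> (carrier (total (cohomology A (diff A))))"
      "?\<phi> ` carrier (total (cohomology A (diff A))) = carrier (total (cohomology B (diff B)))"
    and piece: "?\<phi> ` piece (cohomology A (diff A)) p q = piece (cohomology B (diff B)) p q" for p q
    by (simp_all add: bigraded_iso_def iso_def bij_betw_def)
  interpret \<phi>: group_hom "total (cohomology A (diff A))" "total (cohomology B (diff B))" ?\<phi>
    by unfold_locales (rule \<psi>.cohomology_map_hom)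
  have comm: "?\<phi> (induced_map A (diff A) (diff' A) X) = induced_map B (diff B) (diff' B) (?\<phi> X)"
    if X: "X \<in> carrier (total (cohomology A (diff A)))" for X
  proof -
    obtain x where x: "x \<in> A.cocycles" "X = A.cls x" using X by (auto simp: A.carrier_cohomology)
    have c: "x \<in> carrier (total A)" "diff' A x \<in> carrier (total A)" "\<psi> x \<in> carrier (total B)"
      using x A.hom' \<psi>.map_hom by (auto simp: hom_def kernel_def)
    show ?thesis unfolding induced_map_eq_cohomology_map x(2)
      using c by (simp add: A.second.cohomology_map_cls B.second.cohomology_map_cls
          \<psi>.cohomology_map_cls commute')
  qed
  have cocycle: "?\<phi> X \<in> HB.cocycles \<longleftrightarrow> X \<in> HA.cocycles" if X: "X \<in> carrier (total (cohomology A (diff A)))" for X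
  proof -
    have "?\<phi> (induced_map A (diff A) (diff' A) X) = \<one>\<^bsub>total (cohomology B (diff B))\<^esub> \<longleftrightarrow>
      induced_map A (diff A) (diff' A) X = \<one>\<^bsub>total (cohomology A (diff A))\<^esub>"
      using inj_on_eq_iff[OF bij(1) HA.hom_closed[OF X], of "\<one>\<^bsub>total (cohomology A (diff A))\<^esub>"] by simp
    then show ?thesis using X by (simp add: kernel_def comm)
  qed
  have carr: "piece (cohomology A (diff A)) p q \<subseteq> carrier (total (cohomology A (diff A)))" for p q
    by (auto simp: A.piece_cohomology A.carrier_cohomology)
  have "quasi_isomorphism (cohomology A (diff A)) (induced_map A (diff A) (diff' A))
    (cohomology B (diff B)) (induced_map B (diff B) (diff' B)) ?\<phi>"
  proof unfold_locales
    show "?\<phi> X \<in> HB.cocycles" if "X \<in> HA.cocycles" for X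
      using that cocycle HA.cocycles_closed by blast
    show "?\<phi> (induced_map A (diff A) (diff' A) X) \<in> HB.coboundaries"
      if "X \<in> carrier (total (cohomology A (diff A)))" for X
      using that by (simp add: comm)
    show "?\<phi> ` piece (cohomology A (diff A)) p q \<subseteq> piece (cohomology B (diff B)) p q" for p q
      by (simp add: piece)
    show "X \<in> HA.coboundaries" if X: "X \<in> HA.cocycles" "?\<phi> X \<in> HB.coboundaries" for X
    proof -
      obtain W where W: "?\<phi> X = induced_map B (diff B) (diff' B) W" "W \<in> carrier (total (cohomology B (diff B)))"
        using X(2) by (rule imageE)
      obtain Y where Y: "W = ?\<phi> Y" "Y \<in> carrier (total (cohomology A (diff A)))"
        using W(2) unfolding bij(2)[symmetric] by (rule imageE)
      have "?\<phi> X = ?\<phi> (induced_map A (diff A) (diff' A) Y)" unfolding W(1) Y(1) by (rule comm[OF Y(2), symmetric])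
      from inj_onD[OF bij(1) this HA.cocycles_closed[OF X(1)] HA.hom_closed[OF Y(2)]]
      show ?thesis using Y(2) by (rule image_eqI)
    qed
    have lift: "\<exists>X\<in>S \<inter> HA.cocycles. \<exists>W\<in>carrier (total (cohomology B (diff B))).
        Y = induced_map B (diff B) (diff' B) W \<otimes>\<^bsub>total (cohomology B (diff B))\<^esub> ?\<phi> X"
      if Y: "Y \<in> ?\<phi> ` S" "Y \<in> HB.cocycles" and S: "S \<subseteq> carrier (total (cohomology A (diff A)))" for Y S
    proof -
      obtain X where X: "X \<in> S" "Y = ?\<phi> X" using Y(1) by blast
      then have "X \<in> HA.cocycles" using Y(2) S cocycle by blast
      then show ?thesis using X S HB.cocycles_closed[OF Y(2)]
        by (intro bexI[of _ X] bexI[of _ "\<one>\<^bsub>total (cohomology B (diff B))\<^esub>"]) auto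
    qed
    show "\<exists>X\<in>HA.cocycles. \<exists>W\<in>carrier (total (cohomology B (diff B))).
        Y = induced_map B (diff B) (diff' B) W \<otimes>\<^bsub>total (cohomology B (diff B))\<^esub> ?\<phi> X"
      if "Y \<in> HB.cocycles" for Y
      using lift[of Y, OF _ that order_refl] HB.cocycles_closed[OF that] bij(2) by blast
    show "\<exists>X\<in>piece (cohomology A (diff A)) p q \<inter> HA.cocycles. \<exists>W\<in>carrier (total (cohomology B (diff B))).
        Y = induced_map B (diff B) (diff' B) W \<otimes>\<^bsub>total (cohomology B (diff B))\<^esub> ?\<phi> X"
      if "Y \<in> piece (cohomology B (diff B)) p q \<inter> HB.cocycles" for Y p q
      using lift[of Y "piece (cohomology A (diff A)) p q"] that carr piece by blast
  qed (rule \<psi>.cohomology_map_hom)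
  from quasi_isomorphism.bigraded_iso_cohomology[OF this] show ?thesis
    unfolding first_double_cohomology_def bigraded_isomorphic_def by blast
qed


section \<open>Signs\<close>

lemma eps_mult_self [simp]: "eps k A * eps k A = 1"
  by (simp add: eps_def flip: power_add)

lemma eps_insert_other:
  assumes "finite A" "j \<notin> A"
  shows "eps k (insert j A) = (if j < k then - eps k A else eps k A)"
proof -
  have "{r \<in> insert j A. r < k} = (if j < k then insert j {r \<in> A. r < k} else {r \<in> A. r < k})" by auto
  then show ?thesis using assms by (simp add: eps_def)
qed

lemma eps_minus_self [simp]: "eps k (A - {k}) = eps k A"
  unfolding eps_def by (rule arg_cong[where f = "\<lambda>S. (-1) ^ card S"]) auto

text \<open>Removing two factors \<open>u\<^sub>i\<close>, \<open>u\<^sub>k\<close> from an exterior monomial in the two possible orders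
  gives opposite signs. The anticommutation of the differentials rests on this, and
  \<open>eps_swap_insert\<close> is the version for removing one factor and adding another, which the homotopy
  needs.\<close>

lemma eps_swap:
  assumes "finite A" "i \<notin> A" "k \<notin> A" "i \<noteq> k"
  shows "eps i A * eps k (insert i A) = - (eps k A * eps i (insert k A))"
  using assms by (auto simp: eps_insert_other)

lemma eps_swap_insert:
  assumes "finite A" "i \<notin> A" "k \<notin> A" "i \<noteq> k"
  shows "eps k A * eps i A = - (eps i (insert k A) * eps k (insert i A))"
  using assms by (auto simp: eps_insert_other)


section \<open>Monomials and the contraction of the non-squarefree part\<close>

type_synonym monomial = "nat set \<times> (nat \<Rightarrow>\<^sub>0 nat)"

text \<open>The pair \<open>(J, a)\<close> stands for \<open>u\<^sub>J v\<^sup>a\<close>. The support condition on \<open>a\<close> selects the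
  monomials that do not vanish in the face ring.\<close>

definition monomials :: "nat \<Rightarrow> nat set set \<Rightarrow> monomial set" where
  "monomials m K = {(J, a). J \<subseteq> {1..m} \<and> Poly_Mapping.keys a \<in> K}"

definition mon_d :: "nat set set \<Rightarrow> (monomial \<Rightarrow>\<^sub>0 int) \<Rightarrow> (monomial \<Rightarrow>\<^sub>0 int)" where
  "mon_d K = frag_extend (\<lambda>(J, a). \<Sum>k \<in> {k \<in> J. insert k (Poly_Mapping.keys a) \<in> K}.
     frag_cmul (eps k J) (frag_of (J - {k}, a + Poly_Mapping.single k 1)))"

definition mon_d' :: "(monomial \<Rightarrow>\<^sub>0 int) \<Rightarrow> (monomial \<Rightarrow>\<^sub>0 int)" where
  "mon_d' = frag_extend (\<lambda>(J, a). \<Sum>k \<in> J. frag_cmul (eps k J) (frag_of (J - {k}, a)))"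

lemma keys_plus_single: "Poly_Mapping.keys (a + Poly_Mapping.single k (1::nat)) = insert k (Poly_Mapping.keys a)"
  by (auto simp: in_keys_iff lookup_add lookup_single when_def split: if_splits)

text \<open>The indices at which the multidegree \<open>\<chi>\<^sub>J + a\<close> of \<open>u\<^sub>J v\<^sup>a\<close> is at least \<open>2\<close>. Since the
  differential \<open>d\<close> preserves the multidegree, it preserves this set (\<open>excess_d\<close>).\<close>

definition excess :: "monomial \<Rightarrow> nat set" where
  "excess = (\<lambda>(J, a). {i. 2 \<le> Poly_Mapping.lookup a i + (if i \<in> J then 1 else 0)})"

definition pivot :: "monomial \<Rightarrow> nat" where
  "pivot x = (LEAST i. i \<in> excess x)"

text \<open>The exchange of a factor \<open>v\<^sub>i\<close> for \<open>u\<^sub>i\<close> at the pivot \<open>i\<close>, which is zero if \<open>u\<^sub>i\<close> is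
  already present because \<open>u\<^sub>i\<^sup>2 = 0\<close>. The sign is the one of \<open>u\<^sub>i u\<^sub>J = \<plusminus> u\<^bsub>J \<union> {i}\<^esub>\<close>.\<close>

definition mon_homotopy :: "(monomial \<Rightarrow>\<^sub>0 int) \<Rightarrow> (monomial \<Rightarrow>\<^sub>0 int)" where
  "mon_homotopy = frag_extend (\<lambda>(J, a). if excess (J, a) = {} \<or> pivot (J, a) \<in> J then 0
     else frag_cmul (eps (pivot (J, a)) J)
       (frag_of (insert (pivot (J, a)) J, a - Poly_Mapping.single (pivot (J, a)) 1)))"

definition squarefree_part :: "(monomial \<Rightarrow>\<^sub>0 int) \<Rightarrow> (monomial \<Rightarrow>\<^sub>0 int)" where
  "squarefree_part = frag_extend (\<lambda>x. if excess x = {} then frag_of x else 0)"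

lemma pivot_in_excess: "excess x \<noteq> {} \<Longrightarrow> pivot x \<in> excess x"
  unfolding pivot_def by (rule LeastI_ex) blast

lemma excess_d:
  assumes "k \<in> J"
  shows "excess (J - {k}, a + Poly_Mapping.single k 1) = excess (J, a)"
  using assms by (auto simp: excess_def lookup_add lookup_single when_def split: if_splits)

lemma mon_homotopy_d_term:
  assumes "k \<in> J"
  shows "mon_homotopy (frag_of (J - {k}, a + Poly_Mapping.single k 1)) =
    (if excess (J, a) = {} \<or> pivot (J, a) \<in> J - {k} then 0
     else frag_cmul (eps (pivot (J, a)) (J - {k}))
       (frag_of (insert (pivot (J, a)) (J - {k}), a + Poly_Mapping.single k 1 - Poly_Mapping.single (pivot (J, a)) 1)))"
  unfolding mon_homotopy_def using excess_d[OF assms] by (simp add: pivot_def)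

text \<open>Write \<open>h\<close> for the homotopy and let \<open>x = u\<^sub>J v\<^sup>a\<close> have pivot \<open>i\<close>. If \<open>i \<in> J\<close>, then
  \<open>h x = 0\<close>, and of the terms of \<open>d x\<close> only the one that turns \<open>u\<^sub>i\<close> into \<open>v\<^sub>i\<close> survives \<open>h\<close>, which
  turns it back into \<open>x\<close>. If \<open>i \<notin> J\<close>, then the term of \<open>d (h x)\<close> that turns \<open>u\<^sub>i\<close> back into \<open>v\<^sub>i\<close>
  is \<open>x\<close>, and the remaining terms cancel against those of \<open>h (d x)\<close>.\<close>

lemma mon_homotopy_identity_monomial:
  assumes fin: "finite J" and a: "Poly_Mapping.keys a \<in> K"
  shows "mon_d K (mon_homotopy (frag_of (J, a))) + mon_homotopy (mon_d K (frag_of (J, a))) =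
    frag_of (J, a) - squarefree_part (frag_of (J, a))"
proof (cases "excess (J, a) = {}")
  case True
  have "mon_homotopy (mon_d K (frag_of (J, a))) = 0"
    unfolding mon_d_def using fin True mon_homotopy_d_term
    by (simp add: mon_homotopy_def frag_extend_sum frag_extend_cmul)
  then show ?thesis using True by (simp add: mon_homotopy_def squarefree_part_def mon_d_def)
next
  case False
  define i where "i = pivot (J, a)"
  define S where "S = {k \<in> J. insert k (Poly_Mapping.keys a) \<in> K}"
  have finS: "finite S" using fin by (simp add: S_def)
  have i: "2 \<le> Poly_Mapping.lookup a i + (if i \<in> J then 1 else 0)"
    using pivot_in_excess[OF False] unfolding i_def by (simp add: excess_def)
  \<comment> \<open>The variable at the pivot divides \<open>v\<^sup>a\<close> since the exterior part contributes at most one to the multidegree.\<close>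
  then have ia: "i \<in> Poly_Mapping.keys a" by (auto simp: in_keys_iff split: if_splits)
  have hd: "mon_homotopy (mon_d K (frag_of (J, a))) = (\<Sum>k\<in>S. frag_cmul (eps k J)
     (mon_homotopy (frag_of (J - {k}, a + Poly_Mapping.single k 1))))"
    unfolding mon_d_def using fin by (simp add: mon_homotopy_def frag_extend_sum frag_extend_cmul S_def)
  have r: "squarefree_part (frag_of (J, a)) = 0" using False by (simp add: squarefree_part_def)
  show ?thesis
  proof (cases "i \<in> J")
    case True
    then have h: "mon_homotopy (frag_of (J, a)) = 0" by (simp add: mon_homotopy_def i_def)
    have "i \<in> S" using True a ia by (simp add: S_def insert_absorb)
    have "mon_homotopy (mon_d K (frag_of (J, a))) = (\<Sum>k\<in>S. if k = i then frag_of (J, a) else 0)"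
      unfolding hd
    proof (rule sum.cong[OF refl])
      fix k assume k: "k \<in> S"
      then have "k \<in> J" by (simp add: S_def)
      then show "frag_cmul (eps k J) (mon_homotopy (frag_of (J - {k}, a + Poly_Mapping.single k 1))) =
          (if k = i then frag_of (J, a) else 0)"
        using True False by (simp add: mon_homotopy_d_term insert_absorb flip: i_def)
    qed
    then show ?thesis using \<open>i \<in> S\<close> finS by (simp add: h r mon_d_def)
  next
    case iJ: False
    define b where "b = a - Poly_Mapping.single i 1"
    have ab: "a = b + Poly_Mapping.single i 1"
      using i iJ by (intro poly_mapping_eqI) (auto simp: b_def lookup_add lookup_minus lookup_single when_def)
    \<comment> \<open>Here \<open>u\<^sub>i\<close> is absent, so the exponent of \<open>v\<^sub>i\<close> is at least \<open>2\<close> and the support stays the same.\<close>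
    have keys_b: "Poly_Mapping.keys b = Poly_Mapping.keys a"
      using i iJ by (auto simp: b_def in_keys_iff lookup_minus lookup_single when_def)
    have h: "mon_homotopy (frag_of (J, a)) = frag_cmul (eps i J) (frag_of (insert i J, b))"
      using False iJ by (simp add: mon_homotopy_def b_def flip: i_def)
    have "{k \<in> insert i J. insert k (Poly_Mapping.keys b) \<in> K} = insert i S"
      using ia a by (auto simp: S_def keys_b insert_absorb)
    moreover have "i \<notin> S" using iJ by (simp add: S_def)
    ultimately have "mon_d K (mon_homotopy (frag_of (J, a))) = frag_of (J, a) +
      (\<Sum>k\<in>S. frag_cmul (eps i J * eps k (insert i J)) (frag_of (insert i J - {k}, b + Poly_Mapping.single k 1)))"
      unfolding h mon_d_def using finS iJ
      by (simp add: frag_extend_cmul frag_cmul_distrib2 frag_cmul_sum ab)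
    moreover have "mon_homotopy (mon_d K (frag_of (J, a))) =
      (\<Sum>k\<in>S. - frag_cmul (eps i J * eps k (insert i J)) (frag_of (insert i J - {k}, b + Poly_Mapping.single k 1)))"
      unfolding hd
    proof (rule sum.cong[OF refl])
      fix k assume "k \<in> S"
      then have k: "k \<in> J" "k \<noteq> i" using iJ by (auto simp: S_def)
      have e: "eps k J * eps i (J - {k}) = - (eps i J * eps k (insert i J))"
        using eps_swap_insert[of "J - {k}" i k] k iJ fin eps_minus_self[of k "insert i J"]
        by (simp add: insert_absorb insert_Diff_if)
      have s: "insert i (J - {k}) = insert i J - {k}" using k by auto
      have m: "a + Poly_Mapping.single k 1 - Poly_Mapping.single i 1 = b + Poly_Mapping.single k 1"
        by (rule poly_mapping_eqI) (simp add: ab lookup_add lookup_minus)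
      show "frag_cmul (eps k J) (mon_homotopy (frag_of (J - {k}, a + Poly_Mapping.single k 1))) =
        - frag_cmul (eps i J * eps k (insert i J)) (frag_of (insert i J - {k}, b + Poly_Mapping.single k 1))"
        using mon_homotopy_d_term[OF k(1), of a] iJ False e by (simp add: s m flip: i_def)
    qed
    ultimately show ?thesis by (simp add: r sum_negf del: minus_frag_cmul)
  qed
qed



lemma mon_homotopy_identity:
  assumes "Poly_Mapping.keys c \<subseteq> monomials m K"
  shows "mon_d K (mon_homotopy c) + mon_homotopy (mon_d K c) = c - squarefree_part c"
  using assms
proof (induction c rule: frag_induction)
  case zero
  then show ?case by (simp add: mon_d_def mon_homotopy_def squarefree_part_def)
next
  case (one x)
  then show ?case
    using mon_homotopy_identity_monomial by (auto simp: monomials_def finite_subset)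
next
  case (diff a b)
  have "mon_d K (mon_homotopy (a - b)) + mon_homotopy (mon_d K (a - b)) =
      (mon_d K (mon_homotopy a) + mon_homotopy (mon_d K a)) - (mon_d K (mon_homotopy b) + mon_homotopy (mon_d K b))"
    by (simp add: mon_d_def mon_homotopy_def frag_extend_diff)
  then show ?case unfolding diff by (simp add: squarefree_part_def frag_extend_diff)
qed

lemma keys_frag_extend_subset:
  assumes "Poly_Mapping.keys c \<subseteq> S" "\<And>x. x \<in> S \<Longrightarrow> Poly_Mapping.keys (f x) \<subseteq> T"
  shows "Poly_Mapping.keys (frag_extend f c) \<subseteq> T"
  using keys_frag_extend[of f c] assms by blast

lemma keys_sum_subset:
  assumes "\<And>i. i \<in> I \<Longrightarrow> Poly_Mapping.keys (f i) \<subseteq> T"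
  shows "Poly_Mapping.keys (\<Sum>i\<in>I. f i :: 'a \<Rightarrow>\<^sub>0 int) \<subseteq> T"
  using keys_sum[of f I] assms by blast

lemma keys_mon_d:
  assumes "Poly_Mapping.keys c \<subseteq> monomials m K"
  shows "Poly_Mapping.keys (mon_d K c) \<subseteq> monomials m K"
  unfolding mon_d_def using assms
  by (rule keys_frag_extend_subset)
    (auto intro!: keys_sum_subset simp: monomials_def keys_plus_single)

lemma keys_mon_d':
  assumes "Poly_Mapping.keys c \<subseteq> monomials m K"
  shows "Poly_Mapping.keys (mon_d' c) \<subseteq> monomials m K"
  unfolding mon_d'_def using assms
  by (rule keys_frag_extend_subset) (auto intro!: keys_sum_subset simp: monomials_def)

lemma keys_mon_homotopy:
  assumes K: "K \<subseteq> Pow {1..m}" and "Poly_Mapping.keys c \<subseteq> monomials m K"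
  shows "Poly_Mapping.keys (mon_homotopy c) \<subseteq> monomials m K"
  unfolding mon_homotopy_def using assms(2)
proof (rule keys_frag_extend_subset)
  fix x assume "x \<in> monomials m K"
  then obtain J a where x: "x = (J, a)" "J \<subseteq> {1..m}" "Poly_Mapping.keys a \<in> K" by (auto simp: monomials_def)
  show "Poly_Mapping.keys (case x of (J, a) \<Rightarrow> if excess (J, a) = {} \<or> pivot (J, a) \<in> J then 0
     else frag_cmul (eps (pivot (J, a)) J)
       (frag_of (insert (pivot (J, a)) J, a - Poly_Mapping.single (pivot (J, a)) 1))) \<subseteq> monomials m K"
  proof (cases "excess (J, a) = {} \<or> pivot (J, a) \<in> J")
    case False
    define i where "i = pivot (J, a)"
    have "2 \<le> Poly_Mapping.lookup a i"
      using pivot_in_excess[of "(J, a)"] False unfolding i_def by (simp add: excess_def)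
    then have "Poly_Mapping.keys (a - Poly_Mapping.single i 1) = Poly_Mapping.keys a" "i \<in> Poly_Mapping.keys a"
      by (auto simp: in_keys_iff lookup_minus lookup_single when_def)
    moreover from this x K have "i \<in> {1..m}" by blast
    ultimately show ?thesis using False x by (auto simp: monomials_def simp flip: i_def)
  qed (simp add: x)
qed

lemma keys_squarefree_part:
  "Poly_Mapping.keys (squarefree_part c) \<subseteq> {x \<in> Poly_Mapping.keys c. excess x = {}}"
  unfolding squarefree_part_def by (rule keys_frag_extend_subset[OF order_refl]) auto

text \<open>Because \<open>d\<close> preserves the multidegree, the squarefree monomials and the others span two
  subcomplexes.\<close>

lemma squarefree_part_mon_d:
  assumes "Poly_Mapping.keys c \<subseteq> monomials m K"
  shows "squarefree_part (mon_d K c) = mon_d K (squarefree_part c)"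
  using assms
proof (induction c rule: frag_induction)
  case (one x)
  then obtain J a where x: "x = (J, a)" "finite J" by (auto simp: monomials_def finite_subset)
  show ?case
    using x(2) excess_d[of _ J a]
    by (simp add: x(1) mon_d_def squarefree_part_def frag_extend_sum frag_extend_cmul)
qed (simp_all add: squarefree_part_def mon_d_def frag_extend_diff)

lemma squarefree_part_eq:
  assumes "Poly_Mapping.keys c \<subseteq> {x. excess x = {}}"
  shows "squarefree_part c = c"
  using assms by (induction c rule: frag_induction) (simp_all add: squarefree_part_def frag_extend_diff)


section \<open>Cochains as squarefree monomials\<close>

definition exponent :: "nat set \<Rightarrow> (nat \<Rightarrow>\<^sub>0 nat)" where
  "exponent L = (\<Sum>i\<in>L. Poly_Mapping.single i 1)"

lemma lookup_exponent:
  "finite L \<Longrightarrow> Poly_Mapping.lookup (exponent L) i = (if i \<in> L then 1 else 0)"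
  by (simp add: exponent_def lookup_sum lookup_single when_def)

lemma keys_exponent: "finite L \<Longrightarrow> Poly_Mapping.keys (exponent L) = L"
  by (rule Set.set_eqI) (simp add: in_keys_iff lookup_exponent)

lemma exponent_insert:
  "finite L \<Longrightarrow> i \<notin> L \<Longrightarrow> exponent L + Poly_Mapping.single i 1 = exponent (insert i L)"
  by (simp add: exponent_def add.commute)

text \<open>The squarefree monomials are exactly the \<open>u\<^sub>J v\<^sub>L\<close> with \<open>J \<inter> L = {}\<close>, the basis of
  \<open>R\<^sup>*(K)\<close>.\<close>

lemma excess_empty_iff:
  "excess (J, a) = {} \<longleftrightarrow> J \<inter> Poly_Mapping.keys a = {} \<and> a = exponent (Poly_Mapping.keys a)"
proof
  assume "excess (J, a) = {}"
  then have *: "Poly_Mapping.lookup a i + (if i \<in> J then 1 else 0) \<le> 1" for i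
    by (auto simp: excess_def not_le less_eq_Suc_le numeral_2_eq_2 One_nat_def)
  have "J \<inter> Poly_Mapping.keys a = {}"
  proof (rule ccontr)
    assume "J \<inter> Poly_Mapping.keys a \<noteq> {}"
    then obtain i where "i \<in> J" "Poly_Mapping.lookup a i \<noteq> 0" by (auto simp: in_keys_iff)
    then show False using *[of i] by simp
  qed
  moreover have "a = exponent (Poly_Mapping.keys a)"
  proof (rule poly_mapping_eqI)
    fix i show "Poly_Mapping.lookup a i = Poly_Mapping.lookup (exponent (Poly_Mapping.keys a)) i"
      using *[of i] by (cases "Poly_Mapping.lookup a i = 0") (auto simp: lookup_exponent in_keys_iff split: if_splits)
  qed
  ultimately show "J \<inter> Poly_Mapping.keys a = {} \<and> a = exponent (Poly_Mapping.keys a)" ..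
next
  assume a: "J \<inter> Poly_Mapping.keys a = {} \<and> a = exponent (Poly_Mapping.keys a)"
  have "\<not> 2 \<le> Poly_Mapping.lookup a i + (if i \<in> J then 1 else 0)" for i
    using a lookup_exponent[OF finite_keys, of a i] by (auto simp: in_keys_iff split: if_splits)
  then show "excess (J, a) = {}" by (simp add: excess_def)
qed

text \<open>The sign relating \<open>\<alpha>\<^bsub>L,I\<^esub>\<close> to \<open>u\<^bsub>I - L\<^esub> v\<^sub>L\<close>. Compatibility with \<open>d\<close> forces
  \<open>s(L \<union> {k}, I) = \<epsilon>(k, I) s(L, I)\<close>, because \<open>\<epsilon>(k, L) \<epsilon>(k, I - L) = \<epsilon>(k, I)\<close>. This determines \<open>s\<close> up to
  a factor depending on \<open>I\<close> only.\<close>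

definition cochain_sign :: "nat set \<Rightarrow> nat set \<Rightarrow> int" where
  "cochain_sign L I = (\<Prod>l\<in>L. eps l I)"

lemma cochain_sign_self [simp]: "cochain_sign L I * cochain_sign L I = 1"
  by (simp add: cochain_sign_def flip: prod.distrib)

text \<open>Compatibility of the signs with \<open>d\<close>.\<close>

lemma cochain_sign_insert:
  assumes "finite I" "L \<subseteq> I" "k \<in> I - L"
  shows "cochain_sign L I * eps k (I - L) = eps k L * cochain_sign (insert k L) I"
proof -
  have fin: "finite L" using assms finite_subset by blast
  have "eps k I = eps k L * eps k (I - L)"
    using eps_Un[of L "I - L" k] assms fin by (simp add: Un_absorb1)
  then show ?thesis using assms fin by (simp add: cochain_sign_def)
qed

lemma eps_prod: "finite A \<Longrightarrow> eps i A = (\<Prod>l\<in>A. if l < i then - 1 else 1)"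
  by (induction A rule: finite_induct) (simp_all add: eps_insert_other)

text \<open>Compatibility of the signs with \<open>d'\<close>. Removing \<open>i\<close> from \<open>I\<close> changes the factor of each
  \<open>l \<in> L\<close> with \<open>l > i\<close>. There are \<open>|L| - #{l \<in> L: l < i}\<close> of them, which explains the global sign
  \<open>(-1)\<^sup>|\<^sup>L\<^sup>|\<close> in the definition of \<open>d'\<close> on cochains.\<close>

lemma cochain_sign_remove:
  assumes "finite I" "L \<subseteq> I" "i \<in> I - L"
  shows "cochain_sign L I * eps i (I - L) = (- 1) ^ card L * eps i I * cochain_sign L (I - {i})"
proof -
  have fin: "finite L" using assms finite_subset by blast
  have I: "eps i I = eps i L * eps i (I - L)"
    using eps_Un[of L "I - L" i] assms fin by (simp add: Un_absorb1)
  have "cochain_sign L I = (\<Prod>l\<in>L. (- 1) * (if l < i then - 1 else 1) * eps l (I - {i}))"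
    unfolding cochain_sign_def
  proof (rule prod.cong[OF refl])
    fix l assume "l \<in> L"
    then have "l \<noteq> i" using assms(3) by auto
    then show "eps l I = (- 1) * (if l < i then - 1 else 1) * eps l (I - {i})"
      using eps_insert_other[of "I - {i}" i l] assms(1,3) insert_Diff[of i I]
      by (cases "l < i") simp_all
  qed
  also have "\<dots> = (- 1) ^ card L * eps i L * cochain_sign L (I - {i})"
    unfolding prod.distrib cochain_sign_def eps_prod[OF fin] by simp
  finally show ?thesis unfolding I by (simp add: mult_ac)
qed

definition cochain_to_mon :: "((nat set \<times> nat set) \<Rightarrow>\<^sub>0 int) \<Rightarrow> (monomial \<Rightarrow>\<^sub>0 int)" where
  "cochain_to_mon = frag_extend (\<lambda>(L, I). frag_cmul (cochain_sign L I) (frag_of (I - L, exponent L)))"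

definition mon_to_cochain :: "(monomial \<Rightarrow>\<^sub>0 int) \<Rightarrow> ((nat set \<times> nat set) \<Rightarrow>\<^sub>0 int)" where
  "mon_to_cochain = frag_extend (\<lambda>(J, a). let L = Poly_Mapping.keys a in
     frag_cmul (cochain_sign L (J \<union> L)) (frag_of (L, J \<union> L)))"

lemma cochain_basisD:
  assumes "(L, I) \<in> cochain_basis m K"
  shows "I \<subseteq> {1..m}" "L \<subseteq> I" "L \<in> K" "finite I" "finite L"
proof -
  show *: "I \<subseteq> {1..m}" "L \<subseteq> I" "L \<in> K"
    using assms by (auto simp: cochain_basis_def full_subcomplex_def)
  show "finite I" using *(1) by (rule finite_subset) simp
  with *(2) show "finite L" by (rule finite_subset)
qed

definition squarefree_monomials :: "nat \<Rightarrow> nat set set \<Rightarrow> monomial set" where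
  "squarefree_monomials m K = {x \<in> monomials m K. excess x = {}}"

lemma mon_to_cochain_to_mon:
  assumes "Poly_Mapping.keys c \<subseteq> cochain_basis m K"
  shows "mon_to_cochain (cochain_to_mon c) = c"
  using assms
proof (induction c rule: frag_induction)
  case (one x)
  obtain L I where LI: "x = (L, I)" by (cases x)
  then have x: "x = (L, I)" "L \<subseteq> I" "finite L" using one cochain_basisD[of L I m K] by simp_all
  then have "I - L \<union> L = I" by blast
  then show ?case using x
    by (simp add: mon_to_cochain_def cochain_to_mon_def frag_extend_cmul keys_exponent)
qed (simp_all add: mon_to_cochain_def cochain_to_mon_def frag_extend_diff)

lemma cochain_to_mon_to_cochain:
  assumes "Poly_Mapping.keys c \<subseteq> squarefree_monomials m K"
  shows "cochain_to_mon (mon_to_cochain c) = c"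
  using assms
proof (induction c rule: frag_induction)
  case (one x)
  obtain J a where Ja: "x = (J, a)" by (cases x)
  then have x: "x = (J, a)" "J \<inter> Poly_Mapping.keys a = {}" "exponent (Poly_Mapping.keys a) = a"
    using one by (simp_all add: squarefree_monomials_def excess_empty_iff)
  then have "J \<union> Poly_Mapping.keys a - Poly_Mapping.keys a = J" by blast
  then show ?case using x
    by (simp add: mon_to_cochain_def cochain_to_mon_def frag_extend_cmul Let_def)
qed (simp_all add: mon_to_cochain_def cochain_to_mon_def frag_extend_diff)

text \<open>Up to sign, \<^const>\<open>cochain_to_mon\<close> is a bijection between two bases. For that reason it
  identifies the spans of corresponding basis subsets; the instances below are the total group and
  each bidegree.\<close>

lemma cochain_to_mon_image:
  assumes "S \<subseteq> cochain_basis m K" "T \<subseteq> squarefree_monomials m K"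
    and S: "\<And>L I. (L, I) \<in> S \<Longrightarrow> (I - L, exponent L) \<in> T"
    and T: "\<And>J a. (J, a) \<in> T \<Longrightarrow> (Poly_Mapping.keys a, J \<union> Poly_Mapping.keys a) \<in> S"
  shows "cochain_to_mon ` carrier (free_Abelian_group S) = carrier (free_Abelian_group T)"
proof (intro equalityI subsetI)
  fix c assume "c \<in> cochain_to_mon ` carrier (free_Abelian_group S)"
  then obtain b where "c = cochain_to_mon b" "Poly_Mapping.keys b \<subseteq> S" by auto
  moreover have "Poly_Mapping.keys (cochain_to_mon b) \<subseteq> T"
    unfolding cochain_to_mon_def using \<open>Poly_Mapping.keys b \<subseteq> S\<close>
    by (rule keys_frag_extend_subset[of _ S]) (use S in auto)
  ultimately show "c \<in> carrier (free_Abelian_group T)" by simp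
next
  fix c assume "c \<in> carrier (free_Abelian_group T)"
  then have c: "Poly_Mapping.keys c \<subseteq> T" by simp
  then have "Poly_Mapping.keys (mon_to_cochain c) \<subseteq> S"
    unfolding mon_to_cochain_def
    by (rule keys_frag_extend_subset[of _ T]) (use T in \<open>auto simp: Let_def\<close>)
  moreover have "cochain_to_mon (mon_to_cochain c) = c"
    using c assms(2) by (intro cochain_to_mon_to_cochain[of _ m K]) blast
  ultimately show "c \<in> cochain_to_mon ` carrier (free_Abelian_group S)"
    by (metis carrier_free_Abelian_group_iff image_eqI)
qed

lemma squarefree_monomials_iff:
  "(J, a) \<in> squarefree_monomials m K \<longleftrightarrow>
    J \<subseteq> {1..m} \<and> Poly_Mapping.keys a \<in> K \<and> J \<inter> Poly_Mapping.keys a = {} \<and> a = exponent (Poly_Mapping.keys a)"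
  by (auto simp: squarefree_monomials_def monomials_def excess_empty_iff)

lemma cochain_basis_to_squarefree:
  "(L, I) \<in> cochain_basis m K \<Longrightarrow> (I - L, exponent L) \<in> squarefree_monomials m K"
  using cochain_basisD[of L I m K] by (auto simp: squarefree_monomials_iff keys_exponent)

lemma squarefree_to_cochain_basis:
  assumes "K \<subseteq> Pow {1..m}" "(J, a) \<in> squarefree_monomials m K"
  shows "(Poly_Mapping.keys a, J \<union> Poly_Mapping.keys a) \<in> cochain_basis m K"
  using assms by (auto simp: squarefree_monomials_iff cochain_basis_def full_subcomplex_def)

definition monomial_piece :: "nat \<Rightarrow> nat set set \<Rightarrow> int \<Rightarrow> int \<Rightarrow> monomial set" where
  "monomial_piece m K p q = {(J, a) \<in> monomials m K.
     p = - int (card J) \<and> q = 2 * int (card J) + 2 * int (\<Sum>i=1..m. Poly_Mapping.lookup a i)}"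

lemma sum_lookup_exponent:
  assumes "L \<subseteq> {1..m}"
  shows "(\<Sum>i=1..m. Poly_Mapping.lookup (exponent L) i) = card L"
proof -
  have "finite L" using assms finite_subset by blast
  then have "(\<Sum>i=1..m. Poly_Mapping.lookup (exponent L) i) = (\<Sum>i=1..m. if i \<in> L then 1 else 0)"
    by (simp add: lookup_exponent)
  also have "\<dots> = card L" using assms by (simp add: sum.If_cases Int_absorb1)
  finally show ?thesis .
qed

lemma cochain_to_mon_carrier:
  assumes "K \<subseteq> Pow {1..m}"
  shows "cochain_to_mon ` carrier (total (cochain_bicomplex m K)) =
    carrier (free_Abelian_group (squarefree_monomials m K))"
  unfolding cochain_bicomplex_def bigraded.simps
  by (rule cochain_to_mon_image[where m = m and K = K])
    (use assms cochain_basis_to_squarefree squarefree_to_cochain_basis in auto)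

lemma cochain_to_mon_piece:
  assumes "K \<subseteq> Pow {1..m}"
  shows "cochain_to_mon ` piece (cochain_bicomplex m K) p q =
    carrier (free_Abelian_group (squarefree_monomials m K \<inter> monomial_piece m K p q))"
  unfolding cochain_bicomplex_def bigraded.simps
proof (rule cochain_to_mon_image[where m = m and K = K])
  fix L I assume LI: "(L, I) \<in> {(L, I) \<in> cochain_basis m K. p = int (card L) - int (card I) \<and> q = 2 * int (card I)}"
  then have b: "(L, I) \<in> cochain_basis m K" by simp
  note D = cochain_basisD[OF b]
  have "card L \<le> card I" using D by (simp add: card_mono)
  moreover have "card (I - L) = card I - card L" using D by (simp add: card_Diff_subset)
  moreover have "(\<Sum>i=1..m. Poly_Mapping.lookup (exponent L) i) = card L"
    using D by (intro sum_lookup_exponent) auto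
  ultimately show "(I - L, exponent L) \<in> squarefree_monomials m K \<inter> monomial_piece m K p q"
    using LI cochain_basis_to_squarefree[OF b]
    by (simp add: monomial_piece_def squarefree_monomials_def of_nat_diff del: of_nat_sum)
next
  fix J a assume "(J, a) \<in> squarefree_monomials m K \<inter> monomial_piece m K p q"
  then have b: "(J, a) \<in> squarefree_monomials m K" and pq: "p = - int (card J)"
    "q = 2 * int (card J) + 2 * int (\<Sum>i=1..m. Poly_Mapping.lookup a i)"
    by (simp_all add: monomial_piece_def)
  have J: "J \<subseteq> {1..m}" "J \<inter> Poly_Mapping.keys a = {}" and a: "a = exponent (Poly_Mapping.keys a)"
    and ka: "Poly_Mapping.keys a \<subseteq> {1..m}"
    using b assms unfolding squarefree_monomials_iff by blast+
  have "finite J" using J finite_subset by blast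
  then have "card (J \<union> Poly_Mapping.keys a) = card J + card (Poly_Mapping.keys a)"
    using J by (simp add: card_Un_disjoint)
  moreover have "(\<Sum>i=1..m. Poly_Mapping.lookup a i) = card (Poly_Mapping.keys a)"
    using sum_lookup_exponent[OF ka] a by simp
  ultimately show "(Poly_Mapping.keys a, J \<union> Poly_Mapping.keys a) \<in>
      {(L, I) \<in> cochain_basis m K. p = int (card L) - int (card I) \<and> q = 2 * int (card I)}"
    using squarefree_to_cochain_basis[OF assms b] pq by (simp del: of_nat_sum)
qed auto

lemma cochain_to_mon_d:
  assumes "Poly_Mapping.keys c \<subseteq> cochain_basis m K"
  shows "cochain_to_mon (cochain_d K c) = mon_d K (cochain_to_mon c)"
  using assms
proof (induction c rule: frag_induction)
  case (one x)
  obtain L I where x: "x = (L, I)" by (cases x)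
  then have b: "(L, I) \<in> cochain_basis m K" using one by simp
  note D = cochain_basisD[OF b]
  let ?S = "{k \<in> I - L. insert k L \<in> K}"
  have "finite ?S" using D by simp
  then have "cochain_to_mon (cochain_d K (frag_of x)) =
      (\<Sum>k\<in>?S. frag_cmul (eps k L * cochain_sign (insert k L) I) (frag_of (I - insert k L, exponent (insert k L))))"
    by (simp add: x cochain_to_mon_def cochain_d_def frag_extend_sum frag_extend_cmul)
  also have "\<dots> = (\<Sum>k\<in>?S. frag_cmul (cochain_sign L I * eps k (I - L))
      (frag_of (I - L - {k}, exponent L + Poly_Mapping.single k 1)))"
  proof (intro sum.cong refl)
    fix k assume k: "k \<in> ?S"
    have "I - insert k L = I - L - {k}" by blast
    then show "frag_cmul (eps k L * cochain_sign (insert k L) I) (frag_of (I - insert k L, exponent (insert k L))) =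
        frag_cmul (cochain_sign L I * eps k (I - L)) (frag_of (I - L - {k}, exponent L + Poly_Mapping.single k 1))"
      using cochain_sign_insert[of I L k] exponent_insert[of L k] D k by simp
  qed
  also have "\<dots> = mon_d K (cochain_to_mon (frag_of x))"
    using D by (simp add: x cochain_to_mon_def mon_d_def frag_extend_cmul frag_cmul_sum keys_exponent)
  finally show ?case .
qed (simp_all add: cochain_to_mon_def cochain_d_def mon_d_def frag_extend_diff)

lemma cochain_to_mon_d':
  assumes "Poly_Mapping.keys c \<subseteq> cochain_basis m K"
  shows "cochain_to_mon (cochain_d' c) = mon_d' (cochain_to_mon c)"
  using assms
proof (induction c rule: frag_induction)
  case (one x)
  obtain L I where x: "x = (L, I)" by (cases x)
  then have b: "(L, I) \<in> cochain_basis m K" using one by simp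
  note D = cochain_basisD[OF b]
  have "finite (I - L)" using D by simp
  then have "cochain_to_mon (cochain_d' (frag_of x)) =
      (\<Sum>i\<in>I - L. frag_cmul ((- 1) ^ card L * eps i I * cochain_sign L (I - {i})) (frag_of (I - {i} - L, exponent L)))"
    by (simp add: x cochain_to_mon_def cochain_d'_def frag_extend_sum frag_extend_cmul frag_cmul_sum mult.assoc)
  also have "\<dots> = (\<Sum>i\<in>I - L. frag_cmul (cochain_sign L I * eps i (I - L)) (frag_of (I - L - {i}, exponent L)))"
  proof (intro sum.cong refl)
    fix i assume i: "i \<in> I - L"
    have "I - {i} - L = I - L - {i}" by blast
    then show "frag_cmul ((- 1) ^ card L * eps i I * cochain_sign L (I - {i})) (frag_of (I - {i} - L, exponent L)) =
        frag_cmul (cochain_sign L I * eps i (I - L)) (frag_of (I - L - {i}, exponent L))"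
      using cochain_sign_remove[OF _ _ i] D by simp
  qed
  also have "\<dots> = mon_d' (cochain_to_mon (frag_of x))"
    using D by (simp add: x cochain_to_mon_def mon_d'_def frag_extend_cmul frag_cmul_sum)
  finally show ?case .
qed (simp_all add: cochain_to_mon_def cochain_d'_def mon_d'_def frag_extend_diff)


section \<open>The face ring in terms of monomials\<close>

lemma keys_add_nat: "Poly_Mapping.keys (a + b :: 'a \<Rightarrow>\<^sub>0 nat) = Poly_Mapping.keys a \<union> Poly_Mapping.keys b"
  by (rule Set.set_eqI) (simp add: in_keys_iff lookup_add)

lemma var_power: "var i ^ n = Poly_Mapping.single (Poly_Mapping.single i n) 1"
proof (induction n)
  case (Suc n)
  have "Poly_Mapping.single i 1 + Poly_Mapping.single i n = Poly_Mapping.single i (Suc n)"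
    by (simp add: One_nat_def flip: single_add)
  then show ?case using Suc by (simp add: var_def mult_single)
qed simp

lemma prod_var_power:
  "finite S \<Longrightarrow> (\<Prod>i\<in>S. var i ^ n i) = Poly_Mapping.single (\<Sum>i\<in>S. Poly_Mapping.single i (n i)) 1"
  by (induction S rule: finite_induct) (simp_all add: var_power mult_single)

lemma prod_var: "finite S \<Longrightarrow> (\<Prod>i\<in>S. var i) = Poly_Mapping.single (exponent S) 1"
  using prod_var_power[of S "\<lambda>_. 1"] by (simp add: exponent_def)

lemma sum_single_lookup:
  assumes "Poly_Mapping.keys a \<subseteq> S" "finite S"
  shows "(\<Sum>i\<in>S. Poly_Mapping.single i (Poly_Mapping.lookup a i)) = a"
  by (rule poly_mapping_eqI)
    (use assms in \<open>auto simp: lookup_sum lookup_single when_def in_keys_iff subset_iff\<close>)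

lemma sum_monomials:
  "(\<Sum>a\<in>Poly_Mapping.keys p. Poly_Mapping.single a (Poly_Mapping.lookup p a)) = p"
  by (rule poly_mapping_eqI)
    (simp add: lookup_sum lookup_single when_def in_keys_iff sum.delta')

locale simplicial_complex =
  fixes m :: nat and K :: "nat set set"
  assumes simplicial_complex: "simplicial_complex_on m K"
begin

lemma K_subset: "K \<subseteq> Pow {1..m}"
  using simplicial_complex by (simp add: simplicial_complex_on_def)

lemma face_subset: "J \<in> K \<Longrightarrow> L \<subseteq> J \<Longrightarrow> L \<in> K"
  using simplicial_complex by (auto simp: simplicial_complex_on_def)

text \<open>The ideal is a monomial ideal. A monomial with support \<open>I \<notin> K\<close> is a multiple of the
  generator \<open>\<Prod>i\<in>I. v\<^sub>i\<close>; conversely, multiplication only enlarges supports and a superset of a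
  non-face is a non-face, so the span of these monomials is an ideal.\<close>

lemma stanley_reisner_ideal_eq:
  "stanley_reisner_ideal m K =
    {p \<in> carrier (poly_ring m). \<forall>a \<in> Poly_Mapping.keys p. Poly_Mapping.keys a \<notin> K}" (is "_ = ?N")
proof
  interpret cring "poly_ring m" by (rule poly_ring_cring)
  let ?gens = "{\<Prod>i\<in>I. var i | I. I \<subseteq> {1..m} \<and> I \<notin> K}"
  have gen: "?gens \<subseteq> carrier (poly_ring m)" by (auto intro!: poly_ring_prod_closed var_closed)
  have mult: "x * y \<in> ?N" if x: "x \<in> carrier (poly_ring m)" and y: "y \<in> ?N" for x y
  proof -
    have "Poly_Mapping.keys c \<notin> K" if c: "c \<in> Poly_Mapping.keys (x * y)" for c
    proof -
      obtain a b where ab: "c = a + b" "b \<in> Poly_Mapping.keys y" using keys_mult[of x y] c by auto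
      then have "Poly_Mapping.keys b \<notin> K" using y by blast
      then show ?thesis using face_subset[of "Poly_Mapping.keys c" "Poly_Mapping.keys b"] ab(1)
        by (auto simp: keys_add_nat)
    qed
    then show ?thesis using x y poly_ring_closed(5) by blast
  qed
  have "ideal ?N (poly_ring m)"
  proof (rule idealI)
    show "ring (poly_ring m)" by (rule ring_axioms)
    show "subgroup ?N (add_monoid (poly_ring m))"
    proof (rule add.subgroupI)
      show "?N \<noteq> {}" using poly_ring_closed(1) by fastforce
      show "\<ominus>\<^bsub>poly_ring m\<^esub> a \<in> ?N" if "a \<in> ?N" for a
        using that by (simp add: poly_ring_a_inv poly_ring_closed)
      show "a \<oplus>\<^bsub>poly_ring m\<^esub> b \<in> ?N" if "a \<in> ?N" "b \<in> ?N" for a b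
        using that poly_ring_closed(4) Poly_Mapping.keys_add[of a b] unfolding poly_ring_simps(5) by blast
    qed auto
    show "x \<otimes>\<^bsub>poly_ring m\<^esub> a \<in> ?N" "a \<otimes>\<^bsub>poly_ring m\<^esub> x \<in> ?N"
      if "a \<in> ?N" "x \<in> carrier (poly_ring m)" for a x
      using mult[OF that(2,1)] by (simp_all add: poly_ring_simps(2) mult.commute)
  qed
  moreover have "?gens \<subseteq> ?N"
  proof
    fix p assume p: "p \<in> ?gens"
    then obtain I where I: "p = (\<Prod>i\<in>I. var i)" "I \<subseteq> {1..m}" "I \<notin> K" by blast
    have "finite I" using I(2) by (rule finite_subset) simp
    then show "p \<in> ?N" using gen p I by (auto simp: prod_var keys_exponent)
  qed
  ultimately show "stanley_reisner_ideal m K \<subseteq> ?N"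
    unfolding stanley_reisner_ideal_def by (rule genideal_minimal)
  interpret I: ideal "stanley_reisner_ideal m K" "poly_ring m" by (rule sr_ideal)
  show "?N \<subseteq> stanley_reisner_ideal m K"
  proof
    fix p assume p: "p \<in> ?N"
    have mono: "Poly_Mapping.single a c \<in> stanley_reisner_ideal m K"
      if a: "Poly_Mapping.keys a \<subseteq> {1..m}" "Poly_Mapping.keys a \<notin> K" for a c
    proof -
      define b where "b = a - exponent (Poly_Mapping.keys a)"
      have ab: "a = b + exponent (Poly_Mapping.keys a)"
        by (rule poly_mapping_eqI) (auto simp: b_def lookup_add lookup_minus lookup_exponent in_keys_iff)
      have "Poly_Mapping.keys b \<subseteq> Poly_Mapping.keys a" by (auto simp: b_def in_keys_iff lookup_minus)
      then have "Poly_Mapping.single b c \<in> carrier (poly_ring m)"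
        using a by (auto simp: poly_ring_simps(1))
      moreover have "(\<Prod>i\<in>Poly_Mapping.keys a. var i) \<in> stanley_reisner_ideal m K"
        using genideal_self[OF gen] a unfolding stanley_reisner_ideal_def by blast
      ultimately have "Poly_Mapping.single b c * (\<Prod>i\<in>Poly_Mapping.keys a. var i) \<in> stanley_reisner_ideal m K"
        using I.I_l_closed by (simp add: poly_ring_simps(2))
      moreover have "Poly_Mapping.single b c * (\<Prod>i\<in>Poly_Mapping.keys a. var i) = Poly_Mapping.single a c"
        by (subst (2) ab) (simp add: prod_var mult_single)
      ultimately show ?thesis by simp
    qed
    have "(\<Sum>a\<in>S. Poly_Mapping.single a (Poly_Mapping.lookup p a)) \<in> stanley_reisner_ideal m K"
      if "finite S" "S \<subseteq> Poly_Mapping.keys p" for S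
      using that
    proof (induction S rule: finite_induct)
      case empty
      then show ?case using I.zero_closed by (simp add: poly_ring_simps(4))
    next
      case (insert a S)
      have "Poly_Mapping.single a (Poly_Mapping.lookup p a) \<in> stanley_reisner_ideal m K"
        using p insert.prems by (intro mono) (auto simp: poly_ring_simps(1))
      then show ?case using insert I.a_closed by (simp add: poly_ring_simps(5))
    qed
    from this[OF finite_keys order_refl] show "p \<in> stanley_reisner_ideal m K"
      by (simp add: sum_monomials)
  qed
qed

lemma face_class_eq_iff:
  assumes "p \<in> carrier (poly_ring m)" "q \<in> carrier (poly_ring m)"
  shows "face_class m K p = face_class m K q \<longleftrightarrow>
    (\<forall>a. Poly_Mapping.keys a \<in> K \<longrightarrow> Poly_Mapping.lookup p a = Poly_Mapping.lookup q a)"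
proof -
  interpret cring "poly_ring m" by (rule poly_ring_cring)
  have "p \<ominus>\<^bsub>poly_ring m\<^esub> q = p - q"
    using assms by (simp add: a_minus_def poly_ring_a_inv poly_ring_simps(5))
  moreover have "p - q \<in> carrier (poly_ring m)"
    using poly_ring_closed(4)[OF assms(1) poly_ring_closed(3)[OF assms(2)]] by simp
  ultimately show ?thesis
    using quotient_eq_iff_same_a_r_cos[OF sr_ideal[of m K] assms]
    unfolding face_class_def by (auto simp: stanley_reisner_ideal_eq in_keys_iff lookup_minus)
qed

text \<open>Representatives of an element of the Koszul algebra are unique in their coefficients at
  monomials supported on faces; this makes the Koszul algebra free on \<^const>\<open>monomials\<close>.\<close>

lemma kclass_eq_iff:
  assumes "F \<in> kfam m" "G \<in> kfam m"
  shows "kclass m K F = kclass m K G \<longleftrightarrow>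
    (\<forall>(J, a) \<in> monomials m K. Poly_Mapping.lookup (F J) a = Poly_Mapping.lookup (G J) a)"
proof -
  have "kclass m K F = kclass m K G \<longleftrightarrow> (\<forall>J\<in>Pow {1..m}. face_class m K (F J) = face_class m K (G J))"
  proof
    assume "kclass m K F = kclass m K G"
    then have "kclass m K F J = kclass m K G J" for J by simp
    then show "\<forall>J\<in>Pow {1..m}. face_class m K (F J) = face_class m K (G J)"
      unfolding kclass_def by (metis restrict_apply')
  next
    assume "\<forall>J\<in>Pow {1..m}. face_class m K (F J) = face_class m K (G J)"
    then show "kclass m K F = kclass m K G" unfolding kclass_def by (intro restrict_ext) blast
  qed
  also have "\<dots> \<longleftrightarrow> (\<forall>J\<in>Pow {1..m}. \<forall>a. Poly_Mapping.keys a \<in> K \<longrightarrow>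
      Poly_Mapping.lookup (F J) a = Poly_Mapping.lookup (G J) a)"
    using assms by (intro ball_cong refl face_class_eq_iff) (auto simp: kfam_def)
  finally show ?thesis by (auto simp: monomials_def)
qed

end


section \<open>The Koszul algebra as a free abelian group on monomials\<close>

text \<open>The coefficient of \<open>u\<^sub>J\<close> in a combination of monomials \<open>u\<^sub>J v\<^sup>a\<close>.\<close>

definition mon_coeffs :: "(monomial \<Rightarrow>\<^sub>0 int) \<Rightarrow> nat set \<Rightarrow> ipoly" where
  "mon_coeffs c J = Poly_Mapping.map_key (Pair J) c"

lemma lookup_mon_coeffs [simp]:
  "Poly_Mapping.lookup (mon_coeffs c J) a = Poly_Mapping.lookup c (J, a)"
  unfolding mon_coeffs_def by (subst map_key.rep_eq) (auto intro: injI)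

lemma mon_coeffs_simps:
  "mon_coeffs 0 J = 0"
  "mon_coeffs (b + c) J = mon_coeffs b J + mon_coeffs c J"
  "mon_coeffs (b - c) J = mon_coeffs b J - mon_coeffs c J"
  "mon_coeffs (- c) J = - mon_coeffs c J"
  "mon_coeffs (frag_of (J', a)) J = (if J = J' then Poly_Mapping.single a 1 else 0)"
  by (rule poly_mapping_eqI; simp add: lookup_add lookup_minus lookup_single when_def)+

text \<open>Both differentials send \<open>u\<^sub>k\<close> to a monomial \<open>v\<^bsup>t k\<^esup>\<close>, with \<open>v\<^bsup>t k\<^esup> = v\<^sub>k\<close> for \<open>d\<close> and
  \<open>v\<^bsup>t k\<^esup> = 1\<close> for \<open>d'\<close>, so one computation in the monomial basis serves for both.\<close>

lemma eder_mon_coeffs: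
  assumes c: "Poly_Mapping.keys c \<subseteq> {(J, a). J \<subseteq> {1..m}}" and J: "J \<subseteq> {1..m}" and a: "Poly_Mapping.keys a \<in> K"
  shows "Poly_Mapping.lookup (eder {1..m} (\<lambda>k. Poly_Mapping.single (t k) 1) (mon_coeffs c) J) a =
    Poly_Mapping.lookup (frag_extend (\<lambda>(J, a). \<Sum>k \<in> {k \<in> J. Poly_Mapping.keys (a + t k) \<in> K}.
      frag_cmul (eps k J) (frag_of (J - {k}, a + t k))) c) (J, a)"
  using c
proof (induction c rule: frag_induction)
  case zero
  have "eder {1..m} (\<lambda>k. Poly_Mapping.single (t k) 1) (mon_coeffs 0) = (\<lambda>_. 0)"
    by (simp add: eder_def fun_eq_iff mon_coeffs_simps)
  then show ?case by simp
next
  case (one x)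
  obtain J0 a0 where x: "x = (J0, a0)" by (cases x)
  then have J0: "J0 \<subseteq> {1..m}" "finite J0" using one finite_subset[of J0 "{1..m}"] by auto
  let ?P = "\<lambda>k. k \<in> J0 \<and> J = J0 - {k} \<and> a = a0 + t k"
  have "Poly_Mapping.lookup (eder {1..m} (\<lambda>k. Poly_Mapping.single (t k) 1) (mon_coeffs (frag_of x)) J) a =
    (\<Sum>k\<in>{1..m} - J. if ?P k then eps k J0 else 0)"
    unfolding eder_def lookup_sum
  proof (rule sum.cong[OF refl])
    fix k assume k: "k \<in> {1..m} - J"
    show "Poly_Mapping.lookup (of_int (eps k J) *
          (Poly_Mapping.single (t k) 1 * mon_coeffs (frag_of x) (insert k J))) a =
        (if ?P k then eps k J0 else 0)"
    proof (cases "insert k J = J0")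
      case True
      then have "J = J0 - {k}" "k \<in> J0" using k by auto
      then have "?P k \<longleftrightarrow> a0 + t k = a" by auto
      moreover have "eps k J = eps k J0" using True by (metis eps_insert)
      moreover have "of_int e * Poly_Mapping.single b 1 = (Poly_Mapping.single b e :: ipoly)" for e b
        by (simp add: mult_single flip: single_of_int)
      ultimately show ?thesis
        using True by (simp add: x mon_coeffs_simps mult_single lookup_single when_def add.commute)
    next
      case False
      then have P: "?P k = False" by (auto simp: insert_absorb)
      show ?thesis using False unfolding P by (simp add: x mon_coeffs_simps)
    qed
  qed
  also have "\<dots> = (\<Sum>k\<in>{k \<in> J0. Poly_Mapping.keys (a0 + t k) \<in> K}. if ?P k then eps k J0 else 0)"
    by (rule sum.mono_neutral_cong) (use J0 a in auto)
  also have "\<dots> = Poly_Mapping.lookup (\<Sum>k \<in> {k \<in> J0. Poly_Mapping.keys (a0 + t k) \<in> K}.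
      frag_cmul (eps k J0) (frag_of (J0 - {k}, a0 + t k))) (J, a)"
    unfolding lookup_sum by (rule sum.cong[OF refl]) (auto simp: lookup_single when_def)
  finally show ?case by (simp add: x)
next
  case (diff b c)
  have "eder {1..m} (\<lambda>k. Poly_Mapping.single (t k) 1) (mon_coeffs (b - c)) J =
      eder {1..m} (\<lambda>k. Poly_Mapping.single (t k) 1) (mon_coeffs b) J -
      eder {1..m} (\<lambda>k. Poly_Mapping.single (t k) 1) (mon_coeffs c) J"
    by (simp add: eder_def mon_coeffs_simps right_diff_distrib sum_subtractf)
  then show ?case using diff by (simp add: lookup_minus frag_extend_diff)
qed

text \<open>In the composite, removing first \<open>u\<^sub>l\<close> and then \<open>u\<^sub>k\<close> cancels against the opposite order
  in the other composite, by \<open>eps_swap\<close>.\<close>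

lemma eder_anticommute:
  fixes F :: "nat set \<Rightarrow> 'r::comm_ring_1"
  assumes V: "finite V" "J \<subseteq> V"
  shows "eder V W (eder V W' F) J + eder V W' (eder V W F) J = 0"
proof -
  define T where "T k l = of_int (eps k J * eps l (insert k J)) * (W k * W' l * F (insert l (insert k J)))" for k l
  have fin: "finite J" using V finite_subset by auto
  let ?D = "SIGMA k:V - J. V - insert k J"
  have S: "eder V W (eder V W' F) J = (\<Sum>(k, l)\<in>?D. of_int (eps k J * eps l (insert k J)) * (W k * W' l * F (insert l (insert k J))))"
    for W W' :: "nat \<Rightarrow> 'r"
    unfolding eder_def sum_distrib_left using V
    by (subst sum.Sigma) (auto intro!: sum.cong simp: mult_ac)
  have "eder V W' (eder V W F) J =
      (\<Sum>(k, l)\<in>?D. of_int (eps l J * eps k (insert l J)) * (W' l * W k * F (insert k (insert l J))))"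
    unfolding S by (rule sum.reindex_bij_witness[of _ prod.swap prod.swap]) auto
  also have "\<dots> = (\<Sum>(k, l)\<in>?D. - T k l)"
  proof (rule sum.cong[OF refl])
    fix x assume "x \<in> ?D"
    then obtain k l where kl: "x = (k, l)" "k \<notin> J" "l \<notin> J" "l \<noteq> k" by auto
    have e: "eps l J * eps k (insert l J) = - (eps k J * eps l (insert k J))"
      using kl by (intro eps_swap fin)
    have "insert k (insert l J) = insert l (insert k J)" by (rule insert_commute)
    then show "(case x of (k, l) \<Rightarrow> of_int (eps l J * eps k (insert l J)) * (W' l * W k * F (insert k (insert l J)))) =
        (case x of (k, l) \<Rightarrow> - T k l)"
      unfolding kl(1) prod.case e T_def by (simp add: mult_ac)
  qed
  finally show ?thesis unfolding S by (simp add: T_def sum_negf case_prod_unfold)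
qed

text \<open>The anticommutator of a derivation with itself is twice its square, and the
  polynomial ring has no \<open>2\<close>-torsion.\<close>

lemma eder_eder_same:
  fixes F :: "nat set \<Rightarrow> ipoly"
  assumes "finite V" "J \<subseteq> V"
  shows "eder V W (eder V W F) J = 0"
proof (rule poly_mapping_eqI)
  fix a
  have "Poly_Mapping.lookup (eder V W (eder V W F) J + eder V W (eder V W F) J) a = 0"
    unfolding eder_anticommute[OF assms] by simp
  then show "Poly_Mapping.lookup (eder V W (eder V W F) J) a = Poly_Mapping.lookup 0 a"
    unfolding lookup_add by simp
qed

text \<open>A derivation is determined by its values on generators, so the Koszul differentials are
  given by the explicit coefficient formula.\<close>

lemma koszul_d_kder: "koszul_d m K = kder m K var"
  by (rule koszul_derivation_unique[OF koszul_d_derivation kder_derivation]) (rule var_closed)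

lemma koszul_d'_kder: "koszul_d' m K = kder m K (\<lambda>_. 1)"
  using koszul_d'_derivation unfolding koszul_one
  by (rule koszul_derivation_unique[OF _ kder_derivation]) (rule poly_ring_closed)

text \<open>This is the isomorphism from the free abelian group on \<^const>\<open>monomials\<close> to the Koszul
  algebra; injectivity is \<open>mon_to_koszul_eq_iff\<close>, surjectivity is \<open>mon_to_koszul_surj\<close>, and the
  differentials correspond by \<open>mon_to_koszul_d\<close> and \<open>mon_to_koszul_d'\<close>.\<close>

definition mon_to_koszul :: "nat \<Rightarrow> nat set set \<Rightarrow> (monomial \<Rightarrow>\<^sub>0 int) \<Rightarrow> nat set \<Rightarrow> ipoly set" where
  "mon_to_koszul m K c = kclass m K (mon_coeffs c)"

lemma mon_to_koszul_monomial:
  "mon_to_koszul m K (frag_of (J, a)) = koszul_elem m K J (Poly_Mapping.single a 1)"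
  unfolding mon_to_koszul_def koszul_elem_kclass by (rule kclass_cong) (simp add: mon_coeffs_simps)

lemma carrier_free_generate:
  assumes "S \<subseteq> T"
  shows "generate (free_Abelian_group T) (frag_of ` S) = carrier (free_Abelian_group S)"
proof
  interpret T: group "free_Abelian_group T" by simp
  have "subgroup (carrier (free_Abelian_group S)) (free_Abelian_group T)"
  proof (rule T.subgroupI)
    show "carrier (free_Abelian_group S) \<noteq> {}" by (metis group.is_monoid group_free_Abelian_group monoid.carrier_not_empty)
    show "a \<otimes>\<^bsub>free_Abelian_group T\<^esub> b \<in> carrier (free_Abelian_group S)"
      if "a \<in> carrier (free_Abelian_group S)" "b \<in> carrier (free_Abelian_group S)" for a b
      using that Poly_Mapping.keys_add[of a b] by auto
  qed (use assms in auto)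
  then show "generate (free_Abelian_group T) (frag_of ` S) \<subseteq> carrier (free_Abelian_group S)"
    by (intro T.generate_subgroup_incl) auto
  have sub: "subgroup (generate (free_Abelian_group T) (frag_of ` S)) (free_Abelian_group T)"
    using assms by (intro T.generate_is_subgroup) auto
  show "carrier (free_Abelian_group S) \<subseteq> generate (free_Abelian_group T) (frag_of ` S)"
  proof
    fix c assume "c \<in> carrier (free_Abelian_group S)"
    then have "Poly_Mapping.keys c \<subseteq> S" by simp
    then show "c \<in> generate (free_Abelian_group T) (frag_of ` S)"
    proof (rule free_Abelian_group_induct)
      show "0 \<in> generate (free_Abelian_group T) (frag_of ` S)" using subgroup.one_closed[OF sub] by simp
    next
      fix x y assume xy: "Poly_Mapping.keys y \<subseteq> S" "x \<in> generate (free_Abelian_group T) (frag_of ` S)"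
        "y \<in> generate (free_Abelian_group T) (frag_of ` S)"
      have "inv\<^bsub>free_Abelian_group T\<^esub> y = - y" using xy(1) assms by (intro inv_free_Abelian_group) blast
      then show "x - y \<in> generate (free_Abelian_group T) (frag_of ` S)"
        using subgroup.m_closed[OF sub xy(2) subgroup.m_inv_closed[OF sub xy(3)]] by simp
    qed (intro generate.incl imageI)
  qed
qed

context simplicial_complex
begin

lemma mon_coeffs_kfam:
  assumes "Poly_Mapping.keys c \<subseteq> monomials m K"
  shows "mon_coeffs c \<in> kfam m"
  unfolding kfam_def poly_ring_simps(1)
proof (intro CollectI ballI)
  fix J a assume "a \<in> Poly_Mapping.keys (mon_coeffs c J)"
  then have "(J, a) \<in> Poly_Mapping.keys c" by (simp add: in_keys_iff)
  then show "Poly_Mapping.keys a \<subseteq> {1..m}" using assms K_subset by (auto simp: monomials_def)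
qed

lemma mon_to_koszul_eq_iff:
  assumes "Poly_Mapping.keys b \<subseteq> monomials m K" "Poly_Mapping.keys c \<subseteq> monomials m K"
  shows "mon_to_koszul m K b = mon_to_koszul m K c \<longleftrightarrow> b = c"
proof
  assume "mon_to_koszul m K b = mon_to_koszul m K c"
  then have *: "Poly_Mapping.lookup b x = Poly_Mapping.lookup c x" if "x \<in> monomials m K" for x
    using kclass_eq_iff[OF mon_coeffs_kfam mon_coeffs_kfam, OF assms] that
    by (auto simp: mon_to_koszul_def)
  show "b = c"
  proof (rule poly_mapping_eqI)
    fix x show "Poly_Mapping.lookup b x = Poly_Mapping.lookup c x"
    proof (cases "x \<in> monomials m K")
      case False
      then have "x \<notin> Poly_Mapping.keys b" "x \<notin> Poly_Mapping.keys c" using assms by blast+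
      then show ?thesis by (simp add: in_keys_iff)
    qed (rule *)
  qed
qed simp

lemma mon_to_koszul_hom:
  "mon_to_koszul m K \<in> hom (free_Abelian_group (monomials m K)) (add_monoid (koszul_algebra m K))"
proof (rule homI)
  show "mon_to_koszul m K c \<in> carrier (add_monoid (koszul_algebra m K))"
    if "c \<in> carrier (free_Abelian_group (monomials m K))" for c
    using that by (simp add: mon_to_koszul_def koszul_carrier mon_coeffs_kfam)
  show "mon_to_koszul m K (b \<otimes>\<^bsub>free_Abelian_group (monomials m K)\<^esub> c) =
      mon_to_koszul m K b \<otimes>\<^bsub>add_monoid (koszul_algebra m K)\<^esub> mon_to_koszul m K c"
    if "b \<in> carrier (free_Abelian_group (monomials m K))" "c \<in> carrier (free_Abelian_group (monomials m K))" for b c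
    using that by (simp add: mon_to_koszul_def koszul_add mon_coeffs_kfam)
      (rule kclass_cong, simp add: mon_coeffs_simps)
qed

lemma mon_to_koszul_surj:
  "mon_to_koszul m K ` carrier (free_Abelian_group (monomials m K)) = carrier (koszul_algebra m K)"
proof
  show "mon_to_koszul m K ` carrier (free_Abelian_group (monomials m K)) \<subseteq> carrier (koszul_algebra m K)"
    using mon_to_koszul_hom by (auto simp: hom_def)
  show "carrier (koszul_algebra m K) \<subseteq> mon_to_koszul m K ` carrier (free_Abelian_group (monomials m K))"
  proof
    fix x assume "x \<in> carrier (koszul_algebra m K)"
    then obtain F where F: "F \<in> kfam m" "x = kclass m K F" by (auto simp: koszul_carrier)
    \<comment> \<open>The coefficients at monomials supported on non-faces are dropped; they represent zero.\<close>
    define f where "f = (\<lambda>(J, a). if (J, a) \<in> monomials m K then Poly_Mapping.lookup (F J) a else 0)"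
    define c where "c = Poly_Mapping.Abs_poly_mapping f"
    have "{x. f x \<noteq> 0} \<subseteq> (SIGMA J:Pow {1..m}. Poly_Mapping.keys (F J))"
      by (clarsimp simp: f_def monomials_def in_keys_iff split: if_splits)
    then have "finite {x. f x \<noteq> 0}" by (rule finite_subset) simp
    then have c: "Poly_Mapping.lookup c = f" unfolding c_def by (intro lookup_Abs_poly_mapping)
    then have keys: "Poly_Mapping.keys c \<subseteq> monomials m K"
      by (auto simp: in_keys_iff f_def split: if_splits)
    have "mon_to_koszul m K c = x" unfolding mon_to_koszul_def F(2)
      using kclass_eq_iff[OF mon_coeffs_kfam[OF keys] F(1)] by (auto simp: c f_def)
    then show "x \<in> mon_to_koszul m K ` carrier (free_Abelian_group (monomials m K))"
      using keys by (intro image_eqI[of _ _ c]) auto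
  qed
qed

lemma mon_to_koszul_d:
  assumes c: "Poly_Mapping.keys c \<subseteq> monomials m K"
  shows "koszul_d m K (mon_to_koszul m K c) = mon_to_koszul m K (mon_d K c)"
proof -
  have keys: "Poly_Mapping.keys c \<subseteq> {(J, a). J \<subseteq> {1..m}}" using c by (auto simp: monomials_def)
  have v: "var = (\<lambda>k. Poly_Mapping.single (Poly_Mapping.single k 1) 1)" by (simp add: var_def fun_eq_iff)
  have "koszul_d m K (mon_to_koszul m K c) = kclass m K (eder {1..m} var (mon_coeffs c))"
    unfolding mon_to_koszul_def koszul_d_kder by (rule kder_kclass[OF mon_coeffs_kfam[OF c] var_closed])
  also have "\<dots> = kclass m K (mon_coeffs (mon_d K c))"
    using eder_mon_coeffs[OF keys, of _ _ K "\<lambda>k. Poly_Mapping.single k 1"]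
    by (subst kclass_eq_iff[OF kfam_eder[OF mon_coeffs_kfam[OF c] var_closed] mon_coeffs_kfam[OF keys_mon_d[OF c]]])
      (auto simp: monomials_def v mon_d_def keys_plus_single)
  finally show ?thesis by (simp add: mon_to_koszul_def)
qed

lemma mon_to_koszul_d':
  assumes c: "Poly_Mapping.keys c \<subseteq> monomials m K"
  shows "koszul_d' m K (mon_to_koszul m K c) = mon_to_koszul m K (mon_d' c)"
proof -
  have keys: "Poly_Mapping.keys c \<subseteq> {(J, a). J \<subseteq> {1..m}}" using c by (auto simp: monomials_def)
  have one: "1 \<in> carrier (poly_ring m)" by (rule poly_ring_closed)
  have "koszul_d' m K (mon_to_koszul m K c) = kclass m K (eder {1..m} (\<lambda>_. 1) (mon_coeffs c))"
    unfolding mon_to_koszul_def koszul_d'_kder by (rule kder_kclass[OF mon_coeffs_kfam[OF c] one])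
  also have "\<dots> = kclass m K (mon_coeffs (mon_d' c))"
  proof (subst kclass_eq_iff[OF kfam_eder[OF mon_coeffs_kfam[OF c] one] mon_coeffs_kfam[OF keys_mon_d'[OF c]]], clarify)
    fix J a assume "(J, a) \<in> monomials m K"
    then have Ja: "J \<subseteq> {1..m}" "Poly_Mapping.keys a \<in> K" by (simp_all add: monomials_def)
    have "mon_d' c = frag_extend (\<lambda>(J, a). \<Sum>k \<in> {k \<in> J. Poly_Mapping.keys (a + 0) \<in> K}.
      frag_cmul (eps k J) (frag_of (J - {k}, a + 0))) c"
      unfolding mon_d'_def by (rule frag_extend_eq) (use c in \<open>auto simp: monomials_def intro!: sum.cong\<close>)
    then show "Poly_Mapping.lookup (eder {1..m} (\<lambda>_. 1) (mon_coeffs c) J) a =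
        Poly_Mapping.lookup (mon_coeffs (mon_d' c) J) a"
      using eder_mon_coeffs[OF keys Ja, of "\<lambda>_. 0"] by simp
  qed
  finally show ?thesis by (simp add: mon_to_koszul_def)
qed

text \<open>Subgroups of the Koszul algebra generated by monomials become spans of subsets of the
  basis, which turns \<^const>\<open>R_group\<close> and \<^const>\<open>koszul_piece\<close> into statements about
  basis elements.\<close>

lemma mon_to_koszul_span:
  assumes "S \<subseteq> monomials m K"
  shows "mon_to_koszul m K ` carrier (free_Abelian_group S) =
    generate (add_monoid (koszul_algebra m K)) ((\<lambda>(J, a). koszul_elem m K J (Poly_Mapping.single a 1)) ` S)"
proof -
  interpret E: abelian_group "koszul_algebra m K" by (rule koszul_abelian_group)
  interpret group_hom "free_Abelian_group (monomials m K)" "add_monoid (koszul_algebra m K)" "mon_to_koszul m K"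
    by (intro group_hom.intro group_hom_axioms.intro mon_to_koszul_hom group_free_Abelian_group E.a_group)
  have "frag_of ` S \<subseteq> carrier (free_Abelian_group (monomials m K))" using assms by auto
  from generate_img[OF this]
  have "generate (add_monoid (koszul_algebra m K)) (mon_to_koszul m K ` (frag_of ` S)) =
      mon_to_koszul m K ` carrier (free_Abelian_group S)"
    unfolding carrier_free_generate[OF assms] .
  moreover have "mon_to_koszul m K ` (frag_of ` S) = (\<lambda>(J, a). koszul_elem m K J (Poly_Mapping.single a 1)) ` S"
    unfolding image_image by (rule image_cong) (auto simp: mon_to_koszul_monomial)
  ultimately show ?thesis by simp
qed

lemma carrier_R_group:
  "carrier (R_group m K) = mon_to_koszul m K ` carrier (free_Abelian_group (squarefree_monomials m K))"
proof -
  let ?gens = "{koszul_elem m K J (\<Prod>i\<in>I. var i) | J I. J \<subseteq> {1..m} \<and> I \<in> K \<and> J \<inter> I = {}}"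
  have "?gens = (\<lambda>(J, a). koszul_elem m K J (Poly_Mapping.single a 1)) ` squarefree_monomials m K"
  proof (intro equalityI subsetI)
    fix x assume "x \<in> ?gens"
    then obtain J I where x: "x = koszul_elem m K J (\<Prod>i\<in>I. var i)" "J \<subseteq> {1..m}" "I \<in> K" "J \<inter> I = {}" by blast
    have "I \<subseteq> {1..m}" using x(3) K_subset by blast
    then have "finite I" by (rule finite_subset) simp
    then show "x \<in> (\<lambda>(J, a). koszul_elem m K J (Poly_Mapping.single a 1)) ` squarefree_monomials m K"
      using x by (intro image_eqI[of _ _ "(J, exponent I)"]) (simp_all add: prod_var squarefree_monomials_iff keys_exponent)
  next
    fix x assume "x \<in> (\<lambda>(J, a). koszul_elem m K J (Poly_Mapping.single a 1)) ` squarefree_monomials m K"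
    then obtain J a where x: "x = koszul_elem m K J (Poly_Mapping.single a 1)" "(J, a) \<in> squarefree_monomials m K" by auto
    have a: "J \<subseteq> {1..m}" "Poly_Mapping.keys a \<in> K" "J \<inter> Poly_Mapping.keys a = {}"
      "a = exponent (Poly_Mapping.keys a)"
      using x(2) by (simp_all only: squarefree_monomials_iff)
    have "x = koszul_elem m K J (\<Prod>i\<in>Poly_Mapping.keys a. var i)"
      unfolding x(1) prod_var[OF finite_keys] a(4)[symmetric] ..
    then show "x \<in> ?gens" using a(1-3) by blast
  qed
  moreover have "?gens \<subseteq> carrier (koszul_algebra m K)"
    using K_subset by (auto intro!: koszul_elem_carrier poly_ring_prod_closed var_closed)
  ultimately show ?thesis
    unfolding R_group_def
    by (subst mon_to_koszul_span) (auto simp: squarefree_monomials_def carrier_subgroup_generated Int_absorb1)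
qed

text \<open>The generators of the bidegree component that are not basis monomials have a
  support outside \<open>K\<close> and are zero.\<close>

lemma koszul_piece_eq:
  "koszul_piece m K p q = mon_to_koszul m K ` carrier (free_Abelian_group (monomial_piece m K p q))"
proof -
  interpret E: abelian_group "koszul_algebra m K" by (rule koszul_abelian_group)
  let ?gens = "{koszul_elem m K J (\<Prod>i=1..m. var i ^ a i) | J a.
        J \<subseteq> {1..m} \<and> p = - int (card J) \<and> q = 2 * int (card J) + 2 * int (\<Sum>i=1..m. a i)}"
  let ?T = "(\<lambda>(J, a). koszul_elem m K J (Poly_Mapping.single a 1)) ` monomial_piece m K p q"
  have piece: "monomial_piece m K p q \<subseteq> monomials m K" by (auto simp: monomial_piece_def)
  have T: "?T \<subseteq> ?gens"
  proof
    fix x assume "x \<in> ?T"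
    then obtain J a where x: "x = koszul_elem m K J (Poly_Mapping.single a 1)" "(J, a) \<in> monomial_piece m K p q" by auto
    then have "Poly_Mapping.keys a \<subseteq> {1..m}" using K_subset by (auto simp: monomial_piece_def monomials_def)
    then have "x = koszul_elem m K J (\<Prod>i=1..m. var i ^ Poly_Mapping.lookup a i)"
      by (simp add: x(1) prod_var_power sum_single_lookup)
    then show "x \<in> ?gens"
      using x(2) by (intro CollectI exI[of _ J] exI[of _ "Poly_Mapping.lookup a"])
        (simp add: monomial_piece_def monomials_def)
  qed
  have gens: "?gens \<subseteq> carrier (koszul_algebra m K)"
    by (auto intro!: koszul_elem_carrier poly_ring_prod_closed poly_ring_power_closed var_closed)
  have sub: "subgroup (generate (add_monoid (koszul_algebra m K)) ?T) (add_monoid (koszul_algebra m K))"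
    by (rule E.add.generate_is_subgroup[OF order_trans[OF T gens]])
  have "?gens \<subseteq> generate (add_monoid (koszul_algebra m K)) ?T"
  proof
    fix x assume "x \<in> ?gens"
    then obtain J n where x: "x = koszul_elem m K J (\<Prod>i=1..m. var i ^ n i)" "J \<subseteq> {1..m}" "p = - int (card J)"
      "q = 2 * int (card J) + 2 * int (\<Sum>i=1..m. n i)" by blast
    define b where "b = (\<Sum>i=1..m. Poly_Mapping.single i (n i))"
    have n: "Poly_Mapping.lookup b i = (if i \<in> {1..m} then n i else 0)" for i
      by (simp add: b_def lookup_sum lookup_single when_def)
    have xb: "x = koszul_elem m K J (Poly_Mapping.single b 1)" by (simp add: x(1) prod_var_power b_def)
    have bc: "Poly_Mapping.single b 1 \<in> carrier (poly_ring m)"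
      by (auto simp: poly_ring_simps(1) in_keys_iff n split: if_splits)
    show "x \<in> generate (add_monoid (koszul_algebra m K)) ?T"
    proof (cases "Poly_Mapping.keys b \<in> K")
      case True
      then have "(J, b) \<in> monomial_piece m K p q" using x by (simp add: monomial_piece_def monomials_def n)
      then show ?thesis unfolding xb by (intro generate.incl) auto
    next
      case False
      then have "x = \<zero>\<^bsub>koszul_algebra m K\<^esub>"
        unfolding xb koszul_elem_kclass koszul_zero
        by (subst kclass_eq_iff[OF kfam_intros(2)[OF bc] kfam_intros(1)])
          (auto simp: monomials_def lookup_single when_def)
      then show ?thesis using subgroup.one_closed[OF sub] by simp
    qed
  qed
  then have "generate (add_monoid (koszul_algebra m K)) ?gens = generate (add_monoid (koszul_algebra m K)) ?T"
    by (intro equalityI E.add.generate_subgroup_incl[OF _ sub] E.add.mono_generate[OF T])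
  then show ?thesis unfolding koszul_piece_def mon_to_koszul_span[OF piece] .
qed

end


section \<open>The comparison map\<close>

text \<open>The relations between the differentials of the cochain bicomplex are inherited from
  the Koszul algebra, where they follow from the coefficient formula.\<close>

lemma anticommuting_differentials_reflect:
  assumes B: "anticommuting_differentials B \<epsilon> \<epsilon>'" and A: "comm_group (total A)"
    and \<psi>: "\<psi> \<in> hom (total A) (total B)" "inj_on \<psi> (carrier (total A))"
    and d: "\<delta> \<in> hom (total A) (total A)" "\<And>x. x \<in> carrier (total A) \<Longrightarrow> \<psi> (\<delta> x) = \<epsilon> (\<psi> x)"
    and d': "\<delta>' \<in> hom (total A) (total A)" "\<And>x. x \<in> carrier (total A) \<Longrightarrow> \<psi> (\<delta>' x) = \<epsilon>' (\<psi> x)"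
  shows "anticommuting_differentials A \<delta> \<delta>'"
proof -
  interpret B: anticommuting_differentials B \<epsilon> \<epsilon>' by (rule B)
  interpret A: comm_group "total A" by (rule A)
  interpret \<psi>: group_hom "total A" "total B" \<psi> by unfold_locales (rule \<psi>(1))
  have closed: "\<delta> x \<in> carrier (total A)" "\<delta>' x \<in> carrier (total A)" if "x \<in> carrier (total A)" for x
    using d(1) d'(1) that by (auto simp: hom_def)
  have one: "x = \<one>\<^bsub>total A\<^esub>" if "x \<in> carrier (total A)" "\<psi> x = \<one>\<^bsub>total B\<^esub>" for x
    using inj_onD[OF \<psi>(2), of x "\<one>\<^bsub>total A\<^esub>"] that by simp
  show ?thesis
    by (intro anticommuting_differentials.intro differential_group.intro anticommuting_differentials_axioms.intro
        A d(1) d'(1) one)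
      (simp_all add: closed d(2) d'(2) B.square B.square' B.anticommute)
qed

lemma koszul_anticommuting:
  "anticommuting_differentials (koszul_bicomplex m K) (diff (koszul_bicomplex m K)) (diff' (koszul_bicomplex m K))"
proof -
  interpret E: abelian_group "koszul_algebra m K" by (rule koszul_abelian_group)
  have one: "1 \<in> carrier (poly_ring m)" by (rule poly_ring_closed)
  have d: "koszul_d m K (kclass m K F) = kclass m K (eder {1..m} var F)" "eder {1..m} var F \<in> kfam m"
    and d': "koszul_d' m K (kclass m K F) = kclass m K (eder {1..m} (\<lambda>_. 1) F)" "eder {1..m} (\<lambda>_. 1) F \<in> kfam m"
    if "F \<in> kfam m" for F
    unfolding koszul_d_kder koszul_d'_kder
    by (rule kder_kclass[OF that var_closed] kfam_eder[OF that var_closed]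
        kder_kclass[OF that one] kfam_eder[OF that one], assumption?)+
  have rep: "\<exists>F\<in>kfam m. x = kclass m K F" if "x \<in> carrier (koszul_algebra m K)" for x
    using that by (auto simp: koszul_carrier)
  have hom: "koszul_d m K \<in> hom (add_monoid (koszul_algebra m K)) (add_monoid (koszul_algebra m K))"
    "koszul_d' m K \<in> hom (add_monoid (koszul_algebra m K)) (add_monoid (koszul_algebra m K))"
    using koszul_d_derivation[of m K] koszul_d'_derivation[of m K]
    unfolding is_koszul_derivation_def Let_def by simp_all
  have same: "kclass m K (eder {1..m} W (eder {1..m} W F)) = \<zero>\<^bsub>koszul_algebra m K\<^esub>" for W F
    unfolding koszul_zero by (rule kclass_cong) (simp add: eder_eder_same)
  have [simp]: "diff (koszul_bicomplex m K) = koszul_d m K" "diff' (koszul_bicomplex m K) = koszul_d' m K"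
    "total (koszul_bicomplex m K) = add_monoid (koszul_algebra m K)"
    by (simp_all add: koszul_bicomplex_def)
  show ?thesis
  proof (intro anticommuting_differentials.intro differential_group.intro anticommuting_differentials_axioms.intro)
    show "comm_group (total (koszul_bicomplex m K))"
      using E.a_comm_group by simp
    show "diff (koszul_bicomplex m K) \<in> hom (total (koszul_bicomplex m K)) (total (koszul_bicomplex m K))"
      "diff' (koszul_bicomplex m K) \<in> hom (total (koszul_bicomplex m K)) (total (koszul_bicomplex m K))"
      using hom by simp_all
    fix x assume "x \<in> carrier (total (koszul_bicomplex m K))"
    then obtain F where F: "F \<in> kfam m" "x = kclass m K F" using rep by auto
    show "diff (koszul_bicomplex m K) (diff (koszul_bicomplex m K) x) = \<one>\<^bsub>total (koszul_bicomplex m K)\<^esub>"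
      "diff' (koszul_bicomplex m K) (diff' (koszul_bicomplex m K) x) = \<one>\<^bsub>total (koszul_bicomplex m K)\<^esub>"
      by (simp_all add: F d d' same)
    show "diff (koszul_bicomplex m K) (diff' (koszul_bicomplex m K) x) \<otimes>\<^bsub>total (koszul_bicomplex m K)\<^esub>
        diff' (koszul_bicomplex m K) (diff (koszul_bicomplex m K) x) = \<one>\<^bsub>total (koszul_bicomplex m K)\<^esub>"
      using F by (simp add: d d' koszul_add koszul_zero) (rule kclass_cong, simp add: eder_anticommute)
  qed
qed

lemma keys_cochain_d:
  assumes "Poly_Mapping.keys c \<subseteq> cochain_basis m K"
  shows "Poly_Mapping.keys (cochain_d K c) \<subseteq> cochain_basis m K"
  unfolding cochain_d_def using assms
  by (rule keys_frag_extend_subset)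
    (auto intro!: keys_sum_subset simp: cochain_basis_def full_subcomplex_def)

context simplicial_complex
begin

lemma keys_cochain_d':
  assumes "Poly_Mapping.keys c \<subseteq> cochain_basis m K"
  shows "Poly_Mapping.keys (cochain_d' c) \<subseteq> cochain_basis m K"
  unfolding cochain_d'_def using assms
  by (rule keys_frag_extend_subset)
    (auto intro!: order_trans[OF keys_cmul] keys_sum_subset simp: cochain_basis_def full_subcomplex_def)

lemma cochain_carrier: "x \<in> carrier (total (cochain_bicomplex m K)) \<longleftrightarrow> Poly_Mapping.keys x \<subseteq> cochain_basis m K"
  by (simp add: cochain_bicomplex_def)

lemma keys_cochain_to_mon:
  assumes "Poly_Mapping.keys c \<subseteq> cochain_basis m K"
  shows "Poly_Mapping.keys (cochain_to_mon c) \<subseteq> squarefree_monomials m K"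
    and "Poly_Mapping.keys (cochain_to_mon c) \<subseteq> monomials m K"
proof -
  have "cochain_to_mon c \<in> carrier (free_Abelian_group (squarefree_monomials m K))"
    unfolding cochain_to_mon_carrier[OF K_subset, symmetric] using assms by (simp add: cochain_carrier)
  then show "Poly_Mapping.keys (cochain_to_mon c) \<subseteq> squarefree_monomials m K" by simp
  then show "Poly_Mapping.keys (cochain_to_mon c) \<subseteq> monomials m K"
    by (auto simp: squarefree_monomials_def)
qed

text \<open>The comparison map \<open>\<alpha>\<^bsub>L,I\<^esub> \<mapsto> \<plusminus> u\<^bsub>I - L\<^esub> v\<^sub>L\<close>.\<close>

definition cochain_to_koszul :: "((nat set \<times> nat set) \<Rightarrow>\<^sub>0 int) \<Rightarrow> nat set \<Rightarrow> ipoly set" where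
  "cochain_to_koszul c = mon_to_koszul m K (cochain_to_mon c)"

lemma cochain_to_koszul_hom:
  "cochain_to_koszul \<in> hom (total (cochain_bicomplex m K)) (total (koszul_bicomplex m K))"
proof (rule homI)
  show "cochain_to_koszul c \<in> carrier (total (koszul_bicomplex m K))"
    if "c \<in> carrier (total (cochain_bicomplex m K))" for c
    using that keys_cochain_to_mon(2)[of c] mon_to_koszul_hom
    by (auto simp: cochain_carrier cochain_to_koszul_def koszul_bicomplex_def hom_def)
  show "cochain_to_koszul (b \<otimes>\<^bsub>total (cochain_bicomplex m K)\<^esub> c) =
      cochain_to_koszul b \<otimes>\<^bsub>total (koszul_bicomplex m K)\<^esub> cochain_to_koszul c"
    if "b \<in> carrier (total (cochain_bicomplex m K))" "c \<in> carrier (total (cochain_bicomplex m K))" for b c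
  proof -
    have "b \<otimes>\<^bsub>total (cochain_bicomplex m K)\<^esub> c = b + c" by (simp add: cochain_bicomplex_def)
    moreover have "cochain_to_mon (b + c) = cochain_to_mon b + cochain_to_mon c"
      by (simp add: cochain_to_mon_def frag_extend_add)
    ultimately show ?thesis
      using hom_mult[OF mon_to_koszul_hom, of "cochain_to_mon b" "cochain_to_mon c"]
        keys_cochain_to_mon(2)[of b] keys_cochain_to_mon(2)[of c] that
      by (simp add: cochain_to_koszul_def koszul_bicomplex_def cochain_carrier)
  qed
qed

lemma cochain_to_koszul_inj: "inj_on cochain_to_koszul (carrier (total (cochain_bicomplex m K)))"
proof (rule inj_onI)
  fix b c assume bc: "b \<in> carrier (total (cochain_bicomplex m K))" "c \<in> carrier (total (cochain_bicomplex m K))"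
    "cochain_to_koszul b = cochain_to_koszul c"
  then have k: "Poly_Mapping.keys b \<subseteq> cochain_basis m K" "Poly_Mapping.keys c \<subseteq> cochain_basis m K"
    by (simp_all add: cochain_carrier)
  have "cochain_to_mon b = cochain_to_mon c"
    using bc(3) mon_to_koszul_eq_iff[OF k[THEN keys_cochain_to_mon(2)]] by (simp add: cochain_to_koszul_def)
  then have "mon_to_cochain (cochain_to_mon b) = mon_to_cochain (cochain_to_mon c)" by simp
  then show "b = c" unfolding mon_to_cochain_to_mon[OF k(1)] mon_to_cochain_to_mon[OF k(2)] .
qed

lemma cochain_to_koszul_diff:
  assumes "c \<in> carrier (total (cochain_bicomplex m K))"
  shows "cochain_to_koszul (cochain_d K c) = koszul_d m K (cochain_to_koszul c)"
    and "cochain_to_koszul (cochain_d' c) = koszul_d' m K (cochain_to_koszul c)"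
  using assms unfolding cochain_carrier cochain_to_koszul_def
  by (simp_all add: cochain_to_mon_d cochain_to_mon_d' mon_to_koszul_d mon_to_koszul_d' keys_cochain_to_mon)

lemma cochain_to_koszul_carrier:
  "cochain_to_koszul ` carrier (total (cochain_bicomplex m K)) = carrier (R_group m K)"
  unfolding carrier_R_group cochain_to_mon_carrier[OF K_subset, symmetric]
  by (simp add: image_image cochain_to_koszul_def)

lemma cochain_to_koszul_piece:
  "cochain_to_koszul ` piece (cochain_bicomplex m K) p q = koszul_piece m K p q \<inter> carrier (R_group m K)"
proof -
  have inj: "inj_on (mon_to_koszul m K) (carrier (free_Abelian_group (monomials m K)))"
    by (rule inj_onI) (simp add: mon_to_koszul_eq_iff)
  have "koszul_piece m K p q \<inter> carrier (R_group m K) = mon_to_koszul m K `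
      (carrier (free_Abelian_group (monomial_piece m K p q)) \<inter> carrier (free_Abelian_group (squarefree_monomials m K)))"
    unfolding koszul_piece_eq carrier_R_group
    by (rule inj_on_image_Int[OF inj, symmetric]) (auto simp: monomial_piece_def squarefree_monomials_def)
  also have "carrier (free_Abelian_group (monomial_piece m K p q)) \<inter> carrier (free_Abelian_group (squarefree_monomials m K)) =
      cochain_to_mon ` piece (cochain_bicomplex m K) p q"
    unfolding cochain_to_mon_piece[OF K_subset] by auto
  finally show ?thesis by (simp add: image_image cochain_to_koszul_def)
qed

lemma cochain_anticommuting:
  "anticommuting_differentials (cochain_bicomplex m K) (diff (cochain_bicomplex m K)) (diff' (cochain_bicomplex m K))"
proof (rule anticommuting_differentials_reflect[OF koszul_anticommuting])
  show "comm_group (total (cochain_bicomplex m K))"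
    by (simp add: cochain_bicomplex_def abelian_free_Abelian_group)
  show "diff (cochain_bicomplex m K) \<in> hom (total (cochain_bicomplex m K)) (total (cochain_bicomplex m K))"
    by (rule homI) (simp_all add: cochain_bicomplex_def keys_cochain_d, simp add: cochain_d_def frag_extend_add)
  show "diff' (cochain_bicomplex m K) \<in> hom (total (cochain_bicomplex m K)) (total (cochain_bicomplex m K))"
    by (rule homI) (simp_all add: cochain_bicomplex_def keys_cochain_d', simp add: cochain_d'_def frag_extend_add)
  show "cochain_to_koszul \<in> hom (total (cochain_bicomplex m K)) (total (koszul_bicomplex m K))"
    by (rule cochain_to_koszul_hom)
  show "inj_on cochain_to_koszul (carrier (total (cochain_bicomplex m K)))"
    by (rule cochain_to_koszul_inj)
  fix c assume c: "c \<in> carrier (total (cochain_bicomplex m K))"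
  have "diff (cochain_bicomplex m K) = cochain_d K" "diff' (cochain_bicomplex m K) = cochain_d'"
    "diff (koszul_bicomplex m K) = koszul_d m K" "diff' (koszul_bicomplex m K) = koszul_d' m K"
    by (simp_all add: cochain_bicomplex_def koszul_bicomplex_def)
  note [simp] = this
  show "cochain_to_koszul (diff (cochain_bicomplex m K) c) = diff (koszul_bicomplex m K) (cochain_to_koszul c)"
    "cochain_to_koszul (diff' (cochain_bicomplex m K) c) = diff' (koszul_bicomplex m K) (cochain_to_koszul c)"
    using cochain_to_koszul_diff[OF c] by simp_all
qed

lemma mon_cocycle_decomposition:
  assumes c: "Poly_Mapping.keys c \<subseteq> monomials m K" "mon_d K c = 0"
  shows "c = mon_d K (mon_homotopy c) + squarefree_part c"
  using mon_homotopy_identity[OF c(1)] c(2) by (simp add: mon_homotopy_def diff_eq_eq)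

text \<open>Surjectivity on cohomology. By the homotopy identity a cocycle \<open>c\<close> is
  \<open>d (h c)\<close> plus its squarefree part, which comes from a cochain. The squarefree part only involves
  monomials occurring in \<open>c\<close>, whence the parameter \<open>T\<close>: with \<open>T\<close> the monomials of one bidegree, the
  cochain is found in that bidegree.\<close>

lemma koszul_cocycle_decomposition:
  assumes T: "T \<subseteq> monomials m K"
    and y: "y \<in> mon_to_koszul m K ` carrier (free_Abelian_group T)" "koszul_d m K y = \<zero>\<^bsub>koszul_algebra m K\<^esub>"
  shows "\<exists>b. Poly_Mapping.keys b \<subseteq> cochain_basis m K \<and> cochain_d K b = 0 \<and>
    Poly_Mapping.keys (cochain_to_mon b) \<subseteq> T \<and>
    (\<exists>w\<in>carrier (koszul_algebra m K). y = koszul_d m K w \<oplus>\<^bsub>koszul_algebra m K\<^esub> cochain_to_koszul b)"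
proof -
  obtain c where c: "y = mon_to_koszul m K c" "Poly_Mapping.keys c \<subseteq> T" using y(1) by auto
  then have cM: "Poly_Mapping.keys c \<subseteq> monomials m K" using T by blast
  have zero: "\<zero>\<^bsub>koszul_algebra m K\<^esub> = mon_to_koszul m K 0"
    unfolding koszul_zero mon_to_koszul_def by (rule kclass_cong) (simp add: mon_coeffs_simps)
  have "mon_d K c = 0"
    using y(2) mon_to_koszul_d[OF cM] mon_to_koszul_eq_iff[OF keys_mon_d[OF cM], of 0] by (simp add: c(1) zero)
  then have dec: "c = mon_d K (mon_homotopy c) + squarefree_part c" "mon_d K (squarefree_part c) = 0"
    using mon_cocycle_decomposition[OF cM] squarefree_part_mon_d[OF cM] by (simp_all add: squarefree_part_def)
  have sq: "Poly_Mapping.keys (squarefree_part c) \<subseteq> squarefree_monomials m K"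
    "Poly_Mapping.keys (squarefree_part c) \<subseteq> T" "Poly_Mapping.keys (squarefree_part c) \<subseteq> monomials m K"
    using keys_squarefree_part[of c] cM c(2) by (auto simp: squarefree_monomials_def)
  have h: "Poly_Mapping.keys (mon_homotopy c) \<subseteq> monomials m K" by (rule keys_mon_homotopy[OF K_subset cM])
  have "squarefree_part c \<in> cochain_to_mon ` carrier (total (cochain_bicomplex m K))"
    unfolding cochain_to_mon_carrier[OF K_subset] using sq by simp
  then obtain b where b: "squarefree_part c = cochain_to_mon b" "Poly_Mapping.keys b \<subseteq> cochain_basis m K"
    by (auto simp: cochain_carrier)
  have "mon_to_cochain (cochain_to_mon (cochain_d K b)) = 0"
    unfolding cochain_to_mon_d[OF b(2)] b(1)[symmetric] dec(2) by (simp add: mon_to_cochain_def)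
  then have "cochain_d K b = 0" unfolding mon_to_cochain_to_mon[OF keys_cochain_d[OF b(2)]] .
  moreover have "y = koszul_d m K (mon_to_koszul m K (mon_homotopy c)) \<oplus>\<^bsub>koszul_algebra m K\<^esub> cochain_to_koszul b"
    using hom_mult[OF mon_to_koszul_hom, of "mon_d K (mon_homotopy c)" "squarefree_part c"] h sq dec(1)
      keys_mon_d[OF h]
    by (simp add: c(1) cochain_to_koszul_def mon_to_koszul_d flip: b(1))
  moreover have "mon_to_koszul m K (mon_homotopy c) \<in> carrier (koszul_algebra m K)"
    using h mon_to_koszul_hom by (auto simp: hom_def)
  ultimately show ?thesis using b sq(2) by auto
qed

text \<open>Injectivity on cohomology. If a squarefree element is \<open>d c\<close>, then it is also \<open>d\<close> of the
  squarefree part of \<open>c\<close>, because taking squarefree parts commutes with \<open>d\<close>.\<close>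

lemma cochain_to_koszul_reflects_coboundaries:
  assumes b: "Poly_Mapping.keys b \<subseteq> cochain_basis m K" and w: "w \<in> carrier (koszul_algebra m K)"
    and eq: "cochain_to_koszul b = koszul_d m K w"
  shows "\<exists>a. Poly_Mapping.keys a \<subseteq> cochain_basis m K \<and> b = cochain_d K a"
proof -
  obtain c where c: "w = mon_to_koszul m K c" "Poly_Mapping.keys c \<subseteq> monomials m K"
    using w unfolding mon_to_koszul_surj[symmetric] by auto
  have "cochain_to_mon b = mon_d K c"
    using eq mon_to_koszul_eq_iff[OF keys_cochain_to_mon(2)[OF b] keys_mon_d[OF c(2)]]
    by (simp add: cochain_to_koszul_def c mon_to_koszul_d)
  moreover have "squarefree_part (cochain_to_mon b) = cochain_to_mon b"
    using keys_cochain_to_mon(1)[OF b] by (intro squarefree_part_eq) (auto simp: squarefree_monomials_def)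
  ultimately have "cochain_to_mon b = mon_d K (squarefree_part c)"
    by (simp add: squarefree_part_mon_d[OF c(2)])
  moreover have "squarefree_part c \<in> cochain_to_mon ` carrier (total (cochain_bicomplex m K))"
    unfolding cochain_to_mon_carrier[OF K_subset]
    using keys_squarefree_part[of c] c(2) by (auto simp: squarefree_monomials_def)
  then obtain a where a: "squarefree_part c = cochain_to_mon a" "Poly_Mapping.keys a \<subseteq> cochain_basis m K"
    by (auto simp: cochain_carrier)
  ultimately have "cochain_to_mon b = cochain_to_mon (cochain_d K a)"
    by (simp add: cochain_to_mon_d)
  then have "mon_to_cochain (cochain_to_mon b) = mon_to_cochain (cochain_to_mon (cochain_d K a))" by simp
  then show ?thesis
    unfolding mon_to_cochain_to_mon[OF b] mon_to_cochain_to_mon[OF keys_cochain_d[OF a(2)]] using a(2) by blast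
qed

lemma cochain_to_koszul_quasi_isomorphism:
  "quasi_isomorphism (cochain_bicomplex m K) (diff (cochain_bicomplex m K))
     (koszul_bicomplex m K) (diff (koszul_bicomplex m K)) cochain_to_koszul"
proof -
  interpret C: anticommuting_differentials "cochain_bicomplex m K" "diff (cochain_bicomplex m K)"
    "diff' (cochain_bicomplex m K)" by (rule cochain_anticommuting)
  interpret E: anticommuting_differentials "koszul_bicomplex m K" "diff (koszul_bicomplex m K)"
    "diff' (koszul_bicomplex m K)" by (rule koszul_anticommuting)
  have C [simp]: "diff (cochain_bicomplex m K) = cochain_d K" "\<one>\<^bsub>total (cochain_bicomplex m K)\<^esub> = 0"
    and E [simp]: "diff (koszul_bicomplex m K) = koszul_d m K" "piece (koszul_bicomplex m K) = koszul_piece m K"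
    "total (koszul_bicomplex m K) = add_monoid (koszul_algebra m K)"
    by (simp_all add: cochain_bicomplex_def koszul_bicomplex_def)
  have zero: "cochain_to_koszul 0 = \<zero>\<^bsub>koszul_algebra m K\<^esub>"
    unfolding koszul_zero cochain_to_koszul_def mon_to_koszul_def cochain_to_mon_def
    by (rule kclass_cong) (simp add: mon_coeffs_simps)
  have lift: "\<exists>b\<in>S \<inter> C.cocycles. \<exists>w\<in>carrier (total (koszul_bicomplex m K)).
      y = diff (koszul_bicomplex m K) w \<otimes>\<^bsub>total (koszul_bicomplex m K)\<^esub> cochain_to_koszul b"
    if T: "T \<subseteq> monomials m K" and y: "y \<in> mon_to_koszul m K ` carrier (free_Abelian_group T)" "y \<in> E.cocycles"
      and S: "\<And>b. Poly_Mapping.keys b \<subseteq> cochain_basis m K \<Longrightarrow> Poly_Mapping.keys (cochain_to_mon b) \<subseteq> T \<Longrightarrow> b \<in> S"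
    for y S T
  proof -
    have "koszul_d m K y = \<zero>\<^bsub>koszul_algebra m K\<^esub>" using y(2) by (simp add: kernel_def)
    from koszul_cocycle_decomposition[OF T y(1) this]
    obtain b w where b: "Poly_Mapping.keys b \<subseteq> cochain_basis m K" "cochain_d K b = 0"
      "Poly_Mapping.keys (cochain_to_mon b) \<subseteq> T" "w \<in> carrier (koszul_algebra m K)"
      "y = koszul_d m K w \<oplus>\<^bsub>koszul_algebra m K\<^esub> cochain_to_koszul b" by blast
    then have "b \<in> S \<inter> C.cocycles" using S by (simp add: kernel_def cochain_carrier)
    then show ?thesis using b(4,5) by (intro bexI[of _ b] bexI[of _ w]) simp_all
  qed
  show ?thesis
  proof (intro quasi_isomorphism.intro cocycle_map.intro C.differential_group_axioms E.differential_group_axioms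
      cocycle_map_axioms.intro quasi_isomorphism_axioms.intro)
    show "cochain_to_koszul \<in> hom (total (cochain_bicomplex m K)) (total (koszul_bicomplex m K))"
      by (rule cochain_to_koszul_hom)
    then have closed: "cochain_to_koszul x \<in> carrier (total (koszul_bicomplex m K))"
      if "x \<in> carrier (total (cochain_bicomplex m K))" for x
      using that by (auto simp: hom_def)
    show "cochain_to_koszul x \<in> E.cocycles" if "x \<in> C.cocycles" for x
      using that closed cochain_to_koszul_diff(1)[of x] by (simp add: kernel_def zero)
    show "cochain_to_koszul (diff (cochain_bicomplex m K) x) \<in> E.coboundaries"
      if "x \<in> carrier (total (cochain_bicomplex m K))" for x
      using that closed cochain_to_koszul_diff(1)[of x] by simp
    show "cochain_to_koszul ` piece (cochain_bicomplex m K) p q \<subseteq> piece (koszul_bicomplex m K) p q" for p q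
      by (simp add: cochain_to_koszul_piece)
    show "x \<in> C.coboundaries" if x: "x \<in> C.cocycles" "cochain_to_koszul x \<in> E.coboundaries" for x
    proof -
      have "Poly_Mapping.keys x \<subseteq> cochain_basis m K" using C.cocycles_closed[OF x(1)] by (simp add: cochain_carrier)
      moreover obtain w where "w \<in> carrier (koszul_algebra m K)" "cochain_to_koszul x = koszul_d m K w"
        using x(2) by auto
      ultimately obtain a where "Poly_Mapping.keys a \<subseteq> cochain_basis m K" "x = cochain_d K a"
        using cochain_to_koszul_reflects_coboundaries by blast
      then show ?thesis by (simp add: cochain_carrier)
    qed
    show "\<exists>x\<in>C.cocycles. \<exists>w\<in>carrier (total (koszul_bicomplex m K)).
        y = diff (koszul_bicomplex m K) w \<otimes>\<^bsub>total (koszul_bicomplex m K)\<^esub> cochain_to_koszul x"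
      if y: "y \<in> E.cocycles" for y
      using lift[OF order_refl _ y, of UNIV] E.cocycles_closed[OF y] by (simp add: mon_to_koszul_surj)
    show "\<exists>x\<in>piece (cochain_bicomplex m K) p q \<inter> C.cocycles. \<exists>w\<in>carrier (total (koszul_bicomplex m K)).
        y = diff (koszul_bicomplex m K) w \<otimes>\<^bsub>total (koszul_bicomplex m K)\<^esub> cochain_to_koszul x"
      if y: "y \<in> piece (koszul_bicomplex m K) p q \<inter> E.cocycles" for p q y
    proof (rule lift)
      show "monomial_piece m K p q \<subseteq> monomials m K" by (auto simp: monomial_piece_def)
      show "y \<in> mon_to_koszul m K ` carrier (free_Abelian_group (monomial_piece m K p q))"
        using y by (simp add: koszul_piece_eq)
      show "y \<in> E.cocycles" using y by blast
      fix b assume b: "Poly_Mapping.keys b \<subseteq> cochain_basis m K"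
        "Poly_Mapping.keys (cochain_to_mon b) \<subseteq> monomial_piece m K p q"
      then have "cochain_to_koszul b \<in> koszul_piece m K p q \<inter> carrier (R_group m K)"
        unfolding koszul_piece_eq carrier_R_group cochain_to_koszul_def using keys_cochain_to_mon(1)[OF b(1)] by auto
      then obtain b' where b': "b' \<in> piece (cochain_bicomplex m K) p q" "cochain_to_koszul b = cochain_to_koszul b'"
        unfolding cochain_to_koszul_piece[symmetric] by auto
      then have "b' \<in> carrier (total (cochain_bicomplex m K))" by (auto simp: cochain_bicomplex_def)
      then have "b = b'" using b' b(1) by (intro inj_onD[OF cochain_to_koszul_inj]) (simp_all add: cochain_carrier)
      then show "b \<in> piece (cochain_bicomplex m K) p q" using b' by simp
    qed
  qed
qed

lemma cochain_R_isomorphic: "bicomplex_isomorphic (cochain_bicomplex m K) (R_bicomplex m K)"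
proof -
  have "cochain_to_koszul \<in> iso (total (cochain_bicomplex m K)) (R_group m K)"
  proof (rule isoI)
    show "cochain_to_koszul \<in> hom (total (cochain_bicomplex m K)) (R_group m K)"
      using cochain_to_koszul_hom cochain_to_koszul_carrier
      by (auto simp: hom_def koszul_bicomplex_def R_group_def)
    show "bij_betw cochain_to_koszul (carrier (total (cochain_bicomplex m K))) (carrier (R_group m K))"
      using cochain_to_koszul_inj cochain_to_koszul_carrier by (simp add: bij_betw_def)
  qed
  moreover have "diff (cochain_bicomplex m K) = cochain_d K" "diff' (cochain_bicomplex m K) = cochain_d'"
    by (simp_all add: cochain_bicomplex_def)
  ultimately show ?thesis
    unfolding bicomplex_isomorphic_def bigraded_iso_def
    using cochain_to_koszul_piece cochain_to_koszul_diff
    by (intro exI[of _ cochain_to_koszul]) (simp add: R_bicomplex_def)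
qed

lemma HH_koszul_isomorphic:
  "bigraded_isomorphic (HH m K) (first_double_cohomology (koszul_bicomplex m K))"
  unfolding HH_def
proof (rule quasi_isomorphism_double_cohomology[OF cochain_anticommuting koszul_anticommuting
      cochain_to_koszul_quasi_isomorphism])
  fix c assume "c \<in> carrier (total (cochain_bicomplex m K))"
  then show "cochain_to_koszul (diff' (cochain_bicomplex m K) c) = diff' (koszul_bicomplex m K) (cochain_to_koszul c)"
    using cochain_to_koszul_diff(2) by (simp add: cochain_bicomplex_def koszul_bicomplex_def)
qed

end

theorem theorem4p3:
  fixes m :: nat and K :: "nat set set"
  assumes "simplicial_complex_on m K"
  shows "bicomplex_isomorphic (cochain_bicomplex m K) (R_bicomplex m K) \<and>
         bigraded_isomorphic (HH m K) (first_double_cohomology (koszul_bicomplex m K))"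
proof -
  interpret simplicial_complex m K by unfold_locales (rule assms)
  show ?thesis using cochain_R_isomorphic HH_koszul_isomorphic ..
qed

end
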